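(* Let $X$, $f_i$, $l_i$, $F$, $g_i$, $Z_n$ be as in the context. Assume that for all $t\le T$ and all $x,y\in\mathbb{R}^d$, $$|f_i(t,x)|\le C_i(1+|x|)\quad (i=1,\dots,k),\qquad |F(t,x)-F(t,y)|\le M|x-y|,$$ with finite constants $C_i$, $M$. Then for $t\le T$, $\lim_{n\to\infty}Z_n(t)=\bar Z(t)$ almost surely, where $\bar Z$ is the solution of $$\bar Z(t)=x_0+\sum_{i=1}^k l_i\int_0^t g_i\big(s,\bar Z(s)\big)\,ds ,$$ and furthermore $$\bar Z(t)=E[X(t)]=x_0+\sum_{i=1}^k l_i\int_0^t E\big[f_i(s,X(s))\big]\,ds .$$
   Context: Fix $T<\infty$, $d,k\ge 1$, a constant $x_0\in\mathbb{R}^d$, constant vectors $l_1,\dots,l_k\in\mathbb{Z}^d$, continuous functions $f_i:[0,T]\times\mathbb{R}^d\to\mathbb{R}$, and independent rate-1 Poisson processes $Y_1,\dots,Y_k$. $X$ is the $d$-dimensional process solving $$X(t)=x_0+\sum_{i=1}^k l_iY_i\Big(\int_0^t f_i(s,X(s))\,ds\Big),\qquad t\le T.$$ $F(t,x)=\sum_{i=1}^k l_if_i(t,x)$. The mean and covariance matrix of $X(t)$ are finite and bounded over $t\in[0,T]$. The "base distribution" $H_t$ is the law of $X(t)-E[X(t)]$ (a zero-mean distribution on $\mathbb{R}^d$), and $$g_i(t,x)=\int_{\mathbb{R}^d}f_i(t,y+x)\,dH_t(y),\qquad t\le T,\ x\in\mathbb{R}^d,$$ so that $g_i(t,E[X(t)])=E[f_i(t,X(t))]$.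 For each $n\in\mathbb{N}$, $Z_n$ is the process solving $$Z_n(t)=x_0+\sum_{i=1}^k\frac1n\,l_iY_i\Big(\int_0^t n\,g_i(s,Z_n(s))\,ds\Big),\qquad t\le T.$$ The rates are intensities: $f_i(s,X(s))$ and $g_i(s,Z_n(s))$ are nonnegative for all $s\le T$ and all $n$. *)

theory Defs
  imports "HOL-Probability.Probability"
begin

text \<open>
  A Poisson process of rate \<open>r\<close> indexed by the times \<open>t \<ge> 0\<close>; values at negative times are
  irrelevant. Since almost every path is nondecreasing, the truncated subtraction on \<open>nat\<close> gives
  the genuine increments almost surely.
\<close>

definition poisson_process :: "'a measure \<Rightarrow> real \<Rightarrow> (real \<Rightarrow> 'a \<Rightarrow> nat) \<Rightarrow> bool" where
  "poisson_process M r N \<longleftrightarrow>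
     (\<forall>t\<ge>0. N t \<in> measurable M (count_space UNIV)) \<and>
     (AE \<omega> in M. N 0 \<omega> = 0 \<and> mono_on {0..} (\<lambda>t. N t \<omega>) \<and>
        (\<forall>t\<ge>0. continuous (at_right t) (\<lambda>u. N u \<omega>))) \<and>
     (\<forall>s t. 0 \<le> s \<and> s \<le> t \<longrightarrow>
        distr M (count_space UNIV) (\<lambda>\<omega>. N t \<omega> - N s \<omega>) = measure_pmf (poisson_pmf (r * (t - s)))) \<and>
     (\<forall>(m::nat) \<tau>. 0 \<le> \<tau> 0 \<and> mono \<tau> \<longrightarrow>
        prob_space.indep_vars M (\<lambda>_. count_space UNIV) (\<lambda>j \<omega>. N (\<tau> (Suc j)) \<omega> - N (\<tau> j) \<omega>) {..<m})"

text \<open>Mutual independence of whole processes, viewed as random elements of the path space.\<close>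

definition independent_processes :: "'a measure \<Rightarrow> ('k \<Rightarrow> real \<Rightarrow> 'a \<Rightarrow> nat) \<Rightarrow> bool" where
  "independent_processes M Y \<longleftrightarrow>
     prob_space.indep_vars M (\<lambda>_. PiM {0..} (\<lambda>_. count_space UNIV)) (\<lambda>i \<omega>. \<lambda>t\<in>{0..}. Y i t \<omega>) UNIV"

text \<open>
  \<open>V\<close> solves the random time change equation
  \<open>V(t) = x0 + \<Sum>\<^sub>i l\<^sub>i Y\<^sub>i (\<integral>\<^sub>0\<^sup>t a\<^sub>i(s, V(s)) ds)\<close>, \<open>t \<in> [0,T]\<close>, outside a null set not depending on \<open>t\<close>.
  Existence of the time integrals is part of being a solution, as the Bochner integral of a
  non-integrable function is \<open>0\<close> by convention.
\<close>

definition time_change_solution ::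
  "'a measure \<Rightarrow> real \<Rightarrow> real^'d \<Rightarrow> ('k::finite \<Rightarrow> real^'d) \<Rightarrow> ('k \<Rightarrow> real \<Rightarrow> real^'d \<Rightarrow> real) \<Rightarrow>
   ('k \<Rightarrow> real \<Rightarrow> 'a \<Rightarrow> nat) \<Rightarrow> (real \<Rightarrow> 'a \<Rightarrow> real^'d) \<Rightarrow> bool" where
  "time_change_solution M T x0 l a Y V \<longleftrightarrow>
     (\<forall>t\<in>{0..T}. V t \<in> borel_measurable M) \<and>
     (AE \<omega> in M. \<forall>t\<in>{0..T}.
        (\<forall>i. set_integrable lborel {0..t} (\<lambda>s. a i s (V s \<omega>))) \<and>
        V t \<omega> = x0 + (\<Sum>i\<in>UNIV. real (Y i (LBINT s:{0..t}. a i s (V s \<omega>)) \<omega>) *\<^sub>R l i))"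

definition fluid_solution ::
  "real \<Rightarrow> real^'d \<Rightarrow> ('k::finite \<Rightarrow> real^'d) \<Rightarrow> ('k \<Rightarrow> real \<Rightarrow> real^'d \<Rightarrow> real) \<Rightarrow>
   (real \<Rightarrow> real^'d) \<Rightarrow> bool" where
  "fluid_solution T x0 l a z \<longleftrightarrow>
     (\<forall>t\<in>{0..T}.
        (\<forall>i. set_integrable lborel {0..t} (\<lambda>s. a i s (z s))) \<and>
        z t = x0 + (\<Sum>i\<in>UNIV. (LBINT s:{0..t}. a i s (z s)) *\<^sub>R l i))"

definition drift ::
  "('k::finite \<Rightarrow> real^'d) \<Rightarrow> ('k \<Rightarrow> real \<Rightarrow> real^'d \<Rightarrow> real) \<Rightarrow> real \<Rightarrow> real^'d \<Rightarrow> real^'d" where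
  "drift l f t x = (\<Sum>i\<in>UNIV. f i t x *\<^sub>R l i)"

definition covariance_matrix :: "'a measure \<Rightarrow> ('a \<Rightarrow> real^'d) \<Rightarrow> real^'d^'d" where
  "covariance_matrix M V =
     (\<chi> p q. LINT \<omega>|M. (V \<omega> $ p - integral\<^sup>L M V $ p) * (V \<omega> $ q - integral\<^sup>L M V $ q))"

definition finite_mean_covariance :: "'a measure \<Rightarrow> ('a \<Rightarrow> real^'d) \<Rightarrow> bool" where
  "finite_mean_covariance M V \<longleftrightarrow>
     integrable M V \<and>
     (\<forall>p q. integrable M (\<lambda>\<omega>. (V \<omega> $ p - integral\<^sup>L M V $ p) * (V \<omega> $ q - integral\<^sup>L M V $ q)))"

definition base_distribution :: "'a measure \<Rightarrow> (real \<Rightarrow> 'a \<Rightarrow> real^'d) \<Rightarrow> real \<Rightarrow> (real^'d) measure" where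
  "base_distribution M X t = distr M borel (\<lambda>\<omega>. X t \<omega> - integral\<^sup>L M (X t))"

definition averaged_rate ::
  "'a measure \<Rightarrow> (real \<Rightarrow> 'a \<Rightarrow> real^'d) \<Rightarrow> ('k \<Rightarrow> real \<Rightarrow> real^'d \<Rightarrow> real) \<Rightarrow>
   'k \<Rightarrow> real \<Rightarrow> real^'d \<Rightarrow> real" where
  "averaged_rate M X f i t x = (LINT y|base_distribution M X t. f i t (y + x))"

end

theory Submission
  imports Defs "HOL-Real_Asymp.Real_Asymp"
begin

text \<open>
  The averaged rates satisfy \<open>g i t (E X(t)) = E f i t (X(t))\<close>, so \<open>t \<mapsto> E X(t)\<close> solves the fluid equation
  as soon as \<open>E Y\<^sub>i(\<tau>\<^sub>i(t)) = E \<tau>\<^sub>i(t)\<close> for the internal clocks \<open>\<tau>\<^sub>i(t) = \<integral>\<^sub>0\<^sup>t f\<^sub>i(s, X(s)) ds\<close>.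
  This identity is optional stopping: the time change equation is solved jump by jump, so the event
  \<open>\<tau>\<^sub>i(t) \<le> s\<close> is a measurable function of \<open>Y\<^sub>i\<close> on \<open>[0, s]\<close> and of the other driving processes, hence
  independent of the later increments of \<open>Y\<^sub>i\<close>; approximate \<open>\<tau>\<^sub>i(t)\<close> from above on a grid and pass to the limit.
  Averaging preserves the Lipschitz bound on the drift, which gives uniqueness by Gronwall. The law of
  large numbers \<open>Y\<^sub>i(u) / u \<rightarrow> 1\<close> gives an almost sure bound on \<open>Z\<^sub>n\<close> uniform in \<open>n\<close>, and then,
  again by Gronwall, the convergence.
\<close>

text \<open>Neither a filtration nor joint measurability of \<open>X\<close> in time and outcome is
  given, so the only access to the event \<open>\<tau>\<^sub>i(t) \<le> s\<close> is the equation
  itself. Hence it is solved explicitly: between jumps the counts are constant and every clock is a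
  known function of real time. The clocks advance at different speeds, and when clock
  \<open>i\<close> shows \<open>s\<close> another clock may show any value; the past of clock
  \<open>i\<close> must therefore contain the complete paths of the other processes, which
  independence allows. The chain has to be measurable on the whole space of pasts, so its driving
  paths must be step paths everywhere and not just almost surely.

  The moment bounds and linear growth make the clocks integrable, so optional stopping works without
  localisation, and integrability of the stopped count is part of its conclusion. The Lipschitz
  bound concerns the drift and not the single rates, so in the limit argument the clocks are
  compared only through their sum weighted by the jump vectors. The law of large numbers enters as
  \<open>\<bar>Y(v) - v\<bar> \<le> A + \<delta> * v\<close> for all \<open>v \<ge> 0\<close>, a
  form that survives the rescaling by \<open>n\<close>.\<close>

section \<open>Right-continuous step paths and their jump chains\<close>

text \<open>
  For every function \<open>y\<close> this is a nondecreasing, right-continuous step path, it depends on countably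
  many values of \<open>y\<close> only, and it agrees with \<open>y\<close> on \<open>[0, \<infinity>)\<close> when \<open>y\<close> is a path of a counting process.
  Hence paths can be evaluated measurably at random times without discarding a null set.
\<close>

definition rc_version :: "(real \<Rightarrow> nat) \<Rightarrow> real \<Rightarrow> nat" where
  "rc_version y u = (INF q\<in>{q\<in>\<rat>. u < q}. y q)"

definition right_constant :: "(real \<Rightarrow> nat) \<Rightarrow> bool" where
  "right_constant y \<longleftrightarrow> (\<forall>u. \<exists>e>0. \<forall>w. u \<le> w \<and> w < u + e \<longrightarrow> y w = y u)"

lemma rationals_above_nonempty: "{q\<in>\<rat>. u < q} \<noteq> {}" for u :: real
  using Rats_dense_in_real[of u "u + 1"] by auto

lemma rc_version_le: "q \<in> \<rat> \<Longrightarrow> u < q \<Longrightarrow> rc_version y u \<le> y q"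
  unfolding rc_version_def by (intro cINF_lower) auto

lemma rc_version_attained: "\<exists>q\<in>\<rat>. u < q \<and> y q = rc_version y u"
proof -
  have "(INF q\<in>{q\<in>\<rat>. u < q}. y q) \<in> y ` {q\<in>\<rat>. u < q}"
    using rationals_above_nonempty by (intro Inf_nat_def1) auto
  then show ?thesis unfolding rc_version_def by force
qed

lemma mono_rc_version: "mono (rc_version y)"
proof
  fix u w :: real assume "u \<le> w"
  then show "rc_version y u \<le> rc_version y w"
    using rc_version_attained[of w y] rc_version_le[of _ u y] by force
qed

lemma right_constant_rc_version: "right_constant (rc_version y)"
  unfolding right_constant_def
proof
  fix u
  obtain q where q: "q \<in> \<rat>" "u < q" "y q = rc_version y u"
    using rc_version_attained by blast
  show "\<exists>e>0. \<forall>w. u \<le> w \<and> w < u + e \<longrightarrow> rc_version y w = rc_version y u"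
  proof (intro exI[of _ "q - u"] conjI allI impI)
    fix w assume w: "u \<le> w \<and> w < u + (q - u)"
    then have "rc_version y w \<le> y q" by (intro rc_version_le q(1)) simp
    moreover have "rc_version y u \<le> rc_version y w" using w by (intro monoD[OF mono_rc_version]) simp
    ultimately show "rc_version y w = rc_version y u" using q(3) by simp
  qed (use q in simp)
qed

lemma rc_version_eqI:
  assumes "e > 0" "\<And>w. u < w \<Longrightarrow> w < u + e \<Longrightarrow> y w = c" "\<And>w. u < w \<Longrightarrow> c \<le> y w"
  shows "rc_version y u = c"
proof -
  obtain q where q: "q \<in> \<rat>" "u < q" "q < u + e"
    using Rats_dense_in_real[of u "u + e"] assms(1) by auto
  show ?thesis
    using rc_version_le[OF q(1,2), of y] assms(2)[OF q(2,3)] assms(3) rc_version_attained[of u y] by force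
qed

lemma right_continuous_nat_const:
  fixes y :: "real \<Rightarrow> nat"
  assumes "continuous (at_right u) y"
  shows "\<exists>e>0. \<forall>w. u < w \<and> w < u + e \<longrightarrow> y w = y u"
proof -
  have "\<forall>\<^sub>F w in at_right u. y w = y u"
    using assms by (simp add: continuous_within tendsto_discrete)
  then obtain b where "b > u" "\<forall>w>u. w < b \<longrightarrow> y w = y u"
    by (auto simp: eventually_at_right_field)
  then show ?thesis by (intro exI[of _ "b - u"]) auto
qed

lemma rc_version_eq:
  assumes "mono_on {0..} y" "\<And>u. 0 \<le> u \<Longrightarrow> continuous (at_right u) y" "0 \<le> u"
  shows "rc_version y u = y u"
proof -
  obtain e where "e > 0" "\<forall>w. u < w \<and> w < u + e \<longrightarrow> y w = y u"
    using right_continuous_nat_const assms(2,3) by blast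
  then show ?thesis
    using assms(1,3) by (intro rc_version_eqI[of e]) (auto simp: mono_on_def)
qed

text \<open>The delicate point is \<open>u = s\<close>: the rationals above \<open>s\<close> lie
  outside the past, but stopping gives all of them the value \<open>y s\<close>, so even the value
  at \<open>s\<close> is recovered from \<open>y\<close> on \<open>[0, s]\<close> alone.\<close>

lemma rc_version_stopped_eq:
  assumes "mono_on {0..} y" "\<And>u. 0 \<le> u \<Longrightarrow> continuous (at_right u) y" "0 \<le> u" "u \<le> s"
  shows "rc_version (\<lambda>q. y (min q s)) u = y u"
proof (cases "u = s")
  case True
  then show ?thesis by (intro rc_version_eqI[of 1]) auto
next
  case False
  obtain e where e: "e > 0" "\<forall>w. u < w \<and> w < u + e \<longrightarrow> y w = y u"
    using right_continuous_nat_const assms(2,3) by blast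
  show ?thesis
  proof (rule rc_version_eqI[of "min e (s - u)"])
    show "y u \<le> y (min w s)" if "u < w" for w
      using assms(3,4) that by (intro mono_onD[OF assms(1)]) auto
  qed (use e False assms(4) in auto)
qed

text \<open>The infimum is at most \<open>k\<close> iff some rational beyond the random time has a
  value at most \<open>k\<close>, a countable union. A nonnegative random time restricts the union
  to rationals \<open>q \<ge> 0\<close>, where the coordinates are measurable.\<close>

lemma measurable_rc_version:
  assumes W: "\<And>q. 0 \<le> q \<Longrightarrow> (\<lambda>\<omega>. W \<omega> q) \<in> measurable G (count_space UNIV)"
    and a[measurable]: "a \<in> borel_measurable G" and pos: "\<And>\<omega>. \<omega> \<in> space G \<Longrightarrow> 0 \<le> a \<omega>"
  shows "(\<lambda>\<omega>. rc_version (W \<omega>) (a \<omega>)) \<in> measurable G (count_space UNIV)"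
proof -
  have le: "Measurable.pred G (\<lambda>\<omega>. rc_version (W \<omega>) (a \<omega>) \<le> k)" for k
  proof -
    have [measurable]: "(\<lambda>\<omega>. W \<omega> q) \<in> measurable G (count_space UNIV)" if "q \<in> \<rat> \<inter> {0..}" for q
      using W that by auto
    have "Measurable.pred G (\<lambda>\<omega>. \<exists>q\<in>\<rat> \<inter> {0..}. a \<omega> < q \<and> W \<omega> q \<le> k)"
      by (intro measurable_pred_countable countable_Int1 countable_rat) measurable
    moreover have "rc_version (W \<omega>) (a \<omega>) \<le> k \<longleftrightarrow> (\<exists>q\<in>\<rat> \<inter> {0..}. a \<omega> < q \<and> W \<omega> q \<le> k)"
      if \<omega>: "\<omega> \<in> space G" for \<omega>
    proof
      assume le: "rc_version (W \<omega>) (a \<omega>) \<le> k"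
      obtain q where q: "q \<in> \<rat>" "a \<omega> < q" "W \<omega> q = rc_version (W \<omega>) (a \<omega>)"
        using rc_version_attained by blast
      show "\<exists>q\<in>\<rat> \<inter> {0..}. a \<omega> < q \<and> W \<omega> q \<le> k"
        using q le pos[OF \<omega>] by (intro bexI[of _ q]) auto
    next
      assume "\<exists>q\<in>\<rat> \<inter> {0..}. a \<omega> < q \<and> W \<omega> q \<le> k"
      then show "rc_version (W \<omega>) (a \<omega>) \<le> k"
        by (auto intro: order.trans[OF rc_version_le])
    qed
    ultimately show ?thesis by (simp cong: measurable_cong)
  qed
  show ?thesis
  proof (subst measurable_count_space_eq2_countable, intro conjI ballI)
    fix k
    have "Measurable.pred G (\<lambda>\<omega>. rc_version (W \<omega>) (a \<omega>) \<le> k \<and> \<not> (k > 0 \<and> rc_version (W \<omega>) (a \<omega>) \<le> k - 1))"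
      using le by measurable
    moreover have "(\<lambda>\<omega>. rc_version (W \<omega>) (a \<omega>)) -` {k} \<inter> space G =
       {\<omega>\<in>space G. rc_version (W \<omega>) (a \<omega>) \<le> k \<and> \<not> (k > 0 \<and> rc_version (W \<omega>) (a \<omega>) \<le> k - 1)}"
      by auto
    ultimately show "(\<lambda>\<omega>. rc_version (W \<omega>) (a \<omega>)) -` {k} \<inter> space G \<in> sets G"
      by (simp add: pred_def)
  qed auto
qed

section \<open>Jump chain of a system of clocks\<close>

definition counting_paths :: "('k \<Rightarrow> real \<Rightarrow> nat) \<Rightarrow> bool" where
  "counting_paths y \<longleftrightarrow> (\<forall>j. mono (y j) \<and> right_constant (y j))"

lemma counting_paths_mono: "counting_paths y \<Longrightarrow> mono (y j)"
  and counting_paths_right_constant: "counting_paths y \<Longrightarrow> right_constant (y j)"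
  by (simp_all add: counting_paths_def)

text \<open>
  \<open>R j c u\<close> is the internal time that clock \<open>j\<close> accumulates up to real time \<open>u\<close> while the vector of
  counts is held at \<open>c\<close>. From real time \<open>\<sigma>\<close> and internal times \<open>a\<close>, the next jump occurs at the first
  time at which some clock reaches a jump of its counting path; the horizon \<open>t\<close> caps this time.
\<close>

definition jump_time :: "real \<Rightarrow> ('k \<Rightarrow> ('k \<Rightarrow> nat) \<Rightarrow> real \<Rightarrow> real) \<Rightarrow> ('k \<Rightarrow> real \<Rightarrow> nat) \<Rightarrow> real \<Rightarrow> ('k \<Rightarrow> real) \<Rightarrow> real" where
  "jump_time t R y \<sigma> a =
     (let c = (\<lambda>j. y j (a j)) in
      Inf (insert t {u\<in>{\<sigma>..t}. \<exists>j. c j < y j (a j + R j c u - R j c \<sigma>)}))"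

definition chain_step where
  "chain_step t R y p =
     (let \<sigma> = fst p; a = snd p; c = (\<lambda>j. y j (a j)); \<sigma>' = jump_time t R y \<sigma> a in
      (\<sigma>', \<lambda>j. a j + R j c \<sigma>' - R j c \<sigma>))"

definition jump_chain ::
  "real \<Rightarrow> ('k \<Rightarrow> ('k \<Rightarrow> nat) \<Rightarrow> real \<Rightarrow> real) \<Rightarrow> ('k \<Rightarrow> real \<Rightarrow> nat) \<Rightarrow> nat \<Rightarrow> real \<times> ('k \<Rightarrow> real)" where
  "jump_chain t R y n = (chain_step t R y ^^ n) (0, \<lambda>_. 0)"

lemma jump_chain_0: "jump_chain t R y 0 = (0, \<lambda>_. 0)"
  by (simp add: jump_chain_def)

lemma jump_chain_Suc: "jump_chain t R y (Suc n) = chain_step t R y (jump_chain t R y n)"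
  by (simp add: jump_chain_def)

locale clocks =
  fixes R :: "'k::finite \<Rightarrow> ('k \<Rightarrow> nat) \<Rightarrow> real \<Rightarrow> real" and t :: real
  assumes clock_mono: "mono (R j c)" and clock_cont: "continuous_on UNIV (R j c)" and t_nonneg: "0 \<le> t"
begin

text \<open>The last claim says that the infimum is attained: counting paths are constant to the
  right of every point and the clocks are continuous and nondecreasing, so counts unchanged at the
  infimum would stay unchanged on a right neighbourhood.\<close>

lemma
  assumes y: "counting_paths y" and \<sigma>: "\<sigma> \<le> t"
    and c: "c = (\<lambda>j. y j (a j))"
  shows jump_time_ge: "\<sigma> \<le> jump_time t R y \<sigma> a"
    and jump_time_le: "jump_time t R y \<sigma> a \<le> t"
    and before_jump: "\<sigma> \<le> u \<Longrightarrow> u < jump_time t R y \<sigma> a \<Longrightarrow> y j (a j + R j c u - R j c \<sigma>) = c j"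
    and at_jump: "jump_time t R y \<sigma> a < t \<Longrightarrow>
       \<exists>j. c j < y j (a j + R j c (jump_time t R y \<sigma> a) - R j c \<sigma>)"
proof -
  define S where "S = insert t {u\<in>{\<sigma>..t}. \<exists>j. c j < y j (a j + R j c u - R j c \<sigma>)}"
  have jt: "jump_time t R y \<sigma> a = Inf S"
    by (simp only: jump_time_def S_def c Let_def)
  have bdd: "bdd_below S" by (rule bdd_belowI[of _ \<sigma>]) (use \<sigma> in \<open>auto simp: S_def\<close>)
  show ge: "\<sigma> \<le> jump_time t R y \<sigma> a"
    unfolding jt by (rule cInf_greatest) (use \<sigma> in \<open>auto simp: S_def\<close>)
  show le: "jump_time t R y \<sigma> a \<le> t"
    unfolding jt by (rule cInf_lower[OF _ bdd]) (auto simp: S_def)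
  have c_le: "c j \<le> y j (a j + R j c u - R j c \<sigma>)" if "\<sigma> \<le> u" for u j
    unfolding c using that monoD[OF clock_mono, of \<sigma> u j "\<lambda>j. y j (a j)"] by (intro monoD[OF counting_paths_mono[OF y]]) simp
  show "y j (a j + R j c u - R j c \<sigma>) = c j" if "\<sigma> \<le> u" "u < jump_time t R y \<sigma> a" for u j
  proof (rule ccontr)
    assume "y j (a j + R j c u - R j c \<sigma>) \<noteq> c j"
    then have "u \<in> S" using c_le[OF that(1), of j] that le by (auto simp: S_def intro!: exI[of _ j])
    then have "Inf S \<le> u" using bdd by (rule cInf_lower)
    then show False using that jt by simp
  qed
  show "\<exists>j. c j < y j (a j + R j c (jump_time t R y \<sigma> a) - R j c \<sigma>)" if lt: "jump_time t R y \<sigma> a < t"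
  proof (rule ccontr)
    define v where "v = jump_time t R y \<sigma> a"
    assume "\<not> ?thesis"
    then have eq: "y j (a j + R j c v - R j c \<sigma>) = c j" for j
      using c_le[OF ge, of j] by (auto simp: v_def le_less)
    have ev: "\<forall>\<^sub>F u in at_right v. \<forall>j\<in>UNIV. y j (a j + R j c u - R j c \<sigma>) = c j"
    proof (intro eventually_ball_finite ballI)
      fix j
      obtain e where e: "e > 0" "\<And>w. a j + R j c v - R j c \<sigma> \<le> w \<Longrightarrow> w < a j + R j c v - R j c \<sigma> + e \<Longrightarrow>
          y j w = y j (a j + R j c v - R j c \<sigma>)"
        using counting_paths_right_constant[OF y, of j] unfolding right_constant_def by meson
      have "(R j c \<longlongrightarrow> R j c v) (at_right v)"
        using clock_cont[of j c] by (auto simp: continuous_on_def intro: tendsto_within_subset)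
      then have "\<forall>\<^sub>F u in at_right v. R j c u < R j c v + e"
        using e(1) by (intro order_tendstoD(2)) auto
      moreover have "\<forall>\<^sub>F u in at_right v. v < u"
        by (simp add: eventually_at_right_less)
      ultimately show "\<forall>\<^sub>F u in at_right v. y j (a j + R j c u - R j c \<sigma>) = c j"
      proof eventually_elim
        case (elim u)
        then have "R j c v \<le> R j c u" by (intro monoD[OF clock_mono]) simp
        then show ?case using elim e(2)[of "a j + R j c u - R j c \<sigma>"] eq[of j] by simp
      qed
    qed simp
    then obtain b where b: "b > v" "\<And>u. v < u \<Longrightarrow> u < b \<Longrightarrow> \<forall>j. y j (a j + R j c u - R j c \<sigma>) = c j"
      by (auto simp: eventually_at_right_field)
    have "min b t \<le> Inf S"
    proof (rule cInf_greatest)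
      fix u assume u: "u \<in> S"
      have "v \<le> u" using cInf_lower[OF u bdd] by (simp add: v_def jt)
      moreover have "u = v \<Longrightarrow> u = t" using u eq by (auto simp: S_def)
      ultimately show "min b t \<le> u"
      proof (cases "u < b \<and> u \<noteq> v")
        case True
        then have "\<forall>j. y j (a j + R j c u - R j c \<sigma>) = c j" using \<open>v \<le> u\<close> by (intro b(2)) auto
        then show ?thesis using u by (auto simp: S_def)
      qed auto
    qed (auto simp: S_def)
    then show False using b(1) lt by (simp add: jt v_def)
  qed
qed

lemma jump_time_unique:
  assumes y: "counting_paths y" and \<sigma>: "\<sigma> \<le> t"
    and c: "c = (\<lambda>j. y j (a j))"
    and s: "\<sigma> \<le> s" "s \<le> t"
    and bef: "\<And>u j. \<sigma> \<le> u \<Longrightarrow> u < s \<Longrightarrow> y j (a j + R j c u - R j c \<sigma>) = c j"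
    and at: "s < t \<Longrightarrow> \<exists>j. c j < y j (a j + R j c s - R j c \<sigma>)"
  shows "jump_time t R y \<sigma> a = s"
proof (rule linorder_cases[of "jump_time t R y \<sigma> a" s])
  note jl = jump_time_ge[OF y \<sigma> c] jump_time_le[OF y \<sigma> c] before_jump[OF y \<sigma> c] at_jump[OF y \<sigma> c]
  { assume l: "jump_time t R y \<sigma> a < s"
    then obtain j where "c j < y j (a j + R j c (jump_time t R y \<sigma> a) - R j c \<sigma>)"
      using jl(4) s by auto
    with bef[OF jl(1) l, of j] show ?thesis by simp }
  { assume l: "s < jump_time t R y \<sigma> a"
    then obtain j where "c j < y j (a j + R j c s - R j c \<sigma>)" using at jl(2) by auto
    with jl(3)[OF s(1) l, of j] show ?thesis by simp }
qed

lemma jump_chain_bounds: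
  assumes y: "counting_paths y"
  shows "0 \<le> fst (jump_chain t R y n) \<and> fst (jump_chain t R y n) \<le> t"
proof (induction n)
  case (Suc n)
  then show ?case
    using jump_time_ge[OF y, of _ _ "snd (jump_chain t R y n)"] jump_time_le[OF y, of _ _ "snd (jump_chain t R y n)"]
    by (force simp: jump_chain_Suc chain_step_def Let_def)
qed (simp add: jump_chain_0 t_nonneg)

lemma jump_chain_clock_mono:
  assumes y: "counting_paths y"
  shows "snd (jump_chain t R y n) j \<le> snd (jump_chain t R y (Suc n)) j"
  using jump_time_ge[OF y, of "fst (jump_chain t R y n)" _ "snd (jump_chain t R y n)"] jump_chain_bounds[OF y, of n]
  by (auto simp: jump_chain_Suc chain_step_def Let_def intro!: monoD[OF clock_mono])

lemma jump_chain_clock_nonneg: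
  assumes y: "counting_paths y"
  shows "0 \<le> snd (jump_chain t R y n) j"
proof (induction n)
  case (Suc n) then show ?case using jump_chain_clock_mono[OF y, of n j] by simp
qed (simp add: jump_chain_0)

text \<open>Non-anticipation. Up to step \<open>n\<close> the chain reads path \<open>i\<close> only
  at internal times not exceeding the current value of clock \<open>i\<close>; if that value is at
  most \<open>s\<close>, nothing beyond \<open>s\<close> is ever consulted. The bound is imposed on
  one chain only, so the roles can be exchanged and the event "clock \<open>i\<close> is at most
  \<open>s\<close>" is the same for both.\<close>

lemma jump_chain_agree:
  assumes y: "counting_paths y"
    and y': "counting_paths y'"
    and eq: "\<And>u. 0 \<le> u \<Longrightarrow> u \<le> s \<Longrightarrow> y i u = y' i u"
    and eq': "\<And>j u. j \<noteq> i \<Longrightarrow> 0 \<le> u \<Longrightarrow> y j u = y' j u"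
    and le: "snd (jump_chain t R y n) i \<le> s"
  shows "jump_chain t R y n = jump_chain t R y' n"
  using le
proof (induction n)
  case 0
  then show ?case by (simp add: jump_chain_0)
next
  case (Suc n)
  define \<sigma> a where "\<sigma> = fst (jump_chain t R y n)" and "a = snd (jump_chain t R y n)"
  have "a i \<le> s" using Suc.prems jump_chain_clock_mono[OF y, of n i] by (simp add: a_def)
  then have IH: "jump_chain t R y n = jump_chain t R y' n" using Suc.IH by (simp add: a_def)
  have a0: "0 \<le> a j" for j using jump_chain_clock_nonneg[OF y] by (simp add: a_def)
  have \<sigma>t: "\<sigma> \<le> t" using jump_chain_bounds[OF y] by (simp add: \<sigma>_def)
  define c where "c = (\<lambda>j. y j (a j))"
  have c': "c = (\<lambda>j. y' j (a j))"
  proof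
    fix j show "c j = y' j (a j)"
      using eq[of "a i"] eq'[of j "a j"] a0 \<open>a i \<le> s\<close> by (cases "j = i") (auto simp: c_def)
  qed
  define \<sigma>' where "\<sigma>' = jump_time t R y \<sigma> a"
  have ai: "a i + R i c \<sigma>' - R i c \<sigma> \<le> s"
    using Suc.prems by (simp add: jump_chain_Suc chain_step_def Let_def \<sigma>'_def c_def \<sigma>_def a_def)
  note jt = jump_time_ge[OF y \<sigma>t c_def, folded \<sigma>'_def] jump_time_le[OF y \<sigma>t c_def, folded \<sigma>'_def]
    before_jump[OF y \<sigma>t c_def, folded \<sigma>'_def] at_jump[OF y \<sigma>t c_def, folded \<sigma>'_def]
  \<comment> \<open>Up to the next jump, and including it, clock \<open>i\<close> is below its value
    after the step, hence below \<open>s\<close>.\<close>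
  have same: "y j (a j + R j c u - R j c \<sigma>) = y' j (a j + R j c u - R j c \<sigma>)" if "\<sigma> \<le> u" "u \<le> \<sigma>'" for u j
  proof -
    have "R j c \<sigma> \<le> R j c u" for j using that by (intro monoD[OF clock_mono])
    then have nn: "0 \<le> a j + R j c u - R j c \<sigma>" for j using a0[of j] by (smt (verit))
    have "R i c u \<le> R i c \<sigma>'" using that by (intro monoD[OF clock_mono])
    then show ?thesis using nn[of j] ai eq eq'[of j] by (cases "j = i") auto
  qed
  have "jump_time t R y' \<sigma> a = \<sigma>'"
  proof (rule jump_time_unique[OF y' \<sigma>t c'])
    show "y' j (a j + R j c u - R j c \<sigma>) = c j" if "\<sigma> \<le> u" "u < \<sigma>'" for u j
      using same[of u j] jt(3)[OF that] that by simp
    show "\<exists>j. c j < y' j (a j + R j c \<sigma>' - R j c \<sigma>)" if "\<sigma>' < t"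
      using jt(4)[OF that] same[OF jt(1)] by auto
  qed (use jt in auto)
  then have "chain_step t R y' (\<sigma>, a) = chain_step t R y (\<sigma>, a)"
    by (simp add: chain_step_def Let_def \<sigma>'_def flip: c' c_def)
  then show ?case
    by (simp add: jump_chain_Suc flip: IH) (simp add: \<sigma>_def a_def)
qed

lemma jump_chain_le_iff:
  assumes y: "counting_paths y"
    and y': "counting_paths y'"
    and eq: "\<And>u. 0 \<le> u \<Longrightarrow> u \<le> s \<Longrightarrow> y i u = y' i u"
    and eq': "\<And>j u. j \<noteq> i \<Longrightarrow> 0 \<le> u \<Longrightarrow> y j u = y' j u"
  shows "snd (jump_chain t R y n) i \<le> s \<longleftrightarrow> snd (jump_chain t R y' n) i \<le> s"
proof
  assume "snd (jump_chain t R y n) i \<le> s"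
  moreover from this have "jump_chain t R y n = jump_chain t R y' n"
    by (rule jump_chain_agree[OF y y', rotated 2]) (use eq eq' in auto)
  ultimately show "snd (jump_chain t R y' n) i \<le> s" by simp
next
  assume "snd (jump_chain t R y' n) i \<le> s"
  moreover from this have "jump_chain t R y' n = jump_chain t R y n"
    by (rule jump_chain_agree[OF y' y, rotated 2]) (use eq eq' in auto)
  ultimately show "snd (jump_chain t R y n) i \<le> s" by simp
qed

text \<open>The time change equation stripped of its integrals: clocks evolve by \<open>R\<close> as
  long as the counts are frozen. The interval for \<open>w\<close> is half-open, so the increment is
  known up to and including the time \<open>u\<close> at which the counts may change.\<close>

definition runs :: "('k \<Rightarrow> real \<Rightarrow> nat) \<Rightarrow> ('k \<Rightarrow> real \<Rightarrow> real) \<Rightarrow> bool" where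
  "runs y \<tau> \<longleftrightarrow> (\<forall>j. \<tau> j 0 = 0 \<and> continuous_on {0..t} (\<tau> j) \<and> mono_on {0..t} (\<tau> j)) \<and>
     (\<forall>\<sigma> u c j. 0 \<le> \<sigma> \<and> \<sigma> \<le> u \<and> u \<le> t \<and> (\<forall>w. \<sigma> \<le> w \<and> w < u \<longrightarrow> (\<lambda>j. y j (\<tau> j w)) = c) \<longrightarrow>
        \<tau> j u = \<tau> j \<sigma> + R j c u - R j c \<sigma>)"

text \<open>The second claim excludes explosion: every step that ends before the horizon raises the
  total count by at least one, so \<open>n\<close> such steps force a total count of at least
  \<open>n\<close>.\<close>

lemma jump_chain_tracks:
  assumes y: "counting_paths y"
    and run: "runs y \<tau>"
  shows "snd (jump_chain t R y n) = (\<lambda>j. \<tau> j (fst (jump_chain t R y n)))"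
    and "fst (jump_chain t R y n) = t \<or> n \<le> (\<Sum>j\<in>UNIV. y j (\<tau> j (fst (jump_chain t R y n))))"
proof -
  have \<tau>0: "\<tau> j 0 = 0" and \<tau>_cont: "continuous_on {0..t} (\<tau> j)" and \<tau>_mono: "mono_on {0..t} (\<tau> j)" for j
    using run by (simp_all add: runs_def)
  have evol: "\<tau> j u = \<tau> j \<sigma> + R j c u - R j c \<sigma>"
    if "0 \<le> \<sigma>" "\<sigma> \<le> u" "u \<le> t" "\<And>w. \<sigma> \<le> w \<Longrightarrow> w < u \<Longrightarrow> (\<lambda>j. y j (\<tau> j w)) = c" for \<sigma> u c j
    using run that by (simp add: runs_def)
  have "snd (jump_chain t R y n) = (\<lambda>j. \<tau> j (fst (jump_chain t R y n))) \<and>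
    (fst (jump_chain t R y n) = t \<or> n \<le> (\<Sum>j\<in>UNIV. y j (\<tau> j (fst (jump_chain t R y n)))))"
  proof (induction n)
    case 0
    show ?case by (simp add: jump_chain_0 \<tau>0)
  next
    case (Suc n)
    define \<sigma> where "\<sigma> = fst (jump_chain t R y n)"
    define a where "a = (\<lambda>j. \<tau> j \<sigma>)"
    define c where "c = (\<lambda>j. y j (a j))"
    have a: "snd (jump_chain t R y n) = a" using Suc by (simp add: a_def \<sigma>_def)
    have \<sigma>t: "\<sigma> \<le> t" and \<sigma>0: "0 \<le> \<sigma>" using jump_chain_bounds[OF y] by (simp_all add: \<sigma>_def)
    define \<sigma>' where "\<sigma>' = jump_time t R y \<sigma> a"
    note jt = jump_time_ge[OF y \<sigma>t c_def, folded \<sigma>'_def] jump_time_le[OF y \<sigma>t c_def, folded \<sigma>'_def]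
      before_jump[OF y \<sigma>t c_def, folded \<sigma>'_def] at_jump[OF y \<sigma>t c_def, folded \<sigma>'_def]
    have const: "(\<lambda>j. y j (\<tau> j w)) = c" if w: "\<sigma> \<le> w" "w < \<sigma>'" for w
    proof (rule ccontr)
      assume neq: "(\<lambda>j. y j (\<tau> j w)) \<noteq> c"
      define S where "S = {w. \<sigma> \<le> w \<and> w < \<sigma>' \<and> (\<lambda>j. y j (\<tau> j w)) \<noteq> c}"
      define u where "u = Inf S"
      have wS: "w \<in> S" using w neq by (simp add: S_def)
      have bdd: "bdd_below S" by (rule bdd_belowI[of _ \<sigma>]) (auto simp: S_def)
      have uw: "u \<le> w" unfolding u_def by (rule cInf_lower[OF wS bdd])
      have \<sigma>u: "\<sigma> \<le> u" unfolding u_def by (rule cInf_greatest) (use wS in \<open>auto simp: S_def\<close>)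
      have ut: "u < \<sigma>'" "u < t" using uw w jt(2) by auto
      have bef: "(\<lambda>j. y j (\<tau> j v)) = c" if "\<sigma> \<le> v" "v < u" for v
        using cInf_lower[OF _ bdd, of v] that ut by (fastforce simp: u_def S_def)
      have \<tau>u: "\<tau> j u = a j + R j c u - R j c \<sigma>" for j
        unfolding a_def by (rule evol) (use \<sigma>0 \<sigma>u ut bef in auto)
      have cu: "y j (\<tau> j u) = c j" for j
        using jt(3)[OF \<sigma>u ut(1)] by (simp add: \<tau>u)
      have "\<forall>\<^sub>F v in at_right u. \<forall>j\<in>UNIV. y j (\<tau> j v) = c j"
      proof (intro eventually_ball_finite ballI)
        fix j
        obtain e where e: "e > 0" "\<And>w. \<tau> j u \<le> w \<Longrightarrow> w < \<tau> j u + e \<Longrightarrow> y j w = y j (\<tau> j u)"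
          using counting_paths_right_constant[OF y, of j] unfolding right_constant_def by meson
        have "(\<tau> j \<longlongrightarrow> \<tau> j u) (at u within {0..t})"
          using \<tau>_cont[of j] \<sigma>0 \<sigma>u ut by (auto simp: continuous_on_def)
        then have "(\<tau> j \<longlongrightarrow> \<tau> j u) (at u within {u..t})"
          by (rule tendsto_within_subset) (use \<sigma>0 \<sigma>u in auto)
        moreover have "at u within {u..t} = at_right u"
          using ut(2) by (simp add: at_within_Icc_at_right)
        ultimately have "(\<tau> j \<longlongrightarrow> \<tau> j u) (at_right u)" by simp
        then have "\<forall>\<^sub>F v in at_right u. \<tau> j v < \<tau> j u + e"
          using e(1) by (intro order_tendstoD(2)) auto
        moreover have "\<forall>\<^sub>F v in at_right u. u < v \<and> v < t"
          using ut(2) by (auto simp: eventually_at_right_field)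
        ultimately show "\<forall>\<^sub>F v in at_right u. y j (\<tau> j v) = c j"
        proof eventually_elim
          case (elim v)
          then have "\<tau> j u \<le> \<tau> j v" using \<sigma>0 \<sigma>u by (intro mono_onD[OF \<tau>_mono]) auto
          then show ?case using elim e(2) cu by simp
        qed
      qed simp
      then obtain b where b: "b > u" "\<And>v. u < v \<Longrightarrow> v < b \<Longrightarrow> \<forall>j. y j (\<tau> j v) = c j"
        by (auto simp: eventually_at_right_field)
      have "b \<le> Inf S"
      proof (rule cInf_greatest)
        fix v assume v: "v \<in> S"
        have "u \<le> v" unfolding u_def by (rule cInf_lower[OF v bdd])
        moreover have "u \<noteq> v" using v cu by (auto simp: S_def)
        ultimately have "v < b \<Longrightarrow> (\<lambda>j. y j (\<tau> j v)) = c" using b(2)[of v] by auto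
        then show "b \<le> v" using v by (force simp: S_def)
      qed (use wS in auto)
      then show False using b(1) by (simp add: u_def)
    qed
    have \<tau>': "\<tau> j \<sigma>' = a j + R j c \<sigma>' - R j c \<sigma>" for j
      unfolding a_def by (rule evol) (use \<sigma>0 jt const in auto)
    have step: "jump_chain t R y (Suc n) = (\<sigma>', \<lambda>j. \<tau> j \<sigma>')"
      by (simp add: jump_chain_Suc chain_step_def Let_def a \<tau>' flip: \<sigma>_def) (simp add: \<sigma>'_def c_def \<tau>')
    have "\<sigma>' = t \<or> Suc n \<le> (\<Sum>j\<in>UNIV. y j (\<tau> j \<sigma>'))"
    proof (cases "\<sigma>' < t")
      case True
      then obtain i where i: "c i < y i (\<tau> i \<sigma>')" using jt(4) \<tau>' by auto
      have "c j \<le> y j (\<tau> j \<sigma>')" for j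
        unfolding c_def a_def using \<sigma>0 jt(1,2) by (intro monoD[OF counting_paths_mono[OF y]] mono_onD[OF \<tau>_mono]) auto
      then have "(\<Sum>j\<in>UNIV. c j) < (\<Sum>j\<in>UNIV. y j (\<tau> j \<sigma>'))"
        using i by (intro sum_strict_mono_ex1) (auto intro: finite)
      moreover have "\<sigma> < t" using True jt(1) by simp
      then have "n \<le> (\<Sum>j\<in>UNIV. c j)" using Suc by (simp add: c_def a_def flip: \<sigma>_def)
      ultimately show ?thesis by simp
    qed (use jt(2) in simp)
    then show ?case by (simp add: step)
  qed
  then show "snd (jump_chain t R y n) = (\<lambda>j. \<tau> j (fst (jump_chain t R y n)))"
    and "fst (jump_chain t R y n) = t \<or> n \<le> (\<Sum>j\<in>UNIV. y j (\<tau> j (fst (jump_chain t R y n))))"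
    by auto
qed

text \<open>The chain increases to the clock and reaches it after finitely many steps. The number of
  steps is random; quantifying over all \<open>n\<close> instead makes the event a countable
  intersection.\<close>

lemma clock_le_iff_jump_chain:
  assumes y: "counting_paths y"
    and run: "runs y \<tau>"
  shows "\<tau> i t \<le> s \<longleftrightarrow> (\<forall>n. snd (jump_chain t R y n) i \<le> s)"
proof -
  have \<tau>_mono: "mono_on {0..t} (\<tau> j)" for j
    using run by (simp_all add: runs_def)
  note tr = jump_chain_tracks[OF y run]
  have mono: "\<tau> j (fst (jump_chain t R y n)) \<le> \<tau> j t" for j n
    using jump_chain_bounds[OF y, of n] t_nonneg by (intro mono_onD[OF \<tau>_mono]) auto
  \<comment> \<open>One more than the total count at the horizon, so the chain cannot still be short
    of \<open>t\<close> after \<open>N\<close> steps.\<close>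
  define N where "N = Suc (\<Sum>j\<in>UNIV. y j (\<tau> j t))"
  have "(\<Sum>j\<in>UNIV. y j (\<tau> j (fst (jump_chain t R y N)))) < N"
    unfolding N_def less_Suc_eq_le by (intro sum_mono monoD[OF counting_paths_mono[OF y]] mono)
  then have "fst (jump_chain t R y N) = t" using tr(2)[of N] by (meson leD)
  then have at_N: "snd (jump_chain t R y N) i = \<tau> i t" using tr(1)[of N] by simp
  have below: "snd (jump_chain t R y n) i \<le> \<tau> i t" for n using mono[of i n] by (subst tr(1))
  show ?thesis
  proof
    assume "\<tau> i t \<le> s"
    then show "\<forall>n. snd (jump_chain t R y n) i \<le> s" using below order.trans by blast
  next
    assume "\<forall>n. snd (jump_chain t R y n) i \<le> s"
    then show "\<tau> i t \<le> s" using at_N by (metis)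
  qed
qed

text \<open>The jump time is an infimum over uncountably many times. Once a clock has reached a jump
  of its path it stays beyond it, so \<open>\<sigma>' < r\<close> with \<open>r \<le> t\<close> can
  be tested at rational times.\<close>

lemma measurable_jump_chain:
  fixes W :: "'w \<Rightarrow> 'k \<Rightarrow> real \<Rightarrow> nat"
  assumes W: "\<And>j q. 0 \<le> q \<Longrightarrow> (\<lambda>\<omega>. W \<omega> j q) \<in> measurable G (count_space UNIV)"
  defines "y \<equiv> \<lambda>\<omega> j. rc_version (W \<omega> j)"
  shows "(\<lambda>\<omega>. snd (jump_chain t R (y \<omega>) n) j) \<in> borel_measurable G"
proof -
  have y: "counting_paths (y \<omega>)" for \<omega>
    by (simp add: counting_paths_def y_def mono_rc_version right_constant_rc_version)
  have "(\<lambda>\<omega>. fst (jump_chain t R (y \<omega>) n)) \<in> borel_measurable G \<and>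
    (\<forall>j. (\<lambda>\<omega>. snd (jump_chain t R (y \<omega>) n) j) \<in> borel_measurable G)"
  proof (induction n)
    case 0
    show ?case by (simp add: jump_chain_0)
  next
    case (Suc n)
    define \<sigma> a where "\<sigma> = (\<lambda>\<omega>. fst (jump_chain t R (y \<omega>) n))" and "a = (\<lambda>\<omega>. snd (jump_chain t R (y \<omega>) n))"
    define c where "c = (\<lambda>\<omega> j. y \<omega> j (a \<omega> j))"
    have [measurable]: "\<sigma> \<in> borel_measurable G" "\<And>j. (\<lambda>\<omega>. a \<omega> j) \<in> borel_measurable G"
      using Suc by (simp_all add: \<sigma>_def a_def)
    have a0: "0 \<le> a \<omega> j" for \<omega> j using jump_chain_clock_nonneg[OF y] by (simp add: a_def)
    have \<sigma>t: "\<sigma> \<omega> \<le> t" for \<omega> using jump_chain_bounds[OF y] by (simp add: \<sigma>_def)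
    have yu[measurable]: "(\<lambda>\<omega>. y \<omega> j (b \<omega>)) \<in> measurable G (count_space UNIV)"
      if [measurable]: "b \<in> borel_measurable G" and "\<And>\<omega>. 0 \<le> b \<omega>" for b j
      unfolding y_def using W that by (intro measurable_rc_version) auto
    have cj[measurable]: "(\<lambda>\<omega>. c \<omega> j) \<in> measurable G (count_space UNIV)" for j
      unfolding c_def using a0 by (intro yu) auto
    \<comment> \<open>The counts form a countable type, as there are finitely many clocks; this lets
      the random index \<open>c\<close> be substituted into \<open>R\<close>, which is measurable
      for each fixed index.\<close>
    have c[measurable]: "c \<in> measurable G (count_space UNIV)"
    proof (subst measurable_count_space_eq2_countable, intro conjI ballI)
      fix k :: "'k \<Rightarrow> nat"
      have "c -` {k} \<inter> space G = {\<omega>\<in>space G. \<forall>j. c \<omega> j = k j}" by auto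
      also have "\<dots> \<in> sets G" by measurable
      finally show "c -` {k} \<inter> space G \<in> sets G" .
    qed auto
    have Rm[measurable]: "(\<lambda>\<omega>. R j (c \<omega>) (b \<omega>)) \<in> borel_measurable G" if [measurable]: "b \<in> borel_measurable G" for b j
    proof (rule measurable_compose_countable[OF _ c])
      fix k
      have [measurable]: "R j k \<in> borel_measurable borel"
        by (rule borel_measurable_continuous_onI[OF clock_cont])
      show "(\<lambda>\<omega>. R j k (b \<omega>)) \<in> borel_measurable G" by measurable
    qed
    define \<sigma>' where "\<sigma>' = (\<lambda>\<omega>. jump_time t R (y \<omega>) (\<sigma> \<omega>) (a \<omega>))"
    have mR: "\<sigma> \<omega> \<le> u \<Longrightarrow> 0 \<le> a \<omega> j + R j (c \<omega>) u - R j (c \<omega>) (\<sigma> \<omega>)" for \<omega> u j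
      using a0[of \<omega> j] monoD[OF clock_mono, of "\<sigma> \<omega>" u j "c \<omega>"] by (simp add: algebra_simps)
    have jt: "\<sigma> \<omega> \<le> \<sigma>' \<omega>" "\<sigma>' \<omega> \<le> t" for \<omega>
      using jump_time_ge[OF y \<sigma>t c_def[THEN fun_cong]] jump_time_le[OF y \<sigma>t c_def[THEN fun_cong]]
      by (simp_all add: \<sigma>'_def)
    have jt3: "y \<omega> j (a \<omega> j + R j (c \<omega>) u - R j (c \<omega>) (\<sigma> \<omega>)) = c \<omega> j" if "\<sigma> \<omega> \<le> u" "u < \<sigma>' \<omega>" for \<omega> u j
      using before_jump[OF y \<sigma>t c_def[THEN fun_cong] that(1)] that(2) by (simp add: \<sigma>'_def)
    have jt4: "\<exists>j. c \<omega> j < y \<omega> j (a \<omega> j + R j (c \<omega>) (\<sigma>' \<omega>) - R j (c \<omega>) (\<sigma> \<omega>))" if "\<sigma>' \<omega> < t" for \<omega>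
      using at_jump[OF y \<sigma>t c_def[THEN fun_cong]] that by (simp add: \<sigma>'_def)
    \<comment> \<open>For a fixed \<open>q\<close> the clock value may be negative at outcomes with
      \<open>q < \<sigma> \<omega>\<close>. The \<open>max 0\<close> makes the evaluation measurable
      there and changes nothing when \<open>\<sigma> \<omega> \<le> q\<close>.\<close>
    have \<sigma>'_less: "\<sigma>' \<omega> < r \<longleftrightarrow> t < r \<or> (\<exists>q\<in>\<rat> \<inter> {..<r} \<inter> {..t}. \<sigma> \<omega> \<le> q \<and>
        (\<exists>j. c \<omega> j < y \<omega> j (max 0 (a \<omega> j + R j (c \<omega>) q - R j (c \<omega>) (\<sigma> \<omega>)))))" (is "_ \<longleftrightarrow> t < r \<or> ?Q") for r \<omega>
    proof
      assume l: "\<sigma>' \<omega> < r"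
      show "t < r \<or> ?Q"
      proof (cases "t < r")
        case False
        then obtain j where j: "c \<omega> j < y \<omega> j (a \<omega> j + R j (c \<omega>) (\<sigma>' \<omega>) - R j (c \<omega>) (\<sigma> \<omega>))"
          using jt4[of \<omega>] l by auto
        obtain q where q: "q \<in> \<rat>" "\<sigma>' \<omega> < q" "q < r" using Rats_dense_in_real[OF l] by auto
        have "\<sigma> \<omega> \<le> q" using q jt(1)[of \<omega>] by simp
        have "R j (c \<omega>) (\<sigma>' \<omega>) \<le> R j (c \<omega>) q" using q by (intro monoD[OF clock_mono]) simp
        then have "y \<omega> j (a \<omega> j + R j (c \<omega>) (\<sigma>' \<omega>) - R j (c \<omega>) (\<sigma> \<omega>)) \<le> y \<omega> j (max 0 (a \<omega> j + R j (c \<omega>) q - R j (c \<omega>) (\<sigma> \<omega>)))"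
          by (intro monoD[OF counting_paths_mono[OF y]]) simp
        with j have ?Q using q False \<open>\<sigma> \<omega> \<le> q\<close>
          by (intro bexI[of _ q] conjI exI[of _ j]) auto
        then show ?thesis ..
      qed simp
    next
      assume "t < r \<or> ?Q"
      then show "\<sigma>' \<omega> < r"
      proof
        assume "t < r" then show ?thesis using jt(2)[of \<omega>] by simp
      next
        assume ?Q
        then obtain q j where q: "q < r" "\<sigma> \<omega> \<le> q" and j: "c \<omega> j < y \<omega> j (max 0 (a \<omega> j + R j (c \<omega>) q - R j (c \<omega>) (\<sigma> \<omega>)))"
          by auto
        then show ?thesis using jt3[of \<omega> q j] mR[OF q(2), of j] by (cases "q < \<sigma>' \<omega>") auto
      qed
    qed
    have [measurable]: "\<sigma>' \<in> borel_measurable G"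
      unfolding borel_measurable_iff_less
    proof (rule allI)
      fix r
      have [measurable]: "(\<lambda>\<omega>. c \<omega> j) \<in> borel_measurable G" for j
        by (rule measurable_compose[OF cj borel_measurable_count_space])
      have [measurable]: "(\<lambda>\<omega>. y \<omega> j (max 0 (a \<omega> j + R j (c \<omega>) q - R j (c \<omega>) (\<sigma> \<omega>)))) \<in> borel_measurable G" for j q
        by (rule measurable_compose[OF yu borel_measurable_count_space]) auto
      have "Measurable.pred G (\<lambda>\<omega>. \<sigma> \<omega> \<le> q \<and>
        (\<exists>j. c \<omega> j < y \<omega> j (max 0 (a \<omega> j + R j (c \<omega>) q - R j (c \<omega>) (\<sigma> \<omega>)))))" for q
        by measurable
      then have "Measurable.pred G (\<lambda>\<omega>. t < r \<or> (\<exists>q\<in>\<rat> \<inter> {..<r} \<inter> {..t}. \<sigma> \<omega> \<le> q \<and>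
        (\<exists>j. c \<omega> j < y \<omega> j (max 0 (a \<omega> j + R j (c \<omega>) q - R j (c \<omega>) (\<sigma> \<omega>))))))"
        by (intro pred_intros_logic measurable_pred_countable countable_Int1 countable_rat) auto
      then show "{\<omega> \<in> space G. \<sigma>' \<omega> < r} \<in> sets G" by (simp only: \<sigma>'_less pred_def)
    qed
    have "jump_chain t R (y \<omega>) (Suc n) = (\<sigma>' \<omega>, \<lambda>j. a \<omega> j + R j (c \<omega>) (\<sigma>' \<omega>) - R j (c \<omega>) (\<sigma> \<omega>))" for \<omega>
      by (simp add: jump_chain_Suc chain_step_def Let_def \<sigma>'_def c_def \<sigma>_def a_def)
    then show ?case by auto
  qed
  then show "(\<lambda>\<omega>. snd (jump_chain t R (y \<omega>) n) j) \<in> borel_measurable G" by auto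
qed

end

section \<open>Poisson processes\<close>

lemma measure_pmf_nat_integral_sums:
  fixes f :: "nat \<Rightarrow> real"
  assumes nn: "\<And>k. 0 \<le> f k" and s: "(\<lambda>k. f k * pmf p k) sums S"
  shows "integrable (measure_pmf p) f" "integral\<^sup>L (measure_pmf p) f = S"
proof -
  have "summable (\<lambda>k. norm (pmf p k *\<^sub>R f k))"
    using sums_summable[OF s] nn by (simp add: mult.commute)
  then have i: "integrable (count_space UNIV) (\<lambda>k. pmf p k *\<^sub>R f k)"
    by (simp add: integrable_count_space_nat_iff)
  then show "integrable (measure_pmf p) f"
    by (simp add: measure_pmf_eq_density integrable_density)
  have "integral\<^sup>L (measure_pmf p) f = integral\<^sup>L (count_space UNIV) (\<lambda>k. pmf p k *\<^sub>R f k)"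
    by (simp add: measure_pmf_eq_density integral_density)
  also have "\<dots> = (\<Sum>k. pmf p k *\<^sub>R f k)" using i by (rule integral_count_space_nat)
  also have "\<dots> = S" using s by (simp add: mult.commute sums_iff)
  finally show "integral\<^sup>L (measure_pmf p) f = S" .
qed

text \<open>Both moments come from \<open>r * p k = (k + 1) * p (k + 1)\<close>: multiplying a
  series by \<open>r\<close> shifts it by one index. The factorial second moment is the one that
  shifts into the mean.\<close>

lemma
  assumes r: "0 < r"
  shows poisson_sums: "pmf (poisson_pmf r) sums 1"
    and poisson_mean_sums: "(\<lambda>k. real k * pmf (poisson_pmf r) k) sums r"
    and poisson_factorial_moment_sums: "(\<lambda>k. real k * (real k - 1) * pmf (poisson_pmf r) k) sums r\<^sup>2"
proof -
  have "(\<lambda>k. r ^ k /\<^sub>R fact k) sums exp r" by (rule exp_converges)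
  then have "(\<lambda>k. (r ^ k /\<^sub>R fact k) * exp (-r)) sums (exp r * exp (-r))"
    by (rule sums_mult2)
  moreover have "(\<lambda>k. (r ^ k /\<^sub>R fact k) * exp (-r)) = pmf (poisson_pmf r)"
    by (rule ext) (use r in \<open>simp add: divide_inverse mult.commute\<close>)
  ultimately show 1: "pmf (poisson_pmf r) sums 1" by (simp add: exp_minus)
  have "(\<lambda>k. r * pmf (poisson_pmf r) k) sums (r * 1)" using 1 by (rule sums_mult)
  moreover have "r * pmf (poisson_pmf r) k = real (Suc k) * pmf (poisson_pmf r) (Suc k)" for k
    using r by (simp del: of_nat_Suc)
  ultimately have "(\<lambda>k. real (Suc k) * pmf (poisson_pmf r) (Suc k)) sums r" by simp
  then show 2: "(\<lambda>k. real k * pmf (poisson_pmf r) k) sums r"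
    by (subst (asm) sums_Suc_iff) simp
  have "(\<lambda>k. r * (real k * pmf (poisson_pmf r) k)) sums (r * r)" using 2 by (rule sums_mult)
  moreover have "r * (real k * pmf (poisson_pmf r) k) = real (Suc k) * (real (Suc k) - 1) * pmf (poisson_pmf r) (Suc k)" for k
  proof -
    have "r * (real k * pmf (poisson_pmf r) k) = real k * (r * pmf (poisson_pmf r) k)" by simp
    also have "r * pmf (poisson_pmf r) k = real (Suc k) * pmf (poisson_pmf r) (Suc k)"
      using r by (simp del: of_nat_Suc)
    finally show ?thesis by simp
  qed
  ultimately have "(\<lambda>k. real (Suc k) * (real (Suc k) - 1) * pmf (poisson_pmf r) (Suc k)) sums (r * r)" by simp
  then show "(\<lambda>k. real k * (real k - 1) * pmf (poisson_pmf r) k) sums r\<^sup>2"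
    by (subst (asm) sums_Suc_iff) (simp add: power2_eq_square)
qed

lemma
  assumes r: "0 < r"
  shows integrable_poisson: "integrable (measure_pmf (poisson_pmf r)) real"
    and poisson_mean: "integral\<^sup>L (measure_pmf (poisson_pmf r)) real = r"
    and integrable_poisson_square: "integrable (measure_pmf (poisson_pmf r)) (\<lambda>k. (real k - r)\<^sup>2)"
    and poisson_variance: "integral\<^sup>L (measure_pmf (poisson_pmf r)) (\<lambda>k. (real k - r)\<^sup>2) = r"
proof -
  show "integrable (measure_pmf (poisson_pmf r)) real" "integral\<^sup>L (measure_pmf (poisson_pmf r)) real = r"
    by (rule measure_pmf_nat_integral_sums[OF _ poisson_mean_sums[OF r]]; simp)+
  let ?p = "pmf (poisson_pmf r)"
  \<comment> \<open>This is
    \<open>(k - r)\<^sup>2 = k * (k - 1) + (1 - 2 * r) * k + r\<^sup>2\<close>, termwise.\<close>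
  have "(\<lambda>k. real k * (real k - 1) * ?p k + (1 - 2 * r) * (real k * ?p k) + r\<^sup>2 * ?p k) sums (r\<^sup>2 + (1 - 2 * r) * r + r\<^sup>2 * 1)"
    using poisson_sums[OF r] poisson_mean_sums[OF r] poisson_factorial_moment_sums[OF r]
    by (intro sums_add sums_mult)
  moreover have "real k * (real k - 1) * ?p k + (1 - 2 * r) * (real k * ?p k) + r\<^sup>2 * ?p k = (real k - r)\<^sup>2 * ?p k" for k
    by (simp only: power2_eq_square algebra_simps)
  moreover have "r\<^sup>2 + (1 - 2 * r) * r + r\<^sup>2 * 1 = r" by (simp add: power2_eq_square algebra_simps)
  ultimately have s: "(\<lambda>k. (real k - r)\<^sup>2 * ?p k) sums r" by simp
  show "integrable (measure_pmf (poisson_pmf r)) (\<lambda>k. (real k - r)\<^sup>2)"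
    "integral\<^sup>L (measure_pmf (poisson_pmf r)) (\<lambda>k. (real k - r)\<^sup>2) = r"
    by (rule measure_pmf_nat_integral_sums[OF _ s]; simp)+
qed

section \<open>Increments and the strong law of large numbers\<close>

lemma poisson_process_measurable:
  "poisson_process M r N \<Longrightarrow> 0 \<le> t \<Longrightarrow> N t \<in> measurable M (count_space UNIV)"
  by (simp add: poisson_process_def)

lemma poisson_process_AE:
  assumes "poisson_process M r N"
  shows "AE \<omega> in M. N 0 \<omega> = 0 \<and> mono_on {0..} (\<lambda>t. N t \<omega>) \<and> (\<forall>t\<ge>0. continuous (at_right t) (\<lambda>u. N u \<omega>))"
  using assms by (simp add: poisson_process_def)

lemma
  assumes N: "poisson_process M 1 N" and st: "0 \<le> s" "s < t"
  shows integrable_poisson_increment: "integrable M (\<lambda>\<omega>. real (N t \<omega> - N s \<omega>))"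
    and poisson_increment_mean: "(LINT \<omega>|M. real (N t \<omega> - N s \<omega>)) = t - s"
    and integrable_poisson_increment_square: "integrable M (\<lambda>\<omega>. (real (N t \<omega> - N s \<omega>) - (t - s))\<^sup>2)"
    and poisson_increment_variance: "(LINT \<omega>|M. (real (N t \<omega> - N s \<omega>) - (t - s))\<^sup>2) = t - s"
proof -
  have [measurable]: "N t \<in> measurable M (count_space UNIV)" "N s \<in> measurable M (count_space UNIV)"
    using poisson_process_measurable[OF N] st by auto
  have D[measurable]: "(\<lambda>\<omega>. N t \<omega> - N s \<omega>) \<in> measurable M (count_space UNIV)" by measurable
  have d: "distr M (count_space UNIV) (\<lambda>\<omega>. N t \<omega> - N s \<omega>) = measure_pmf (poisson_pmf (t - s))"
    using N st by (simp add: poisson_process_def)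
  have r: "0 < t - s" using st by simp
  show "integrable M (\<lambda>\<omega>. real (N t \<omega> - N s \<omega>))"
    using integrable_poisson[OF r] integrable_distr_eq[OF D, of real] by (simp add: d)
  show "(LINT \<omega>|M. real (N t \<omega> - N s \<omega>)) = t - s"
    using poisson_mean[OF r] integral_distr[OF D, of real] by (simp add: d)
  show "integrable M (\<lambda>\<omega>. (real (N t \<omega> - N s \<omega>) - (t - s))\<^sup>2)"
    using integrable_poisson_square[OF r] integrable_distr_eq[OF D, of "\<lambda>k. (real k - (t - s))\<^sup>2"] by (simp add: d)
  show "(LINT \<omega>|M. (real (N t \<omega> - N s \<omega>) - (t - s))\<^sup>2) = t - s"
    using poisson_variance[OF r] integral_distr[OF D, of "\<lambda>k. (real k - (t - s))\<^sup>2"] by (simp add: d)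
qed

text \<open>The relative squared error at time \<open>q\<close> has mean \<open>1 / q\<close>, which
  is summable along the squares. So the sum of the errors has finite expectation, is finite almost
  surely, and its terms tend to \<open>0\<close>.\<close>

lemma poisson_squares_lln:
  assumes N: "poisson_process M 1 N"
  shows "AE \<omega> in M. (\<lambda>n. real (N ((real (Suc n))\<^sup>2) \<omega>) / (real (Suc n))\<^sup>2) \<longlonglongrightarrow> 1"
proof -
  define q where "q n = (real (Suc n))\<^sup>2" for n
  have q: "0 < q n" for n by (simp add: q_def)
  define V where "V n \<omega> = ((real (N (q n) \<omega> - N 0 \<omega>) - q n) / q n)\<^sup>2" for n \<omega>
  have V_alt: "V n \<omega> = (real (N (q n) \<omega> - N 0 \<omega>) - (q n - 0))\<^sup>2 / (q n)\<^sup>2" for n \<omega>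
    by (simp add: V_def power_divide)
  have V_nonneg: "0 \<le> V n \<omega>" for n \<omega> by (simp add: V_def)
  have int: "integrable M (V n)" "integral\<^sup>L M (V n) = 1 / q n" for n
    unfolding V_alt[abs_def] using integrable_poisson_increment_square[OF N, of 0 "q n"] poisson_increment_variance[OF N, of 0 "q n"] q[of n]
    by (simp_all add: power2_eq_square)
  have meas[measurable]: "V n \<in> borel_measurable M" for n using int(1) by auto
  have "(\<integral>\<^sup>+\<omega>. (\<Sum>n. ennreal (V n \<omega>)) \<partial>M) = (\<Sum>n. \<integral>\<^sup>+\<omega>. ennreal (V n \<omega>) \<partial>M)"
    by (rule nn_integral_suminf) measurable
  also have "\<dots> = (\<Sum>n. ennreal (1 / q n))"
    using int by (subst nn_integral_eq_integral) (auto simp: V_nonneg)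
  also have "\<dots> < \<infinity>"
  proof -
    have "summable (\<lambda>n. 1 / q n)"
      using inverse_power_summable[of 2, where 'a=real] summable_Suc_iff[of "\<lambda>n. inverse ((real n)\<^sup>2)"]
      by (simp add: q_def inverse_eq_divide)
    then show ?thesis using q by (subst suminf_ennreal2) (auto simp: less_imp_le)
  qed
  finally have "AE \<omega> in M. (\<Sum>n. ennreal (V n \<omega>)) \<noteq> \<infinity>"
    by (intro nn_integral_noteq_infinite) auto
  then show ?thesis
    using poisson_process_AE[OF N]
  proof eventually_elim
    case (elim \<omega>)
    then have "summable (\<lambda>n. V n \<omega>)" by (intro summable_suminf_not_top) (auto simp: V_def)
    then have "(\<lambda>n. V n \<omega>) \<longlonglongrightarrow> 0" by (rule summable_LIMSEQ_zero)
    then have "(\<lambda>n. sqrt (V n \<omega>)) \<longlonglongrightarrow> sqrt 0" by (rule tendsto_real_sqrt)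
    then have "(\<lambda>n. (real (N (q n) \<omega>) - q n) / q n) \<longlonglongrightarrow> 0"
      using elim by (subst tendsto_rabs_zero_iff[symmetric]) (simp add: V_def)
    then have "(\<lambda>n. (real (N (q n) \<omega>) - q n) / q n + 1) \<longlonglongrightarrow> 0 + 1" by (intro tendsto_add tendsto_const)
    moreover have "(real (N (q n) \<omega>) - q n) / q n + 1 = real (N (q n) \<omega>) / q n" for n
      using q[of n] by (simp add: field_simps)
    ultimately show ?case by (simp add: q_def)
  qed
qed

text \<open>Monotonicity sandwiches \<open>y v\<close> between its values at consecutive squares,
  whose ratio tends to \<open>1\<close>. The bound holds for all \<open>v \<ge> 0\<close> with an
  additive constant, rather than as a limit, because the clocks it is applied to may stay
  small.\<close>

lemma mono_path_deviation:
  fixes y :: "real \<Rightarrow> nat"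
  assumes mono: "mono_on {0..} y" and lim: "(\<lambda>n. real (y ((real (Suc n))\<^sup>2)) / (real (Suc n))\<^sup>2) \<longlonglongrightarrow> 1"
    and d: "\<delta> > 0"
  shows "\<exists>A. \<forall>v\<ge>0. \<bar>real (y v) - v\<bar> \<le> A + \<delta> * v"
proof -
  have up: "(\<lambda>n. real (y ((real (Suc (Suc n)))\<^sup>2)) / (real (Suc (Suc n)))\<^sup>2 * (real (Suc (Suc n)) / real (Suc n))\<^sup>2) \<longlonglongrightarrow> 1 * 1\<^sup>2"
    by (intro tendsto_intros LIMSEQ_Suc[OF lim]) real_asymp
  have lo: "(\<lambda>n. real (y ((real (Suc n))\<^sup>2)) / (real (Suc n))\<^sup>2 * (real (Suc n) / real (Suc (Suc n)))\<^sup>2) \<longlonglongrightarrow> 1 * 1\<^sup>2"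
    by (intro tendsto_intros lim) real_asymp
  have "\<forall>\<^sub>F n in sequentially. real (y ((real (Suc (Suc n)))\<^sup>2)) / (real (Suc (Suc n)))\<^sup>2 * (real (Suc (Suc n)) / real (Suc n))\<^sup>2 < 1 + \<delta>
     \<and> real (y ((real (Suc n))\<^sup>2)) / (real (Suc n))\<^sup>2 * (real (Suc n) / real (Suc (Suc n)))\<^sup>2 > 1 - \<delta>"
    using order_tendstoD(2)[OF up, of "1 + \<delta>"] order_tendstoD(1)[OF lo, of "1 - \<delta>"] d by (simp add: eventually_conj)
  then obtain n0 where n0: "\<And>n. n \<ge> n0 \<Longrightarrow> real (y ((real (Suc (Suc n)))\<^sup>2)) / (real (Suc (Suc n)))\<^sup>2 * (real (Suc (Suc n)) / real (Suc n))\<^sup>2 < 1 + \<delta>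
     \<and> real (y ((real (Suc n))\<^sup>2)) / (real (Suc n))\<^sup>2 * (real (Suc n) / real (Suc (Suc n)))\<^sup>2 > 1 - \<delta>"
    by (auto simp: eventually_sequentially)
  \<comment> \<open>Beyond this square both ratio estimates hold; before it,
    \<open>y v \<le> y V\<close> and \<open>v < V\<close> give the constant
    \<open>A\<close>.\<close>
  define V where "V = (real (Suc n0))\<^sup>2"
  show ?thesis
  proof (intro exI[of _ "real (y V) + V"] allI impI)
    fix v :: real assume v: "0 \<le> v"
    show "\<bar>real (y v) - v\<bar> \<le> real (y V) + V + \<delta> * v"
    proof (cases "v < V")
      case True
      then have "y v \<le> y V" using v by (intro mono_onD[OF mono]) auto
      moreover have "0 \<le> \<delta> * v" using v d by simp
      ultimately show ?thesis using True v by (simp add: abs_le_iff)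
    next
      case False
      define k where "k = nat \<lfloor>sqrt v\<rfloor>"
      have sq: "real (Suc n0) \<le> sqrt v" using False by (intro real_le_rsqrt) (simp add: V_def)
      have k: "real k \<le> sqrt v" "sqrt v < real k + 1"
        using v by (simp_all add: k_def)
      have "Suc n0 \<le> k" using sq unfolding k_def by (simp add: le_nat_floor)
      then obtain n where n: "k = Suc n" "n \<ge> n0" by (cases k) auto
      have "(real (Suc n))\<^sup>2 \<le> (sqrt v)\<^sup>2"
        using k n by (intro power_mono) auto
      then have v1: "(real (Suc n))\<^sup>2 \<le> v" using v by simp
      have v2: "v \<le> (real (Suc (Suc n)))\<^sup>2"
        by (rule sqrt_le_D) (use k n in simp)
      have y1: "y ((real (Suc n))\<^sup>2) \<le> y v" by (intro mono_onD[OF mono] v1) (use v in auto)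
      have y2: "y v \<le> y ((real (Suc (Suc n)))\<^sup>2)" by (intro mono_onD[OF mono] v2) (use v in auto)
      have "real (y ((real (Suc (Suc n)))\<^sup>2)) / (real (Suc n))\<^sup>2 < 1 + \<delta>"
        using n0[OF n(2)] by (simp add: power_divide del: of_nat_Suc)
      then have "real (y ((real (Suc (Suc n)))\<^sup>2)) \<le> (1 + \<delta>) * (real (Suc n))\<^sup>2"
        by (simp add: field_simps del: of_nat_Suc)
      also have "\<dots> \<le> (1 + \<delta>) * v" using v1 d by (intro mult_left_mono) auto
      finally have u: "real (y v) \<le> (1 + \<delta>) * v" using y2 by linarith
      have "(1 - \<delta>) * (real (Suc (Suc n)))\<^sup>2 \<le> real (y ((real (Suc n))\<^sup>2))"
        using n0[OF n(2)] by (simp add: power_divide field_simps del: of_nat_Suc)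
      \<comment> \<open>For \<open>\<delta> > 1\<close> the factor is negative and reverses the
        inequality, but then the lower bound is at most \<open>0\<close> and holds
        trivially.\<close>
      moreover have "(1 - \<delta>) * v \<le> (1 - \<delta>) * (real (Suc (Suc n)))\<^sup>2 \<or> 1 - \<delta> < 0" using v2
        by (cases "1 - \<delta> < 0") (auto intro!: mult_left_mono simp del: of_nat_Suc)
      moreover have "(1 - \<delta>) * v \<le> 0" if "1 - \<delta> < 0" using that v by (simp add: mult_nonpos_nonneg)
      ultimately have l: "(1 - \<delta>) * v \<le> real (y v)" using y1 by (smt (verit) of_nat_0_le_iff of_nat_mono)
      have "0 \<le> real (y V) + V" by (simp add: V_def)
      then show ?thesis using u l unfolding abs_le_iff by (simp add: algebra_simps)
    qed
  qed
qed

lemma poisson_process_deviation: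
  assumes N: "poisson_process M 1 N"
  shows "AE \<omega> in M. \<forall>\<delta>>0. \<exists>A. \<forall>v\<ge>0. \<bar>real (N v \<omega>) - v\<bar> \<le> A + \<delta> * v"
  using poisson_squares_lln[OF N] poisson_process_AE[OF N]
proof eventually_elim
  case (elim \<omega>)
  then show ?case by (intro allI impI mono_path_deviation) auto
qed

section \<open>Optional stopping of a Poisson process\<close>

lemma rc_version_nat_ceiling_tendsto:
  assumes y: "mono_on {0..} y" "\<And>u. 0 \<le> u \<Longrightarrow> continuous (at_right u) y" and u: "0 \<le> u"
  shows "(\<lambda>m. real (y (real (nat \<lceil>real (Suc m) * u\<rceil>) / real (Suc m)))) \<longlonglongrightarrow> real (rc_version y u)"
proof -
  obtain e where e: "e > 0" "\<And>w. u < w \<Longrightarrow> w < u + e \<Longrightarrow> y w = y u"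
    using right_continuous_nat_const y(2) u by meson
  have "\<forall>\<^sub>F m in sequentially. 1 / real (Suc m) < e"
    using e(1) by (intro order_tendstoD(2)[OF LIMSEQ_inverse_real_of_nat[unfolded inverse_eq_divide]])
  then have "\<forall>\<^sub>F m in sequentially. real (y (real (nat \<lceil>real (Suc m) * u\<rceil>) / real (Suc m))) = real (rc_version y u)"
  proof eventually_elim
    case (elim m)
    define w where "w = real (nat \<lceil>real (Suc m) * u\<rceil>) / real (Suc m)"
    have p: "0 \<le> real (Suc m) * u" using u by simp
    have "u \<le> w" unfolding w_def using p by (simp add: field_simps del: of_nat_Suc) 
    moreover have "real (nat \<lceil>real (Suc m) * u\<rceil>) < real (Suc m) * u + 1" using p by linarith
    then have "w < u + 1 / real (Suc m)"
      unfolding w_def by (simp add: field_simps del: of_nat_Suc)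
    ultimately have "y w = y u" using e(2)[of w] elim by (cases "u = w") auto
    moreover have "rc_version y u = y u" by (rule rc_version_eq) (use y u in auto)
    ultimately show ?case unfolding w_def by simp
  qed
  then show ?thesis by (rule tendsto_eventually)
qed

context prob_space
begin

text \<open>A form of Wald's identity. On the grid of mesh \<open>h\<close>, the count at the
  rounded-up time telescopes into increments weighted by the indicators of
  \<open>\<tau> > j * h\<close>, and \<open>stop\<close> replaces each increment by \<open>h\<close>
  in the mean. Rounding up makes the weight of an increment an event decided at its left
  endpoint.\<close>

lemma poisson_process_stopped_mean:
  assumes N: "poisson_process M 1 N"
    and [measurable]: "\<tau> \<in> borel_measurable M" and nonneg: "\<And>\<omega>. 0 \<le> \<tau> \<omega>" and int: "integrable M \<tau>"
    and stop: "\<And>s h. 0 \<le> s \<Longrightarrow> 0 < h \<Longrightarrow>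
      expectation (\<lambda>\<omega>. indicator {s<..} (\<tau> \<omega>) * real (N (s + h) \<omega> - N s \<omega>)) = expectation (\<lambda>\<omega>. indicator {s<..} (\<tau> \<omega>)) * h"
  shows "integrable M (\<lambda>\<omega>. real (rc_version (\<lambda>u. N u \<omega>) (\<tau> \<omega>)))"
    and "expectation (\<lambda>\<omega>. real (rc_version (\<lambda>u. N u \<omega>) (\<tau> \<omega>))) = expectation \<tau>"
proof -
  have Nm[measurable]: "N t \<in> measurable M (count_space UNIV)" if "0 \<le> t" for t
    using poisson_process_measurable[OF N that] .
  define k where "k m \<omega> = nat \<lceil>real (Suc m) * \<tau> \<omega>\<rceil>" for m \<omega>
  define b where "b m \<omega> = real (k m \<omega>) / real (Suc m)" for m \<omega>
  define A where "A m \<omega> = real (N (b m \<omega>) \<omega>)" for m \<omega>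
  have km[measurable]: "k m \<in> measurable M (count_space UNIV)" for m unfolding k_def by measurable
  have bm[measurable]: "b m \<in> borel_measurable M" for m unfolding b_def by measurable
  have Am[measurable]: "A m \<in> borel_measurable M" for m
    unfolding A_def b_def by (rule measurable_compose_countable[OF _ km]) measurable
  have p: "0 \<le> real (Suc m) * \<tau> \<omega>" for m \<omega> using nonneg by simp
  have b_ge: "\<tau> \<omega> \<le> b m \<omega>" for m \<omega>
    unfolding b_def k_def using p[of m \<omega>] by (simp add: field_simps del: of_nat_Suc)
  have b_le: "b m \<omega> \<le> \<tau> \<omega> + 1 / real (Suc m)" for m \<omega>
  proof -
    have "real (k m \<omega>) \<le> real (Suc m) * \<tau> \<omega> + 1" unfolding k_def using p[of m \<omega>] by linarith
    then show ?thesis unfolding b_def by (simp add: field_simps del: of_nat_Suc)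
  qed
  \<comment> \<open>The integer above \<open>\<tau>\<close> lies on every grid, so the coarsest
    approximation dominates all others; this later provides the dominating functions.\<close>
  have b_le_0: "b m \<omega> \<le> b 0 \<omega>" for m \<omega>
  proof -
    have "real (Suc m) * \<tau> \<omega> \<le> real (Suc m) * real_of_int \<lceil>\<tau> \<omega>\<rceil>" by (intro mult_left_mono) auto
    also have "\<dots> = real_of_int (int (Suc m) * \<lceil>\<tau> \<omega>\<rceil>)" by simp
    finally have "\<lceil>real (Suc m) * \<tau> \<omega>\<rceil> \<le> int (Suc m) * \<lceil>\<tau> \<omega>\<rceil>" by (rule ceiling_le)
    moreover have "0 \<le> \<lceil>\<tau> \<omega>\<rceil>" using nonneg[of \<omega>] by linarith
    ultimately have "k m \<omega> \<le> Suc m * k 0 \<omega>" unfolding k_def by (simp add: nat_le_iff algebra_simps)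
    then have "real (k m \<omega>) \<le> real (Suc m) * real (k 0 \<omega>)" by (metis of_nat_le_iff of_nat_mult)
    then show ?thesis unfolding b_def by (simp add: field_simps del: of_nat_Suc)
  qed
  have b_int: "integrable M (b m)" for m
  proof (rule Bochner_Integration.integrable_bound)
    show "integrable M (\<lambda>\<omega>. \<tau> \<omega> + 1)" using int by simp
    have "norm (b m \<omega>) \<le> norm (\<tau> \<omega> + 1)" for \<omega>
    proof -
      have "b m \<omega> \<le> \<tau> \<omega> + 1 / real (Suc m)" by (rule b_le)
      moreover have "1 / real (Suc m) \<le> 1" by simp
      ultimately have "b m \<omega> \<le> \<tau> \<omega> + 1" by linarith
      then show ?thesis using nonneg[of \<omega>] by (simp add: b_def)
    qed
    then show "AE \<omega> in M. norm (b m \<omega>) \<le> norm (\<tau> \<omega> + 1)" by simp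
  qed measurable
  \<comment> \<open>Computed with nonnegative integrals, so that sum and integral may be exchanged
    and integrability of \<open>A m\<close> follows from that of \<open>b m\<close>.\<close>
  have A_nn: "(\<integral>\<^sup>+\<omega>. ennreal (A m \<omega>) \<partial>M) = (\<integral>\<^sup>+\<omega>. ennreal (b m \<omega>) \<partial>M)" for m
  proof -
    define h where "h = 1 / real (Suc m)"
    have h: "0 < h" by (simp add: h_def)
    define D where "D j \<omega> = N (real j * h + h) \<omega> - N (real j * h) \<omega>" for j \<omega>
    have Dm[measurable]: "D j \<in> measurable M (count_space UNIV)" for j
    proof -
      have [measurable]: "N (real j * h + h) \<in> measurable M (count_space UNIV)" "N (real j * h) \<in> measurable M (count_space UNIV)"
        using h by (auto intro!: Nm)
      show ?thesis unfolding D_def by measurable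
    qed
    \<comment> \<open>Strict on both sides: increment \<open>j\<close> is used exactly when
      \<open>\<tau>\<close> exceeds the left endpoint \<open>j * h\<close>, the event that occurs in
      \<open>stop\<close>.\<close>
    have less: "j < k m \<omega> \<longleftrightarrow> real j * h < \<tau> \<omega>" for j \<omega>
      unfolding k_def h_def using p[of m \<omega>] by (simp add: field_simps zless_nat_eq_int_zless less_ceiling_iff del: of_nat_Suc)
    have split: "(\<Sum>j. ennreal (indicator {real j * h<..} (\<tau> \<omega>) * c j)) = ennreal (\<Sum>j<k m \<omega>. c j)"
      if "\<And>j. 0 \<le> c j" for c :: "nat \<Rightarrow> real" and \<omega>
    proof -
      have "(\<Sum>j. ennreal (indicator {real j * h<..} (\<tau> \<omega>) * c j)) = (\<Sum>j<k m \<omega>. ennreal (indicator {real j * h<..} (\<tau> \<omega>) * c j))"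
        by (intro suminf_finite) (auto simp: less)
      also have "\<dots> = (\<Sum>j<k m \<omega>. ennreal (c j))" by (intro sum.cong) (auto simp: less)
      finally show ?thesis using that by simp
    qed
    have "(\<integral>\<^sup>+\<omega>. ennreal (A m \<omega>) \<partial>M) = (\<integral>\<^sup>+\<omega>. (\<Sum>j. ennreal (indicator {real j * h<..} (\<tau> \<omega>) * real (D j \<omega>))) \<partial>M)"
    proof (rule nn_integral_cong_AE)
      show "AE \<omega> in M. ennreal (A m \<omega>) = (\<Sum>j. ennreal (indicator {real j * h<..} (\<tau> \<omega>) * real (D j \<omega>)))"
        using poisson_process_AE[OF N]
      proof eventually_elim
        case (elim \<omega>)
        have mono: "mono_on {0..} (\<lambda>t. N t \<omega>)" using elim by simp
        have "(\<Sum>j<n. real (D j \<omega>)) = real (N (real n * h) \<omega>)" for n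
        proof (induction n)
          case (Suc n)
          have "N (real n * h) \<omega> \<le> N (real n * h + h) \<omega>"
            using h by (intro mono_onD[OF mono]) auto
          then show ?case using Suc by (simp add: D_def of_nat_diff algebra_simps)
        qed (use elim in simp)
        then have "(\<Sum>j<k m \<omega>. real (D j \<omega>)) = A m \<omega>" by (simp add: A_def b_def h_def)
        moreover have "(\<Sum>j. ennreal (indicator {real j * h<..} (\<tau> \<omega>) * real (D j \<omega>))) = ennreal (\<Sum>j<k m \<omega>. real (D j \<omega>))"
          by (rule split) simp
        ultimately show ?case by simp
      qed
    qed
    also have "\<dots> = (\<Sum>j. \<integral>\<^sup>+\<omega>. ennreal (indicator {real j * h<..} (\<tau> \<omega>) * real (D j \<omega>)) \<partial>M)"
      by (rule nn_integral_suminf) measurable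
    also have "\<dots> = (\<Sum>j. \<integral>\<^sup>+\<omega>. ennreal (indicator {real j * h<..} (\<tau> \<omega>) * h) \<partial>M)"
    proof (rule arg_cong[where f = suminf], rule ext)
      fix j
      have Dint: "integrable M (\<lambda>\<omega>. real (D j \<omega>))"
        unfolding D_def using h by (intro integrable_poisson_increment[OF N]) auto
      have I: "integrable M (\<lambda>\<omega>. indicator {real j * h<..} (\<tau> \<omega>) * real (D j \<omega>))"
        by (rule Bochner_Integration.integrable_bound[OF Dint]) (measurable, auto split: split_indicator)
      have I2: "integrable M (\<lambda>\<omega>. indicator {real j * h<..} (\<tau> \<omega>) * h)"
        by (intro integrable_mult_left integrable_const_bound[of _ 1]) auto
      have "(\<integral>\<^sup>+\<omega>. ennreal (indicator {real j * h<..} (\<tau> \<omega>) * real (D j \<omega>)) \<partial>M)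
        = ennreal (expectation (\<lambda>\<omega>. indicator {real j * h<..} (\<tau> \<omega>) * real (D j \<omega>)))"
        using I by (intro nn_integral_eq_integral) auto
      also have "\<dots> = ennreal (expectation (\<lambda>\<omega>. indicator {real j * h<..} (\<tau> \<omega>)) * h)"
        unfolding D_def using h by (subst stop) auto
      also have "expectation (\<lambda>\<omega>. indicator {real j * h<..} (\<tau> \<omega>)) * h = expectation (\<lambda>\<omega>. indicator {real j * h<..} (\<tau> \<omega>) * h)"
        by simp
      also have "ennreal \<dots> = (\<integral>\<^sup>+\<omega>. ennreal (indicator {real j * h<..} (\<tau> \<omega>) * h) \<partial>M)"
        using I2 h by (intro nn_integral_eq_integral[symmetric]) auto
      finally show "(\<integral>\<^sup>+\<omega>. ennreal (indicator {real j * h<..} (\<tau> \<omega>) * real (D j \<omega>)) \<partial>M)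
        = (\<integral>\<^sup>+\<omega>. ennreal (indicator {real j * h<..} (\<tau> \<omega>) * h) \<partial>M)" .
    qed
    also have "\<dots> = (\<integral>\<^sup>+\<omega>. (\<Sum>j. ennreal (indicator {real j * h<..} (\<tau> \<omega>) * h)) \<partial>M)"
      by (rule nn_integral_suminf[symmetric]) measurable
    also have "\<dots> = (\<integral>\<^sup>+\<omega>. ennreal (b m \<omega>) \<partial>M)"
    proof (rule nn_integral_cong)
      fix \<omega>
      have "(\<Sum>j. ennreal (indicator {real j * h<..} (\<tau> \<omega>) * h)) = ennreal (\<Sum>j<k m \<omega>. h)"
        by (rule split) (use h in simp)
      also have "(\<Sum>j<k m \<omega>. h) = b m \<omega>" by (simp add: b_def h_def)
      finally show "(\<Sum>j. ennreal (indicator {real j * h<..} (\<tau> \<omega>) * h)) = ennreal (b m \<omega>)" .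
    qed
    finally show ?thesis .
  qed
  have b_nn: "(\<integral>\<^sup>+\<omega>. ennreal (b m \<omega>) \<partial>M) = ennreal (expectation (b m))" for m
    by (rule nn_integral_eq_integral[OF b_int]) (simp add: b_def)
  have A_int: "integrable M (A m)" for m
  proof (rule integrableI_nonneg)
    show "(\<integral>\<^sup>+\<omega>. ennreal (A m \<omega>) \<partial>M) < \<infinity>" unfolding A_nn b_nn by simp
  qed (auto simp: A_def)
  have A_eq: "expectation (A m) = expectation (b m)" for m
  proof -
    have "expectation (A m) = enn2real (\<integral>\<^sup>+\<omega>. ennreal (A m \<omega>) \<partial>M)"
      by (rule integral_eq_nn_integral) (auto simp: A_def)
    also have "\<dots> = expectation (b m)" unfolding A_nn b_nn by (simp add: b_def)
    finally show ?thesis .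
  qed
  have m[measurable]: "(\<lambda>\<omega>. rc_version (\<lambda>u. N u \<omega>) (\<tau> \<omega>)) \<in> measurable M (count_space UNIV)"
    using nonneg by (intro measurable_rc_version) auto
  have m': "(\<lambda>\<omega>. real (rc_version (\<lambda>u. N u \<omega>) (\<tau> \<omega>))) \<in> borel_measurable M" by measurable
  have lim: "AE \<omega> in M. (\<lambda>m. A m \<omega>) \<longlonglongrightarrow> real (rc_version (\<lambda>u. N u \<omega>) (\<tau> \<omega>))"
    using poisson_process_AE[OF N]
    unfolding A_def b_def k_def
    by eventually_elim (intro rc_version_nat_ceiling_tendsto, auto simp: nonneg)
  have dom: "AE \<omega> in M. norm (A m \<omega>) \<le> A 0 \<omega>" for m
    using poisson_process_AE[OF N]
  proof eventually_elim
    case (elim \<omega>)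
    have mono: "mono_on {0..} (\<lambda>t. N t \<omega>)" using elim by simp
    have "N (b m \<omega>) \<omega> \<le> N (b 0 \<omega>) \<omega>"
      by (intro mono_onD[OF mono] b_le_0) (auto simp: b_def)
    then show ?case by (simp add: A_def)
  qed
  show "integrable M (\<lambda>\<omega>. real (rc_version (\<lambda>u. N u \<omega>) (\<tau> \<omega>)))"
    by (rule integrable_dominated_convergence[OF m' Am A_int lim dom])
  have 1: "(\<lambda>m. expectation (A m)) \<longlonglongrightarrow> expectation (\<lambda>\<omega>. real (rc_version (\<lambda>u. N u \<omega>) (\<tau> \<omega>)))"
    by (rule integral_dominated_convergence[OF m' Am A_int lim dom])
  have 2: "(\<lambda>m. expectation (b m)) \<longlonglongrightarrow> expectation \<tau>"
  proof (rule integral_dominated_convergence[where w = "b 0"])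
    show "AE \<omega> in M. (\<lambda>m. b m \<omega>) \<longlonglongrightarrow> \<tau> \<omega>"
    proof (rule AE_I2)
      fix \<omega>
      have "(\<lambda>m. \<tau> \<omega> + 1 / real (Suc m)) \<longlonglongrightarrow> \<tau> \<omega> + 0"
        by (intro tendsto_add tendsto_const LIMSEQ_inverse_real_of_nat[unfolded inverse_eq_divide])
      then have "(\<lambda>m. \<tau> \<omega> + 1 / real (Suc m)) \<longlonglongrightarrow> \<tau> \<omega>" by simp
      then show "(\<lambda>m. b m \<omega>) \<longlonglongrightarrow> \<tau> \<omega>"
        by (rule tendsto_sandwich[OF _ _ tendsto_const, rotated 2]) (intro always_eventually allI b_ge b_le)+
    qed
    show "AE \<omega> in M. norm (b m \<omega>) \<le> b 0 \<omega>" for m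
      using b_le_0 by (simp add: b_def)
  qed (auto intro: b_int)
  show "expectation (\<lambda>\<omega>. real (rc_version (\<lambda>u. N u \<omega>) (\<tau> \<omega>))) = expectation \<tau>"
    by (rule LIMSEQ_unique[OF 1[unfolded A_eq] 2])
qed

end

section \<open>Independence of the past\<close>

text \<open>Path \<open>i\<close> is known up to internal time \<open>s\<close> only, the other
  paths entirely: no bound on clock \<open>i\<close> limits how far the other clocks have
  run.\<close>

definition past_space :: "'k \<Rightarrow> real \<Rightarrow> ((real \<Rightarrow> nat) \<times> ('k \<Rightarrow> real \<Rightarrow> nat)) measure" where
  "past_space i s = PiM {0..s} (\<lambda>_. count_space UNIV) \<Otimes>\<^sub>M PiM (UNIV - {i}) (\<lambda>_. PiM {0..} (\<lambda>_. count_space UNIV))"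

definition past :: "('k \<Rightarrow> real \<Rightarrow> 'a \<Rightarrow> nat) \<Rightarrow> 'k \<Rightarrow> real \<Rightarrow> 'a \<Rightarrow> (real \<Rightarrow> nat) \<times> ('k \<Rightarrow> real \<Rightarrow> nat)" where
  "past Y i s \<omega> = (\<lambda>u\<in>{0..s}. Y i u \<omega>, \<lambda>j\<in>UNIV - {i}. \<lambda>u\<in>{0..}. Y j u \<omega>)"

context prob_space
begin

text \<open>Unlike \<^const>\<open>indep_var\<close>, this allows the two random elements to have different types.\<close>

definition indep_pair :: "'s measure \<Rightarrow> ('a \<Rightarrow> 's) \<Rightarrow> 't measure \<Rightarrow> ('a \<Rightarrow> 't) \<Rightarrow> bool" where
  "indep_pair S D R W \<longleftrightarrow> random_variable S D \<and> random_variable R W \<and>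
     (\<forall>A\<in>sets S. \<forall>B\<in>sets R. prob (D -` A \<inter> space M \<inter> (W -` B \<inter> space M)) =
        prob (D -` A \<inter> space M) * prob (W -` B \<inter> space M))"

lemma indep_pair_rv1: "indep_pair S D R W \<Longrightarrow> random_variable S D"
  and indep_pair_rv2: "indep_pair S D R W \<Longrightarrow> random_variable R W"
  and indep_pairD: "indep_pair S D R W \<Longrightarrow> A \<in> sets S \<Longrightarrow> B \<in> sets R \<Longrightarrow>
     prob (D -` A \<inter> space M \<inter> (W -` B \<inter> space M)) = prob (D -` A \<inter> space M) * prob (W -` B \<inter> space M)"
  by (simp_all add: indep_pair_def)

lemma Int_stable_vimage:
  assumes "Int_stable H"
  shows "Int_stable {f -` A \<inter> space M |A. A \<in> H}"
proof (rule Int_stableI, clarify)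
  fix A B assume "A \<in> H" "B \<in> H"
  then have "A \<inter> B \<in> H" using assms by (auto simp: Int_stable_def)
  then show "\<exists>C. f -` A \<inter> space M \<inter> (f -` B \<inter> space M) = f -` C \<inter> space M \<and> C \<in> H"
    by (intro exI[of _ "A \<inter> B"]) auto
qed

lemma indep_pair_generatorI:
  assumes D: "random_variable S D" and W: "random_variable R W"
    and gen: "sets R = sigma_sets (space R) G" and Int: "Int_stable G" and sub: "G \<subseteq> sets R"
    and eq: "\<And>A B. A \<in> sets S \<Longrightarrow> B \<in> G \<Longrightarrow>
      prob (D -` A \<inter> space M \<inter> (W -` B \<inter> space M)) = prob (D -` A \<inter> space M) * prob (W -` B \<inter> space M)"
  shows "indep_pair S D R W"
proof -
  have "indep_set {D -` A \<inter> space M |A. A \<in> sets S} {W -` B \<inter> space M |B. B \<in> G}"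
    unfolding indep_sets2_eq using eq measurable_sets[OF D] measurable_sets[OF W] sub by auto
  then have "indep_set (sigma_sets (space M) {D -` A \<inter> space M |A. A \<in> sets S})
     (sigma_sets (space M) {W -` B \<inter> space M |B. B \<in> G})"
    by (intro indep_set_sigma_sets Int_stable_vimage Int) (auto simp: Int_stable_def)
  moreover have "W \<in> space M \<rightarrow> space R" using measurable_space[OF W] by auto
  then have "{W -` B \<inter> space M |B. B \<in> sets R} = sigma_sets (space M) {W -` B \<inter> space M |B. B \<in> G}"
    unfolding gen by (rule sigma_sets_vimage_commute)
  ultimately have ind: "indep_set (sigma_sets (space M) {D -` A \<inter> space M |A. A \<in> sets S}) {W -` B \<inter> space M |B. B \<in> sets R}"
    by simp
  show ?thesis
    unfolding indep_pair_def
  proof (intro conjI D W ballI)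
    fix A B assume A: "A \<in> sets S" and B: "B \<in> sets R"
    show "prob (D -` A \<inter> space M \<inter> (W -` B \<inter> space M)) = prob (D -` A \<inter> space M) * prob (W -` B \<inter> space M)"
      by (rule indep_setD[OF ind]) (use A B in auto)
  qed
qed

lemma indep_pair_compose:
  assumes ind: "indep_pair S D R W" and f: "f \<in> measurable S S'" and g: "g \<in> measurable R R'"
  shows "indep_pair S' (\<lambda>\<omega>. f (D \<omega>)) R' (\<lambda>\<omega>. g (W \<omega>))"
  unfolding indep_pair_def
proof (intro conjI ballI)
  note D = indep_pair_rv1[OF ind] and W = indep_pair_rv2[OF ind]
  show "random_variable S' (\<lambda>\<omega>. f (D \<omega>))" "random_variable R' (\<lambda>\<omega>. g (W \<omega>))"
    using measurable_compose[OF D f] measurable_compose[OF W g] .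
  fix A B assume A: "A \<in> sets S'" and B: "B \<in> sets R'"
  have "(\<lambda>\<omega>. f (D \<omega>)) -` A \<inter> space M = D -` (f -` A \<inter> space S) \<inter> space M"
    "(\<lambda>\<omega>. g (W \<omega>)) -` B \<inter> space M = W -` (g -` B \<inter> space R) \<inter> space M"
    using measurable_space[OF D] measurable_space[OF W] by auto
  then show "prob ((\<lambda>\<omega>. f (D \<omega>)) -` A \<inter> space M \<inter> ((\<lambda>\<omega>. g (W \<omega>)) -` B \<inter> space M)) =
      prob ((\<lambda>\<omega>. f (D \<omega>)) -` A \<inter> space M) * prob ((\<lambda>\<omega>. g (W \<omega>)) -` B \<inter> space M)"
    using indep_pairD[OF ind measurable_sets[OF f A] measurable_sets[OF g B]] by simp
qed

lemma indep_pair_iff_indep_var: "indep_pair S D R W \<longleftrightarrow> indep_var S D R W"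
proof
  assume ind: "indep_pair S D R W"
  note D = indep_pair_rv1[OF ind] and W = indep_pair_rv2[OF ind]
  have "indep_set {D -` A \<inter> space M |A. A \<in> sets S} {W -` B \<inter> space M |B. B \<in> sets R}"
    unfolding indep_sets2_eq using indep_pairD[OF ind] measurable_sets[OF D] measurable_sets[OF W] by auto
  then show "indep_var S D R W"
    unfolding indep_var_eq using D W
    by (intro conjI indep_set_sigma_sets Int_stable_vimage) (auto simp: Int_stable_def)
next
  assume ind: "indep_var S D R W"
  show "indep_pair S D R W"
    unfolding indep_pair_def
  proof (intro conjI indep_var_rv1[OF ind] indep_var_rv2[OF ind] ballI)
    fix A B assume "A \<in> sets S" "B \<in> sets R"
    moreover have "D -` A \<inter> space M \<inter> (W -` B \<inter> space M) = (\<lambda>\<omega>. (D \<omega>, W \<omega>)) -` (A \<times> B) \<inter> space M" by auto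
    ultimately show "prob (D -` A \<inter> space M \<inter> (W -` B \<inter> space M)) = prob (D -` A \<inter> space M) * prob (W -` B \<inter> space M)"
      using indep_varD[OF ind] by simp
  qed
qed

text \<open>On rectangles the two hypotheses give a threefold product, and rectangles are an
  intersection-stable generator. The lemma joins the own past of a process with the paths of the
  other processes.\<close>

lemma indep_pair_assoc:
  assumes DU: "indep_pair S D T U" and DUV: "indep_pair (S \<Otimes>\<^sub>M T) (\<lambda>\<omega>. (D \<omega>, U \<omega>)) R V"
  shows "indep_pair S D (T \<Otimes>\<^sub>M R) (\<lambda>\<omega>. (U \<omega>, V \<omega>))"
proof (rule indep_pair_generatorI)
  have [measurable]: "random_variable S D" "random_variable T U" "random_variable R V"
    using indep_pair_rv1[OF DU] indep_pair_rv2[OF DU] indep_pair_rv2[OF DUV] by auto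
  show "random_variable S D" "random_variable (T \<Otimes>\<^sub>M R) (\<lambda>\<omega>. (U \<omega>, V \<omega>))" by measurable
  show "sets (T \<Otimes>\<^sub>M R) = sigma_sets (space (T \<Otimes>\<^sub>M R)) {a \<times> b |a b. a \<in> sets T \<and> b \<in> sets R}"
    by (simp add: sets_pair_measure space_pair_measure)
  show "Int_stable {a \<times> b |a b. a \<in> sets T \<and> b \<in> sets R}" by (rule Int_stable_pair_measure_generator)
  show "{a \<times> b |a b. a \<in> sets T \<and> b \<in> sets R} \<subseteq> sets (T \<Otimes>\<^sub>M R)" by auto
  fix A B assume A[measurable]: "A \<in> sets S" and "B \<in> {a \<times> b |a b. a \<in> sets T \<and> b \<in> sets R}"
  then obtain a b where B: "B = a \<times> b" and [measurable]: "a \<in> sets T" "b \<in> sets R" by auto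
  have rect: "prob (D -` A' \<inter> space M \<inter> (U -` a \<inter> space M) \<inter> (V -` b \<inter> space M))
     = prob (D -` A' \<inter> space M) * prob (U -` a \<inter> space M) * prob (V -` b \<inter> space M)"
    if [measurable]: "A' \<in> sets S" for A'
  proof -
    have "D -` A' \<inter> space M \<inter> (U -` a \<inter> space M) = (\<lambda>\<omega>. (D \<omega>, U \<omega>)) -` (A' \<times> a) \<inter> space M" by auto
    then show ?thesis
      using indep_pairD[OF DUV, of "A' \<times> a" b] indep_pairD[OF DU, of A' a] by simp
  qed
  have sp: "D -` space S \<inter> space M = space M"
    using measurable_space[OF \<open>random_variable S D\<close>] by auto
  have e: "(\<lambda>\<omega>. (U \<omega>, V \<omega>)) -` B \<inter> space M = (U -` a \<inter> space M) \<inter> (V -` b \<inter> space M)"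
    by (auto simp: B)
  \<comment> \<open>The case \<open>A' = space S\<close> of \<open>rect\<close> gives the product
    formula for \<open>U\<close> and \<open>V\<close> alone.\<close>
  have "prob ((\<lambda>\<omega>. (U \<omega>, V \<omega>)) -` B \<inter> space M) = prob (U -` a \<inter> space M) * prob (V -` b \<inter> space M)"
    using rect[of "space S"] sets.sets_into_space[of "U -` a \<inter> space M" M]
    by (simp add: e sp prob_space Int_absorb1 Int_absorb2)
  then show "prob (D -` A \<inter> space M \<inter> ((\<lambda>\<omega>. (U \<omega>, V \<omega>)) -` B \<inter> space M))
    = prob (D -` A \<inter> space M) * prob ((\<lambda>\<omega>. (U \<omega>, V \<omega>)) -` B \<inter> space M)"
    using rect[OF A] unfolding e by (simp add: Int_assoc Int_left_commute mult.assoc)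
qed

text \<open>Independence is available for increments along a monotone sequence, whereas cylinder
  sets fix values at arbitrary points of \<open>J\<close>. This sequence visits all these points,
  and its step number \<open>m\<close> is exactly the increment from \<open>s\<close> to
  \<open>s + h\<close>.\<close>

lemma exists_partition_with_points:
  fixes s h :: real
  assumes J: "finite J" "J \<subseteq> {0..s}" and s: "0 \<le> s" and h: "0 < h"
  obtains \<tau> :: "nat \<Rightarrow> real" and m where "\<tau> 0 = 0" "mono \<tau>" "\<tau> m = s" "\<tau> (Suc m) = s + h"
    "\<And>u. u \<in> J \<Longrightarrow> \<exists>k\<le>m. \<tau> k = u"
proof -
  \<comment> \<open>The point \<open>0\<close> is added so that partial sums of increments are
    values of the process, and \<open>s\<close> so that it directly precedes
    \<open>s + h\<close>.\<close>
  define K where "K = insert 0 (insert s J)"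
  define xs where "xs = sorted_list_of_set K"
  have K: "finite K" "K \<noteq> {}" "K \<subseteq> {0..s}" using J s by (auto simp: K_def)
  have xs: "set xs = K" "sorted xs" "xs \<noteq> []" using K by (auto simp: xs_def)
  define m where "m = length xs - 1"
  have len: "length xs = Suc m" using xs(3) by (cases xs) (auto simp: m_def)
  define \<tau> where "\<tau> k = (if k \<le> m then xs ! k else s + h)" for k
  have in_K: "k \<le> m \<Longrightarrow> xs ! k \<in> K" for k using xs(1) len by (metis le_imp_less_Suc nth_mem)
  have ex: "\<exists>k\<le>m. xs ! k = u" if "u \<in> K" for u
    using that xs(1) len by (metis in_set_conv_nth less_Suc_eq_le)
  have mono_xs: "i \<le> j \<Longrightarrow> j \<le> m \<Longrightarrow> xs ! i \<le> xs ! j" for i j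
    using xs(2) len by (simp add: sorted_nth_mono)
  show ?thesis
  proof
    obtain i where "i \<le> m" "xs ! i = 0" using ex[of 0] by (auto simp: K_def)
    then have "xs ! 0 \<le> 0" using mono_xs[of 0 i] by simp
    moreover have "0 \<le> xs ! 0" using in_K[of 0] K by auto
    ultimately show "\<tau> 0 = 0" by (simp add: \<tau>_def)
    obtain j where "j \<le> m" "xs ! j = s" using ex[of s] by (auto simp: K_def)
    then have "s \<le> xs ! m" using mono_xs[of j m] by simp
    moreover have "xs ! m \<le> s" using in_K[of m] K by auto
    ultimately show "\<tau> m = s" by (simp add: \<tau>_def)
    show "\<tau> (Suc m) = s + h" by (simp add: \<tau>_def)
    show "mono \<tau>"
    proof
      fix a b :: nat assume "a \<le> b"
      have "a \<le> m \<Longrightarrow> xs ! a \<le> s" using in_K[of a] K by auto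
      then show "\<tau> a \<le> \<tau> b" using \<open>a \<le> b\<close> h mono_xs[of a b] by (fastforce simp: \<tau>_def)
    qed
    show "\<exists>k\<le>m. \<tau> k = u" if "u \<in> J" for u
      using ex[of u] that by (auto simp: K_def \<tau>_def)
  qed
qed

lemma poisson_increment_indep_own_past:
  assumes N: "poisson_process M r N" and s: "0 \<le> s" and h: "0 < h"
  shows "indep_pair (count_space UNIV) (\<lambda>\<omega>. N (s + h) \<omega> - N s \<omega>)
     (PiM {0..s} (\<lambda>_. count_space UNIV)) (\<lambda>\<omega>. \<lambda>u\<in>{0..s}. N u \<omega>)"
proof (rule indep_pair_generatorI)
  have Nm[measurable]: "N t \<in> measurable M (count_space UNIV)" if "0 \<le> t" for t
    using poisson_process_measurable[OF N that] .
  have [measurable]: "N (s + h) \<in> measurable M (count_space UNIV)" "N s \<in> measurable M (count_space UNIV)"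
    using s h by (auto intro!: Nm)
  let ?D = "\<lambda>\<omega>. N (s + h) \<omega> - N s \<omega>" and ?U = "\<lambda>\<omega>. \<lambda>u\<in>{0..s}. N u \<omega>"
  let ?R = "PiM {0..s} (\<lambda>_. count_space UNIV) :: (real \<Rightarrow> nat) measure"
  let ?G = "prod_algebra {0..s} (\<lambda>_. count_space UNIV :: nat measure)"
  show "random_variable (count_space UNIV) ?D" by measurable
  show U: "random_variable ?R ?U" by (rule measurable_restrict) (auto intro!: Nm)
  show "sets ?R = sigma_sets (space ?R) ?G" by (simp add: sets_PiM space_PiM)
  show "Int_stable ?G" by (rule Int_stable_prod_algebra)
  show "?G \<subseteq> sets ?R" by (auto simp: sets_PiM)
  fix A :: "nat set" and B assume "A \<in> sets (count_space UNIV)" and B: "B \<in> ?G"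
  from B obtain J E where BE: "B = prod_emb {0..s} (\<lambda>_. count_space UNIV) J (\<Pi>\<^sub>E j\<in>J. E j)"
    and J: "finite J" "J \<subseteq> {0..s}" by (rule prod_algebraE)
  obtain \<tau> :: "nat \<Rightarrow> real" and m where \<tau>: "\<tau> 0 = 0" "mono \<tau>" "\<tau> m = s" "\<tau> (Suc m) = s + h"
    and "\<And>u. u \<in> J \<Longrightarrow> \<exists>k\<le>m. \<tau> k = u"
    using exists_partition_with_points[OF J s h] by metis
  then obtain idx where idx: "\<And>u. u \<in> J \<Longrightarrow> idx u \<le> m \<and> \<tau> (idx u) = u" by metis
  have \<tau>0: "0 \<le> \<tau> k" for k using monoD[OF \<tau>(2), of 0 k] \<tau>(1) by simp
  define I where "I j \<omega> = N (\<tau> (Suc j)) \<omega> - N (\<tau> j) \<omega>" for j \<omega>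
  have "indep_vars (\<lambda>_. count_space UNIV) I {..<Suc m}"
    using N \<tau>(1,2) unfolding poisson_process_def I_def[abs_def] by auto
  then have "indep_var (PiM {m} (\<lambda>_. count_space UNIV)) (\<lambda>\<omega>. \<lambda>j\<in>{m}. I j \<omega>)
     (PiM {..<m} (\<lambda>_. count_space UNIV)) (\<lambda>\<omega>. \<lambda>j\<in>{..<m}. I j \<omega>)"
    by (rule indep_var_restrict) auto
  then have "indep_pair (count_space UNIV) (\<lambda>\<omega>. (\<lambda>j\<in>{m}. I j \<omega>) m)
     (PiM {..<m} (\<lambda>_. count_space UNIV)) (\<lambda>\<omega>. \<lambda>j\<in>{..<m}. I j \<omega>)"
    unfolding indep_pair_iff_indep_var[symmetric]
    by (rule indep_pair_compose[where f = "\<lambda>\<alpha>. \<alpha> m" and g = "\<lambda>x. x"]) auto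
  then have ind: "indep_pair (count_space UNIV) ?D (PiM {..<m} (\<lambda>_. count_space UNIV)) (\<lambda>\<omega>. \<lambda>j\<in>{..<m}. I j \<omega>)"
    by (simp add: I_def \<tau>)
  \<comment> \<open>The cylinder event rewritten in the increments: the value at \<open>u\<close> is
    the sum of the increments before index \<open>idx u \<le> m\<close>, so increment
    \<open>m\<close> does not occur.\<close>
  define C where "C = {\<beta>\<in>(\<Pi>\<^sub>E j\<in>{..<m}. (UNIV::nat set)). \<forall>u\<in>J. (\<Sum>j<idx u. \<beta> j) \<in> E u}"
  have C: "C \<in> sets (PiM {..<m} (\<lambda>_. count_space UNIV))"
    by (subst count_space_PiM_finite) (auto simp: C_def)
  \<comment> \<open>Only almost sure: telescoping needs \<open>N 0 = 0\<close> and a monotone path,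
    on which truncated subtraction is genuine.\<close>
  have AE: "AE \<omega> in M. ?U \<omega> \<in> B \<longleftrightarrow> (\<lambda>j\<in>{..<m}. I j \<omega>) \<in> C"
    using poisson_process_AE[OF N]
  proof eventually_elim
    case (elim \<omega>)
    have mono: "mono_on {0..} (\<lambda>t. N t \<omega>)" using elim by simp
    have "(\<Sum>j<k. I j \<omega>) = N (\<tau> k) \<omega>" for k
    proof (induction k)
      case (Suc k)
      have "N (\<tau> k) \<omega> \<le> N (\<tau> (Suc k)) \<omega>"
        using \<tau>0 monoD[OF \<tau>(2), of k "Suc k"] by (intro mono_onD[OF mono]) auto
      then show ?case using Suc by (simp add: I_def)
    qed (use elim \<tau> in simp)
    moreover have "(\<Sum>j<idx u. (\<lambda>j\<in>{..<m}. I j \<omega>) j) = (\<Sum>j<idx u. I j \<omega>)" if "u \<in> J" for u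
      using idx[OF that] by (intro sum.cong) auto
    ultimately have "(\<lambda>j\<in>{..<m}. I j \<omega>) \<in> C \<longleftrightarrow> (\<forall>u\<in>J. N u \<omega> \<in> E u)"
      using idx by (auto simp: C_def)
    moreover have "?U \<omega> \<in> B \<longleftrightarrow> (\<forall>u\<in>J. N u \<omega> \<in> E u)"
      using J(2) by (auto simp: BE prod_emb_iff PiE_iff)
    ultimately show ?case by simp
  qed
  have Bm: "B \<in> sets ?R" using B by (auto simp: sets_PiM)
  have Im[measurable]: "random_variable (PiM {..<m} (\<lambda>_. count_space UNIV)) (\<lambda>\<omega>. \<lambda>j\<in>{..<m}. I j \<omega>)"
    by (rule indep_pair_rv2[OF ind])
  have DA: "?D -` A \<inter> space M \<in> events" by measurable
  have UB: "?U -` B \<inter> space M \<in> events" using measurable_sets[OF U Bm] .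
  have IC: "(\<lambda>\<omega>. \<lambda>j\<in>{..<m}. I j \<omega>) -` C \<inter> space M \<in> events" using measurable_sets[OF Im C] .
  have "prob (?D -` A \<inter> space M \<inter> (?U -` B \<inter> space M)) = prob (?D -` A \<inter> space M \<inter> ((\<lambda>\<omega>. \<lambda>j\<in>{..<m}. I j \<omega>) -` C \<inter> space M))"
    by (rule measure_eq_AE) (use AE DA UB IC in auto)
  also have "\<dots> = prob (?D -` A \<inter> space M) * prob ((\<lambda>\<omega>. \<lambda>j\<in>{..<m}. I j \<omega>) -` C \<inter> space M)"
    by (rule indep_pairD[OF ind _ C]) auto
  also have "prob ((\<lambda>\<omega>. \<lambda>j\<in>{..<m}. I j \<omega>) -` C \<inter> space M) = prob (?U -` B \<inter> space M)"
    by (rule measure_eq_AE) (use AE UB IC in auto)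
  finally show "prob (?D -` A \<inter> space M \<inter> (?U -` B \<inter> space M)) = prob (?D -` A \<inter> space M) * prob (?U -` B \<inter> space M)" .
qed

text \<open>The increment is independent of its own past, and the pair of both is a measurable
  function of the whole path \<open>i\<close>, hence independent of the other paths;
  \<open>indep_pair_assoc\<close> combines the two facts.\<close>

lemma poisson_increment_indep_past:
  assumes N: "poisson_process M r (Y i)" and ind: "independent_processes M Y" and s: "0 \<le> s" and h: "0 < h"
  shows "indep_pair (count_space UNIV) (\<lambda>\<omega>. Y i (s + h) \<omega> - Y i s \<omega>) (past_space i s) (past Y i s)"
  unfolding past_space_def past_def
proof (rule indep_pair_assoc)
  show "indep_pair (count_space UNIV) (\<lambda>\<omega>. Y i (s + h) \<omega> - Y i s \<omega>)
     (PiM {0..s} (\<lambda>_. count_space UNIV)) (\<lambda>\<omega>. \<lambda>u\<in>{0..s}. Y i u \<omega>)"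
    by (rule poisson_increment_indep_own_past[OF N s h])
  let ?path = "PiM {0..} (\<lambda>_. count_space UNIV) :: (real \<Rightarrow> nat) measure"
  have "indep_vars (\<lambda>_. ?path) (\<lambda>i \<omega>. \<lambda>t\<in>{0..}. Y i t \<omega>) UNIV"
    using ind unfolding independent_processes_def .
  then have "indep_var (PiM {i} (\<lambda>_. ?path)) (\<lambda>\<omega>. \<lambda>j\<in>{i}. \<lambda>t\<in>{0..}. Y j t \<omega>)
     (PiM (UNIV - {i}) (\<lambda>_. ?path)) (\<lambda>\<omega>. \<lambda>j\<in>UNIV - {i}. \<lambda>t\<in>{0..}. Y j t \<omega>)"
    by (rule indep_var_restrict) auto
  then have "indep_pair (count_space UNIV \<Otimes>\<^sub>M PiM {0..s} (\<lambda>_. count_space UNIV))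
      (\<lambda>\<omega>. (\<lambda>\<alpha>. (\<alpha> i (s + h) - \<alpha> i s, \<lambda>u\<in>{0..s}. \<alpha> i u)) (\<lambda>j\<in>{i}. \<lambda>t\<in>{0..}. Y j t \<omega>))
     (PiM (UNIV - {i}) (\<lambda>_. ?path)) (\<lambda>\<omega>. \<lambda>j\<in>UNIV - {i}. \<lambda>t\<in>{0..}. Y j t \<omega>)"
    unfolding indep_pair_iff_indep_var[symmetric]
  proof (rule indep_pair_compose[where g = "\<lambda>x. x"])
    have c: "(\<lambda>\<alpha>. \<alpha> i u) \<in> measurable (PiM {i} (\<lambda>_. ?path)) (count_space UNIV)" if "0 \<le> u" for u
      using that measurable_compose[OF measurable_component_singleton[of i "{i}" "\<lambda>_. ?path"]
          measurable_component_singleton[of u "{0..}" "\<lambda>_. count_space UNIV"]] by simp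
    have diff: "(\<lambda>x. a x - b x) \<in> measurable Q (count_space UNIV)"
      if [measurable]: "a \<in> measurable Q (count_space UNIV)" "b \<in> measurable Q (count_space UNIV)"
      for a b :: "'q \<Rightarrow> nat" and Q :: "'q measure"
      by measurable
    show "(\<lambda>\<alpha>. (\<alpha> i (s + h) - \<alpha> i s, \<lambda>u\<in>{0..s}. \<alpha> i u)) \<in> measurable (PiM {i} (\<lambda>_. ?path)) (count_space UNIV \<Otimes>\<^sub>M PiM {0..s} (\<lambda>_. count_space UNIV))"
      by (intro measurable_Pair diff c measurable_restrict) (use s h in auto)
  qed auto
  moreover have "(\<lambda>u\<in>{0..s}. (\<lambda>t\<in>{0..}. Y i t \<omega>) u) = (\<lambda>u\<in>{0..s}. Y i u \<omega>)" for \<omega> by auto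
  ultimately show "indep_pair (count_space UNIV \<Otimes>\<^sub>M PiM {0..s} (\<lambda>_. count_space UNIV))
      (\<lambda>\<omega>. (Y i (s + h) \<omega> - Y i s \<omega>, \<lambda>u\<in>{0..s}. Y i u \<omega>))
     (PiM (UNIV - {i}) (\<lambda>_. ?path)) (\<lambda>\<omega>. \<lambda>j\<in>UNIV - {i}. \<lambda>t\<in>{0..}. Y j t \<omega>)"
    using s h by simp
qed

text \<open>With \<open>B\<close> the event that clock \<open>i\<close> exceeds \<open>s\<close>,
  this becomes the hypothesis \<open>stop\<close> of
  \<open>poisson_process_stopped_mean\<close>.\<close>

lemma poisson_increment_mean_on_past_event:
  assumes N: "poisson_process M 1 (Y i)" and ind: "independent_processes M Y" and s: "0 \<le> s" and h: "0 < h"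
    and B[measurable]: "B \<in> sets (past_space i s)"
  shows "expectation (\<lambda>\<omega>. indicator B (past Y i s \<omega>) * real (Y i (s + h) \<omega> - Y i s \<omega>))
    = expectation (\<lambda>\<omega>. indicator B (past Y i s \<omega>)) * h"
proof -
  note iv = poisson_increment_indep_past[OF N ind s h]
  have "indep_pair borel (\<lambda>\<omega>. real (Y i (s + h) \<omega> - Y i s \<omega>)) borel (\<lambda>\<omega>. indicator B (past Y i s \<omega>) :: real)"
    by (rule indep_pair_compose[OF iv]) auto
  then have "indep_var borel (\<lambda>\<omega>. real (Y i (s + h) \<omega> - Y i s \<omega>)) borel (\<lambda>\<omega>. indicator B (past Y i s \<omega>) :: real)"
    by (simp add: indep_pair_iff_indep_var)
  moreover have "integrable M (\<lambda>\<omega>. real (Y i (s + h) \<omega> - Y i s \<omega>))"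
    using s h by (intro integrable_poisson_increment[OF N]) auto
  moreover have [measurable]: "random_variable (past_space i s) (past Y i s)"
    by (rule indep_pair_rv2[OF iv])
  have "integrable M (\<lambda>\<omega>. indicator B (past Y i s \<omega>) :: real)"
    by (rule integrable_const_bound[of _ 1]) auto
  ultimately have "expectation (\<lambda>\<omega>. real (Y i (s + h) \<omega> - Y i s \<omega>) * indicator B (past Y i s \<omega>))
    = expectation (\<lambda>\<omega>. real (Y i (s + h) \<omega> - Y i s \<omega>)) * expectation (\<lambda>\<omega>. indicator B (past Y i s \<omega>))"
    by (rule indep_var_lebesgue_integral)
  also have "expectation (\<lambda>\<omega>. real (Y i (s + h) \<omega> - Y i s \<omega>)) = h"
    using poisson_increment_mean[OF N s, of "s + h"] h by simp
  finally show ?thesis by (simp add: mult.commute)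
qed

end

section \<open>Adaptedness of the time change\<close>

text \<open>The half-open interval matches \<open>runs\<close>: the integrand is known where the
  counts are still frozen, which excludes the time \<open>u\<close> of a possible jump.\<close>

lemma LBINT_Icc_diff:
  fixes h :: "real \<Rightarrow> real"
  assumes h: "set_integrable lborel {0..u} h" and \<sigma>: "0 \<le> \<sigma>" "\<sigma> \<le> u"
  shows "(LBINT s:{0..u}. h s) - (LBINT s:{0..\<sigma>}. h s) = (LBINT s:{\<sigma>..<u}. h s)"
proof -
  have sub: "set_integrable lborel A h" if "A \<subseteq> {0..u}" "A \<in> sets lborel" for A
    using set_integrable_subset[OF h] that by auto
  have meas: "(\<lambda>s. indicator A s *\<^sub>R h s) \<in> borel_measurable lborel" if "A \<subseteq> {0..u}" "A \<in> sets lborel" for A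
    using sub[OF that] unfolding set_integrable_def by (rule borel_measurable_integrable)
  have "(LBINT s:{0..u}. h s) - (LBINT s:{0..\<sigma>}. h s) = (\<integral>s. indicator {0..u} s *\<^sub>R h s - indicator {0..\<sigma>} s *\<^sub>R h s \<partial>lborel)"
    unfolding set_lebesgue_integral_def using h sub[of "{0..\<sigma>}"] \<sigma>
    by (intro Bochner_Integration.integral_diff[symmetric]) (auto simp: set_integrable_def)
  also have "\<dots> = (\<integral>s. indicator {\<sigma>..<u} s *\<^sub>R h s \<partial>lborel)"
  proof (rule integral_cong_AE)
    show "AE s in lborel. indicator {0..u} s *\<^sub>R h s - indicator {0..\<sigma>} s *\<^sub>R h s = indicator {\<sigma>..<u} s *\<^sub>R h s"
      using AE_lborel_singleton[of \<sigma>] AE_lborel_singleton[of u]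
      by eventually_elim (use \<sigma> in \<open>auto simp: indicator_def\<close>)
  qed (intro borel_measurable_diff meas; use \<sigma> in auto)+
  finally show ?thesis by (simp add: set_lebesgue_integral_def)
qed

lemma continuous_on_LBINT:
  fixes h :: "real \<Rightarrow> real"
  assumes h: "set_integrable lborel {0..T} h"
  shows "continuous_on {0..T} (\<lambda>u. LBINT s:{0..u}. h s)"
proof -
  have "set_integrable lborel {0..u} h" if "u \<in> {0..T}" for u
    using set_integrable_subset[OF h] that by auto
  then have "continuous_on {0..T} (\<lambda>u. LBINT s:{0..u}. h s) \<longleftrightarrow> continuous_on {0..T} (\<lambda>u. integral {0..u} h)"
    by (intro continuous_on_cong refl set_borel_integral_eq_integral(2))
  also have "\<dots>" using set_borel_integral_eq_integral(1)[OF h] by (rule indefinite_integral_continuous_1)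
  finally show ?thesis .
qed

lemma mono_on_LBINT:
  fixes h :: "real \<Rightarrow> real"
  assumes h: "set_integrable lborel {0..T} h" and nonneg: "\<And>s. s \<in> {0..T} \<Longrightarrow> 0 \<le> h s"
  shows "mono_on {0..T} (\<lambda>u. LBINT s:{0..u}. h s)"
proof (rule mono_onI)
  fix u w assume uw: "u \<in> {0..T}" "w \<in> {0..T}" "u \<le> w"
  have "set_integrable lborel {0..u} h" "set_integrable lborel {0..w} h"
    using set_integrable_subset[OF h] uw by auto
  then show "(LBINT s:{0..u}. h s) \<le> (LBINT s:{0..w}. h s)"
    unfolding set_lebesgue_integral_def
    by (intro integral_mono) (use uw nonneg in \<open>auto simp: set_integrable_def indicator_def\<close>)
qed

text \<open>
  The positive part and the truncation of \<open>u\<close> to \<open>[0, T]\<close> make this nondecreasing and continuous in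
  \<open>u\<close> for all \<open>c\<close>, including states that the process never visits.
\<close>

definition frozen_clock ::
  "real \<Rightarrow> real^'d \<Rightarrow> ('k::finite \<Rightarrow> real^'d) \<Rightarrow> ('k \<Rightarrow> real \<Rightarrow> real^'d \<Rightarrow> real) \<Rightarrow> 'k \<Rightarrow> ('k \<Rightarrow> nat) \<Rightarrow> real \<Rightarrow> real" where
  "frozen_clock T x0 l f j c u =
     (LBINT s:{0..max 0 (min u T)}. max 0 (f j s (x0 + (\<Sum>i\<in>UNIV. real (c i) *\<^sub>R l i))))"

text \<open>
  Driving paths rebuilt from the past: path \<open>i\<close> is stopped at time \<open>s\<close>, the others are known entirely.
\<close>

definition past_path :: "'k \<Rightarrow> real \<Rightarrow> (real \<Rightarrow> nat) \<times> ('k \<Rightarrow> real \<Rightarrow> nat) \<Rightarrow> 'k \<Rightarrow> real \<Rightarrow> nat" where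
  "past_path i s p j q = (if j = i then fst p (min q s) else snd p j q)"

locale rates =
  fixes T :: real and x0 :: "real^'d" and l :: "'k::finite \<Rightarrow> real^'d" and f :: "'k \<Rightarrow> real \<Rightarrow> real^'d \<Rightarrow> real"
  assumes T_nonneg: "0 \<le> T" and f_cont: "\<And>i. continuous_on ({0..T} \<times> UNIV) (\<lambda>(t, x). f i t x)"
begin

abbreviation "R \<equiv> frozen_clock T x0 l f"

lemma continuous_on_f_time: "continuous_on {0..T} (\<lambda>s. f j s v)"
proof -
  have "continuous_on {0..T} (\<lambda>s. (s, v))" by (intro continuous_intros)
  then have "continuous_on {0..T} (\<lambda>s. (\<lambda>(t, x). f j t x) (s, v))"
    by (rule continuous_on_compose2[OF f_cont]) auto
  then show ?thesis by simp
qed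

lemma set_integrable_frozen: "set_integrable lborel {0..T} (\<lambda>s. max 0 (f j s v))"
  by (rule borel_integrable_atLeastAtMost') (intro continuous_intros continuous_on_f_time)

lemma clocks_frozen: "t \<in> {0..T} \<Longrightarrow> clocks R t"
proof
  assume t: "t \<in> {0..T}"
  show "0 \<le> t" using t by simp
  fix j :: 'k and c :: "'k \<Rightarrow> nat"
  let ?h = "\<lambda>s. max 0 (f j s (x0 + (\<Sum>i\<in>UNIV. real (c i) *\<^sub>R l i)))"
  show "mono (R j c)"
  proof
    fix u w :: real assume "u \<le> w"
    then show "R j c u \<le> R j c w"
      unfolding frozen_clock_def using T_nonneg
      by (intro mono_onD[OF mono_on_LBINT[OF set_integrable_frozen]]) auto
  qed
  have "continuous_on UNIV (\<lambda>u. max 0 (min u T))" by (intro continuous_intros)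
  then show "continuous_on UNIV (R j c)"
    unfolding frozen_clock_def using T_nonneg
    by (intro continuous_on_compose2[OF continuous_on_LBINT[OF set_integrable_frozen]]) auto
qed

lemma frozen_clock_diff:
  assumes "0 \<le> \<sigma>" "\<sigma> \<le> u" "u \<le> T"
  shows "R j c u - R j c \<sigma> = (LBINT s:{\<sigma>..<u}. max 0 (f j s (x0 + (\<Sum>i\<in>UNIV. real (c i) *\<^sub>R l i))))"
proof -
  have "set_integrable lborel {0..u} (\<lambda>s. max 0 (f j s (x0 + (\<Sum>i\<in>UNIV. real (c i) *\<^sub>R l i))))"
    using set_integrable_subset[OF set_integrable_frozen] assms by auto
  from LBINT_Icc_diff[OF this assms(1,2)] show ?thesis
    using assms by (simp add: frozen_clock_def max_def min_def)
qed

end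

section \<open>A single path of the jump process\<close>

locale time_changed_path = rates T x0 l f
  for T :: real and x0 :: "real^'d" and l :: "'k::finite \<Rightarrow> real^'d" and f :: "'k \<Rightarrow> real \<Rightarrow> real^'d \<Rightarrow> real" +
  fixes Y :: "'k \<Rightarrow> real \<Rightarrow> nat" and x :: "real \<Rightarrow> real^'d"
  assumes Y_mono: "\<And>j. mono_on {0..} (Y j)"
    and Y_right: "\<And>j u. 0 \<le> u \<Longrightarrow> continuous (at_right u) (Y j)"
    and x_int: "\<And>j t. t \<in> {0..T} \<Longrightarrow> set_integrable lborel {0..t} (\<lambda>s. f j s (x s))"
    and x_eq: "\<And>t. t \<in> {0..T} \<Longrightarrow> x t = x0 + (\<Sum>j\<in>UNIV. real (Y j (LBINT s:{0..t}. f j s (x s))) *\<^sub>R l j)"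
    and x_nonneg: "\<And>j t. t \<in> {0..T} \<Longrightarrow> 0 \<le> f j t (x t)"
begin

definition \<tau> :: "'k \<Rightarrow> real \<Rightarrow> real" where "\<tau> j t = (LBINT s:{0..t}. f j s (x s))"

definition y :: "'k \<Rightarrow> real \<Rightarrow> nat" where "y j = rc_version (Y j)"

lemma counting_paths_y: "counting_paths y"
  by (simp add: counting_paths_def y_def mono_rc_version right_constant_rc_version)

lemma y_eq: "0 \<le> u \<Longrightarrow> y j u = Y j u"
  unfolding y_def by (rule rc_version_eq[OF Y_mono Y_right])

lemma \<tau>_cont: "continuous_on {0..T} (\<tau> j)"
  unfolding \<tau>_def using T_nonneg by (intro continuous_on_LBINT x_int) auto

lemma \<tau>_mono: "mono_on {0..T} (\<tau> j)"
  unfolding \<tau>_def using T_nonneg by (intro mono_on_LBINT x_int x_nonneg) auto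

lemma \<tau>_0: "\<tau> j 0 = 0"
proof -
  have "AE s in lborel. indicator {0..0} s *\<^sub>R f j s (x s) = 0"
    using AE_lborel_singleton[of 0] by eventually_elim (auto simp: indicator_def)
  then show ?thesis unfolding \<tau>_def set_lebesgue_integral_def by (rule integral_eq_zero_AE)
qed

lemma \<tau>_nonneg: "t \<in> {0..T} \<Longrightarrow> 0 \<le> \<tau> j t"
  using mono_onD[OF \<tau>_mono, of 0 t j] \<tau>_0 by simp

lemma x_eq_y: "t \<in> {0..T} \<Longrightarrow> x t = x0 + (\<Sum>j\<in>UNIV. real (y j (\<tau> j t)) *\<^sub>R l j)"
  using x_eq by (simp add: y_eq \<tau>_nonneg) (simp add: \<tau>_def)

lemma runs_\<tau>:
  assumes t: "t \<in> {0..T}"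
  shows "clocks.runs R t y \<tau>"
proof -
  interpret clocks R t by (rule clocks_frozen[OF t])
  show ?thesis
    unfolding runs_def
  proof (intro conjI allI impI)
    fix j
    show "\<tau> j 0 = 0" by (rule \<tau>_0)
    show "continuous_on {0..t} (\<tau> j)" using t by (intro continuous_on_subset[OF \<tau>_cont]) auto
    show "mono_on {0..t} (\<tau> j)" using t by (intro mono_on_subset[OF \<tau>_mono]) auto
  next
    fix \<sigma> u c j
    assume *: "0 \<le> \<sigma> \<and> \<sigma> \<le> u \<and> u \<le> t \<and> (\<forall>w. \<sigma> \<le> w \<and> w < u \<longrightarrow> (\<lambda>j. y j (\<tau> j w)) = c)"
    have u: "u \<in> {0..T}" using * t by auto
    have "\<tau> j u - \<tau> j \<sigma> = (LBINT s:{\<sigma>..<u}. f j s (x s))"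
      unfolding \<tau>_def using * by (intro LBINT_Icc_diff x_int u) auto
    also have "\<dots> = (LBINT s:{\<sigma>..<u}. max 0 (f j s (x0 + (\<Sum>i\<in>UNIV. real (c i) *\<^sub>R l i))))"
    proof (rule set_lebesgue_integral_cong)
      show "\<forall>s. s \<in> {\<sigma>..<u} \<longrightarrow> f j s (x s) = max 0 (f j s (x0 + (\<Sum>i\<in>UNIV. real (c i) *\<^sub>R l i)))"
      proof (intro allI impI)
        fix s assume s: "s \<in> {\<sigma>..<u}"
        then have sT: "s \<in> {0..T}" using * u by auto
        have "(\<lambda>j. y j (\<tau> j s)) = c" using * s by auto
        then have "c = (\<lambda>j. y j (\<tau> j s))" ..
        then have "x s = x0 + (\<Sum>i\<in>UNIV. real (c i) *\<^sub>R l i)" using x_eq_y[OF sT] by simp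
        then show "f j s (x s) = max 0 (f j s (x0 + (\<Sum>i\<in>UNIV. real (c i) *\<^sub>R l i)))"
          using x_nonneg[OF sT, of j] by simp
      qed
    qed simp
    also have "\<dots> = R j c u - R j c \<sigma>"
      using * u by (intro frozen_clock_diff[symmetric]) auto
    finally show "\<tau> j u = \<tau> j \<sigma> + R j c u - R j c \<sigma>" by simp
  qed
qed

lemma \<tau>_le_iff_past:
  assumes t: "t \<in> {0..T}" and s: "0 \<le> s"
    and p: "p = (\<lambda>u\<in>{0..s}. Y i u, \<lambda>j\<in>UNIV - {i}. \<lambda>u\<in>{0..}. Y j u)"
  shows "\<tau> i t \<le> s \<longleftrightarrow> (\<forall>n. snd (jump_chain t R (\<lambda>j. rc_version (past_path i s p j)) n) i \<le> s)"
proof -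
  interpret clocks R t by (rule clocks_frozen[OF t])
  let ?y = "\<lambda>j. rc_version (past_path i s p j)"
  have y': "counting_paths ?y"
    by (simp add: counting_paths_def mono_rc_version right_constant_rc_version)
  \<comment> \<open>At \<open>u\<close> the version reads its path only beyond \<open>u\<close>. So
    for \<open>u \<ge> 0\<close> the unspecified values of the restricted functions at negative
    times do not matter.\<close>
  have cong: "rc_version a u = rc_version b u" if "\<And>q. u < q \<Longrightarrow> a q = b q" for a b :: "real \<Rightarrow> nat" and u
    unfolding rc_version_def using that by (intro arg_cong[where f = Inf] image_cong) auto
  have "snd (jump_chain t R y n) i \<le> s \<longleftrightarrow> snd (jump_chain t R ?y n) i \<le> s" for n
  proof (rule jump_chain_le_iff[OF counting_paths_y y'])
    fix u :: real assume u: "0 \<le> u" "u \<le> s"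
    have "?y i u = rc_version (\<lambda>q. Y i (min q s)) u"
      by (rule cong) (use u s in \<open>auto simp: past_path_def p\<close>)
    also have "\<dots> = Y i u" by (rule rc_version_stopped_eq[OF Y_mono Y_right u])
    finally show "y i u = ?y i u" using y_eq[OF u(1)] by simp
  next
    fix j u assume "j \<noteq> i" "0 \<le> (u::real)"
    then show "y j u = ?y j u"
      unfolding y_def by (intro cong) (auto simp: past_path_def p)
  qed
  then show ?thesis using clock_le_iff_jump_chain[OF counting_paths_y runs_\<tau>[OF t], of i s] by simp
qed

text \<open>The clocks are continuous and approach their values from above, where counting paths are
  locally constant. This right-continuity later yields a jointly measurable version of the
  process.\<close>

lemma right_constant_x:
  assumes v: "\<And>m. v m \<in> {u..T}" "v \<longlonglongrightarrow> u" and u: "0 \<le> u"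
  shows "(\<lambda>m. x (v m)) \<longlonglongrightarrow> x u"
proof (rule tendsto_eventually)
  have uT: "u \<in> {0..T}" using v(1)[of 0] u by auto
  have "\<forall>\<^sub>F m in sequentially. \<forall>j\<in>UNIV. y j (\<tau> j (v m)) = y j (\<tau> j u)"
  proof (intro eventually_ball_finite ballI)
    fix j
    obtain e where e: "e > 0" "\<And>w. \<tau> j u \<le> w \<Longrightarrow> w < \<tau> j u + e \<Longrightarrow> y j w = y j (\<tau> j u)"
      using counting_paths_right_constant[OF counting_paths_y, of j] unfolding right_constant_def by meson
    have "(\<lambda>m. \<tau> j (v m)) \<longlonglongrightarrow> \<tau> j u"
      by (rule continuous_on_tendsto_compose[OF \<tau>_cont v(2) uT]) (use v(1) u in \<open>auto intro!: always_eventually\<close>, metis order.trans)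
    then have "\<forall>\<^sub>F m in sequentially. \<tau> j (v m) < \<tau> j u + e"
      using e(1) by (intro order_tendstoD(2)) auto
    then show "\<forall>\<^sub>F m in sequentially. y j (\<tau> j (v m)) = y j (\<tau> j u)"
    proof eventually_elim
      case (elim m)
      have "\<tau> j u \<le> \<tau> j (v m)"
        using v(1)[of m] u by (intro mono_onD[OF \<tau>_mono]) auto
      then show ?case using elim by (intro e(2))
    qed
  qed simp
  then show "\<forall>\<^sub>F m in sequentially. x (v m) = x u"
  proof eventually_elim
    case (elim m)
    have "v m \<in> {0..T}" using v(1)[of m] u by auto
    then show ?case using elim uT by (simp add: x_eq_y)
  qed
qed

end

lemma measurable_past_event:
  fixes R :: "'k::finite \<Rightarrow> ('k \<Rightarrow> nat) \<Rightarrow> real \<Rightarrow> real"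
  assumes "clocks R t" and s: "0 \<le> s"
  shows "{p \<in> space (past_space i s). \<forall>n. snd (jump_chain t R (\<lambda>j. rc_version (past_path i s p j)) n) i \<le> s} \<in> sets (past_space i s)"
proof -
  interpret clocks R t by fact
  have [measurable]: "(\<lambda>p. snd (jump_chain t R (\<lambda>j. rc_version (past_path i s p j)) n) i) \<in> borel_measurable (past_space i s)" for n
  proof (rule measurable_jump_chain)
    fix j :: 'k and q :: real assume q: "0 \<le> q"
    show "(\<lambda>p. past_path i s p j q) \<in> measurable (past_space i s) (count_space UNIV)"
    proof (cases "j = i")
      case True
      have "(\<lambda>p. fst p (min q s)) \<in> measurable (past_space i s) (count_space UNIV)"
        unfolding past_space_def
        using measurable_compose[OF measurable_fst measurable_component_singleton[of "min q s" "{0..s}" "\<lambda>_. count_space UNIV"]] q s by simp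
      then show ?thesis using True by (simp add: past_path_def)
    next
      case False
      have "(\<lambda>p. snd p j q) \<in> measurable (past_space i s) (count_space UNIV)"
        unfolding past_space_def
        using measurable_compose[OF measurable_compose[OF measurable_snd measurable_component_singleton[of j "UNIV - {i}" "\<lambda>_. PiM {0..} (\<lambda>_. count_space UNIV)"]]
            measurable_component_singleton[of q "{0..}" "\<lambda>_. count_space UNIV"]] q False by simp
      then show ?thesis using False by (simp add: past_path_def)
    qed
  qed
  show ?thesis by measurable
qed

context prob_space
begin

text \<open>The clock itself is meaningful only outside a null set; \<open>\<rho>\<close> is a
  version that is measurable and nonnegative at every outcome, as needed for evaluating paths at
  it.\<close>

lemma time_changed_count_mean:
  fixes Y :: "'k::finite \<Rightarrow> real \<Rightarrow> 'a \<Rightarrow> nat" and x0 :: "real^'d"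
  assumes path: "AE \<omega> in M. time_changed_path T x0 l f (\<lambda>j u. Y j u \<omega>) (\<lambda>u. X u \<omega>)"
    and N: "\<And>j. poisson_process M 1 (Y j)" and ind: "independent_processes M Y"
    and rates: "rates T f" and t: "t \<in> {0..T}"
    and \<rho>[measurable]: "\<rho> \<in> borel_measurable M" and \<rho>_nonneg: "\<And>\<omega>. 0 \<le> \<rho> \<omega>" and \<rho>_int: "integrable M \<rho>"
    and \<rho>_eq: "AE \<omega> in M. \<rho> \<omega> = (LBINT s:{0..t}. f i s (X s \<omega>))"
  shows "integrable M (\<lambda>\<omega>. real (rc_version (\<lambda>u. Y i u \<omega>) (\<rho> \<omega>)))"
    and "expectation (\<lambda>\<omega>. real (rc_version (\<lambda>u. Y i u \<omega>) (\<rho> \<omega>))) = expectation \<rho>"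
proof -
  have stop: "expectation (\<lambda>\<omega>. indicator {s<..} (\<rho> \<omega>) * real (Y i (s + h) \<omega> - Y i s \<omega>)) = expectation (\<lambda>\<omega>. indicator {s<..} (\<rho> \<omega>)) * h"
    if s: "0 \<le> s" and h: "0 < h" for s h
  proof -
    let ?R = "frozen_clock T x0 l f"
    have cl: "clocks ?R t" using rates.clocks_frozen[OF rates t] .
    \<comment> \<open>The complement, because \<open>stop\<close> concerns the event
      \<open>\<rho> > s\<close>.\<close>
    define B where "B = space (past_space i s) - {p \<in> space (past_space i s). \<forall>n. snd (jump_chain t ?R (\<lambda>j. rc_version (past_path i s p j)) n) i \<le> s}"
    have B[measurable]: "B \<in> sets (past_space i s)"
      unfolding B_def by (intro sets.compl_sets measurable_past_event[OF cl s])
    have pm[measurable]: "random_variable (past_space i s) (past Y i s)"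
      by (rule indep_pair_rv2[OF poisson_increment_indep_past[OF N ind s h]])
    have [measurable]: "Y i (s + h) \<in> measurable M (count_space UNIV)" "Y i s \<in> measurable M (count_space UNIV)"
      using poisson_process_measurable[OF N] s h by auto
    have AE: "AE \<omega> in M. (indicator {s<..} (\<rho> \<omega>) :: real) = indicator B (past Y i s \<omega>)"
      using path \<rho>_eq AE_space
    proof eventually_elim
      case (elim \<omega>)
      interpret time_changed_path T x0 l f "\<lambda>j u. Y j u \<omega>" "\<lambda>u. X u \<omega>" by fact
      have "\<tau> i t \<le> s \<longleftrightarrow> (\<forall>n. snd (jump_chain t ?R (\<lambda>j. rc_version (past_path i s (past Y i s \<omega>) j)) n) i \<le> s)"
        by (rule \<tau>_le_iff_past[OF t s]) (simp add: past_def)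
      moreover have "\<rho> \<omega> = \<tau> i t" using elim by (simp add: \<tau>_def)
      moreover have "past Y i s \<omega> \<in> space (past_space i s)" using measurable_space[OF pm] elim by simp
      ultimately have "s < \<rho> \<omega> \<longleftrightarrow> past Y i s \<omega> \<in> B" unfolding B_def by (simp add: not_le[symmetric])
      then show ?case by (simp add: indicator_def)
    qed
    have "expectation (\<lambda>\<omega>. indicator {s<..} (\<rho> \<omega>) * real (Y i (s + h) \<omega> - Y i s \<omega>))
      = expectation (\<lambda>\<omega>. indicator B (past Y i s \<omega>) * real (Y i (s + h) \<omega> - Y i s \<omega>))"
      by (rule integral_cong_AE) (measurable, use AE in \<open>eventually_elim, simp\<close>)
    also have "\<dots> = expectation (\<lambda>\<omega>. indicator B (past Y i s \<omega>)) * h"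
      by (rule poisson_increment_mean_on_past_event[OF N ind s h B])
    also have "expectation (\<lambda>\<omega>. indicator B (past Y i s \<omega>) :: real) = expectation (\<lambda>\<omega>. indicator {s<..} (\<rho> \<omega>))"
      by (rule integral_cong_AE[symmetric]) (measurable, use AE in \<open>eventually_elim, simp\<close>)
    finally show ?thesis .
  qed
  show "integrable M (\<lambda>\<omega>. real (rc_version (\<lambda>u. Y i u \<omega>) (\<rho> \<omega>)))"
    and "expectation (\<lambda>\<omega>. real (rc_version (\<lambda>u. Y i u \<omega>) (\<rho> \<omega>))) = expectation \<rho>"
    using poisson_process_stopped_mean[OF N \<rho> \<rho>_nonneg \<rho>_int stop] by auto
qed

end

section \<open>The fluid limit\<close>

text \<open>The integrand \<open>k\<close> is kept apart from \<open>\<phi>\<close> because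
  integrability is known for sums of rates and for norms of drifts, while \<open>\<phi>\<close>, the
  norm of a path, is merely bounded. The bound \<open>S0\<close> only makes the supremum finite and
  does not enter the estimate, which is therefore uniform in families whose individual bounds are
  not.\<close>

lemma integral_gronwall:
  fixes \<phi> k :: "real \<Rightarrow> real"
  assumes a: "0 \<le> a" and b: "0 < b"
    and bound: "\<And>t. t \<in> {0..T} \<Longrightarrow> \<phi> t \<le> S0"
    and k: "\<And>t. t \<in> {0..T} \<Longrightarrow> set_integrable lborel {0..t} k"
    and le: "\<And>t. t \<in> {0..T} \<Longrightarrow> \<phi> t \<le> a + (LBINT s:{0..t}. k s)"
    and k_le: "\<And>s. s \<in> {0..T} \<Longrightarrow> k s \<le> b * \<phi> s"
    and t: "t \<in> {0..T}"
  shows "\<phi> t \<le> 2 * a * exp (2 * b * t)"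
proof -
  \<comment> \<open>The weight \<open>exp (- 2 * b * t)\<close> turns the integral term into at most half of the supremum.\<close>
  define \<psi> where "\<psi> t = \<phi> t * exp (- 2 * b * t)" for t
  define S where "S = (SUP t\<in>{0..T}. \<psi> t)"
  have bdd: "bdd_above (\<psi> ` {0..T})"
  proof (rule bdd_aboveI2)
    fix t assume t: "t \<in> {0..T}"
    have "\<psi> t \<le> \<bar>S0\<bar> * exp (- 2 * b * t)"
      unfolding \<psi>_def using bound[OF t] by (intro mult_right_mono) auto
    also have "\<dots> \<le> \<bar>S0\<bar> * 1" using b t by (intro mult_left_mono) auto
    finally show "\<psi> t \<le> \<bar>S0\<bar>" by simp
  qed
  have S: "\<psi> t \<le> S" if "t \<in> {0..T}" for t
    unfolding S_def using that bdd by (rule cSUP_upper)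
  have phi_S: "\<phi> s \<le> S * exp (2 * b * s)" if "s \<in> {0..T}" for s
  proof -
    have "\<psi> s * exp (2 * b * s) \<le> S * exp (2 * b * s)" using S[OF that] by (intro mult_right_mono) auto
    then show ?thesis by (simp add: \<psi>_def mult.assoc flip: exp_add)
  qed
  have step: "\<psi> t \<le> a + S / 2 - S / 2 * exp (- 2 * b * t)" if t: "t \<in> {0..T}" for t
  proof -
    have cont: "continuous_on {0..t} (\<lambda>s. b * (S * exp (2 * b * s)))" by (intro continuous_intros)
    have "(LBINT s:{0..t}. k s) \<le> (LBINT s:{0..t}. b * (S * exp (2 * b * s)))"
    proof (rule set_integral_mono[OF k[OF t]])
      show "set_integrable lborel {0..t} (\<lambda>s. b * (S * exp (2 * b * s)))"
        using cont by (rule borel_integrable_atLeastAtMost')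
      fix s assume "s \<in> {0..t}"
      then have s: "s \<in> {0..T}" using t by auto
      have "b * \<phi> s \<le> b * (S * exp (2 * b * s))" using b phi_S[OF s] by (intro mult_left_mono) auto
      then show "k s \<le> b * (S * exp (2 * b * s))" using k_le[OF s] by simp
    qed
    also have "\<dots> = S / 2 * exp (2 * b * t) - S / 2 * exp (2 * b * 0)"
      unfolding set_lebesgue_integral_def
      using b t by (subst integral_FTC_Icc[where F = "\<lambda>s. S / 2 * exp (2 * b * s)"])
        (auto intro!: derivative_eq_intros cont simp: has_real_derivative_iff_has_vector_derivative[symmetric])
    finally have "\<phi> t \<le> a + (S / 2 * exp (2 * b * t) - S / 2)" using le[OF t] by simp
    then have "\<psi> t \<le> (a + (S / 2 * exp (2 * b * t) - S / 2)) * exp (- 2 * b * t)"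
      unfolding \<psi>_def by (intro mult_right_mono) auto
    also have "\<dots> = a * exp (- 2 * b * t) + S / 2 * (exp (2 * b * t) * exp (- 2 * b * t)) - S / 2 * exp (- 2 * b * t)"
      by (simp add: algebra_simps)
    also have "exp (2 * b * t) * exp (- 2 * b * t) = 1" by (simp flip: exp_add)
    also have "a * exp (- 2 * b * t) \<le> a * 1" using a b t by (intro mult_left_mono) auto
    finally show ?thesis by simp
  qed
  \<comment> \<open>For \<open>S < 0\<close> the last term of \<open>step\<close> is positive and
    cannot be dropped, but then \<open>S \<le> 2 * a\<close> holds anyway.\<close>
  have "S \<le> 2 * a \<or> S < 0"
  proof (cases "S < 0")
    case False
    have "S \<le> a + S / 2"
      unfolding S_def
    proof (rule cSUP_least)
      fix t assume "t \<in> {0..T}"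
      from step[OF this] False show "\<psi> t \<le> a + (SUP t\<in>{0..T}. \<psi> t) / 2"
        unfolding S_def[symmetric] by (smt (verit) exp_ge_zero mult_nonneg_nonneg field_sum_of_halves)
    qed (use t in auto)
    then show ?thesis by simp
  qed simp
  then have "S \<le> 2 * a" using a by auto
  then have "S * exp (2 * b * t) \<le> 2 * a * exp (2 * b * t)" by (intro mult_right_mono) auto
  then show ?thesis by (rule order.trans[OF phi_S[OF t]])
qed

section \<open>Stability of the fluid equation\<close>

lemma norm_sum_scaleR_le:
  "norm (\<Sum>i\<in>A. c i *\<^sub>R v i) \<le> (\<Sum>i\<in>A. \<bar>c i\<bar> * norm (v i))"
  for v :: "'i \<Rightarrow> 'v::real_normed_vector"
  by (rule order.trans[OF norm_sum]) simp

text \<open>Collects the separate clocks into one integral of the drift, the only quantity to which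
  the Lipschitz bound applies.\<close>

lemma drift_integral:
  assumes "\<And>i. set_integrable lborel {0..t} (\<lambda>s. a i s (z s))"
  shows "set_integrable lborel {0..t} (\<lambda>s. drift l a s (z s))"
    and "(LBINT s:{0..t}. drift l a s (z s)) = (\<Sum>i\<in>UNIV. (LBINT s:{0..t}. a i s (z s)) *\<^sub>R l i)"
proof -
  have i: "set_integrable lborel {0..t} (\<lambda>s. a i s (z s) *\<^sub>R l i)" for i
  proof -
    have "integrable lborel (\<lambda>s. (indicator {0..t} s *\<^sub>R a i s (z s)) *\<^sub>R l i)"
      using assms[of i] unfolding set_integrable_def by (intro integrable_scaleR_left)
    then show ?thesis by (simp add: set_integrable_def)
  qed
  then show "set_integrable lborel {0..t} (\<lambda>s. drift l a s (z s))"
    unfolding drift_def set_integrable_def by (simp add: scaleR_sum_right)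
  have 1: "(LBINT s:{0..t}. drift l a s (z s)) = (\<Sum>i\<in>UNIV. (LBINT s:{0..t}. a i s (z s) *\<^sub>R l i))"
    using i unfolding drift_def set_lebesgue_integral_def set_integrable_def
    by (simp add: scaleR_sum_right Bochner_Integration.integral_sum)
  have 2: "(LBINT s:{0..t}. a i s (z s) *\<^sub>R l i) = (LBINT s:{0..t}. a i s (z s)) *\<^sub>R l i" for i
  proof -
    have "(LBINT s:{0..t}. a i s (z s) *\<^sub>R l i) = (\<integral>s. (indicator {0..t} s *\<^sub>R a i s (z s)) *\<^sub>R l i \<partial>lborel)"
      by (simp add: set_lebesgue_integral_def)
    also have "\<dots> = (LBINT s:{0..t}. a i s (z s)) *\<^sub>R l i"
      using assms[of i] unfolding set_integrable_def set_lebesgue_integral_def by (intro integral_scaleR_left)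
    finally show ?thesis .
  qed
  show "(LBINT s:{0..t}. drift l a s (z s)) = (\<Sum>i\<in>UNIV. (LBINT s:{0..t}. a i s (z s)) *\<^sub>R l i)"
    unfolding 1 2 ..
qed

locale lipschitz_drift =
  fixes T K :: real and l :: "'k::finite \<Rightarrow> real^'d" and g :: "'k \<Rightarrow> real \<Rightarrow> real^'d \<Rightarrow> real" and x0 :: "real^'d"
  assumes K_pos: "0 < K"
    and lip: "\<And>t x y. t \<in> {0..T} \<Longrightarrow> norm (drift l g t x - drift l g t y) \<le> K * norm (x - y)"
begin

text \<open>Here \<open>a\<close> bounds the defect in the equation for the difference. Uniqueness
  is the case \<open>a = 0\<close>; convergence takes for \<open>a\<close> the deviation of the
  scaled Poisson paths.\<close>

lemma stability:
  assumes z: "\<And>t i. t \<in> {0..T} \<Longrightarrow> set_integrable lborel {0..t} (\<lambda>s. g i s (z s))"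
    and z': "\<And>t i. t \<in> {0..T} \<Longrightarrow> set_integrable lborel {0..t} (\<lambda>s. g i s (z' s))"
    and bound: "\<And>t. t \<in> {0..T} \<Longrightarrow> norm (z t - z' t) \<le> S"
    and a: "0 \<le> a"
    and close: "\<And>t. t \<in> {0..T} \<Longrightarrow> norm ((z t - z' t) - ((\<Sum>i\<in>UNIV. (LBINT s:{0..t}. g i s (z s)) *\<^sub>R l i)
        - (\<Sum>i\<in>UNIV. (LBINT s:{0..t}. g i s (z' s)) *\<^sub>R l i))) \<le> a"
    and t: "t \<in> {0..T}"
  shows "norm (z t - z' t) \<le> 2 * a * exp (2 * K * t)"
proof (rule integral_gronwall[OF a K_pos bound _ _ _ t])
  let ?k = "\<lambda>s. drift l g s (z s) - drift l g s (z' s)"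
  fix t assume t: "t \<in> {0..T}"
  have I: "set_integrable lborel {0..t} ?k"
    using drift_integral(1)[where a = g and z = z, OF z[OF t]] drift_integral(1)[where a = g and z = z', OF z'[OF t]] by (rule set_integral_diff(1))
  then show J: "set_integrable lborel {0..t} (\<lambda>s. norm (?k s))" by (rule set_integrable_norm)
  have "(\<Sum>i\<in>UNIV. (LBINT s:{0..t}. g i s (z s)) *\<^sub>R l i) - (\<Sum>i\<in>UNIV. (LBINT s:{0..t}. g i s (z' s)) *\<^sub>R l i)
      = (LBINT s:{0..t}. ?k s)"
    using drift_integral[where a = g and z = z and l = l, OF z[OF t]] drift_integral[where a = g and z = z' and l = l, OF z'[OF t]] by (simp add: set_integral_diff(2))
  then have "norm ((z t - z' t) - (LBINT s:{0..t}. ?k s)) \<le> a" using close[OF t] by simp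
  moreover have "norm (LBINT s:{0..t}. ?k s) \<le> (LBINT s:{0..t}. norm (?k s))"
    using set_integral_norm_bound[OF I] .
  ultimately show "norm (z t - z' t) \<le> a + (LBINT s:{0..t}. norm (?k s))"
    using norm_triangle_sub[of "z t - z' t" "LBINT s:{0..t}. ?k s"] by linarith
qed (use lip in auto)

text \<open>The a priori bound demanded by the Gronwall argument; it comes from integrability of the
  rates up to \<open>T\<close> alone.\<close>

lemma fluid_solution_bounded:
  assumes z: "fluid_solution T x0 l g z" and t: "t \<in> {0..T}"
  shows "norm (z t) \<le> norm x0 + (\<Sum>i\<in>UNIV. (LBINT s:{0..T}. \<bar>g i s (z s)\<bar>) * norm (l i))"
proof -
  have T: "T \<in> {0..T}" using t by auto
  have int: "set_integrable lborel {0..u} (\<lambda>s. g i s (z s))" if "u \<in> {0..T}" for u i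
    using z that unfolding fluid_solution_def by blast
  have "\<bar>LBINT s:{0..t}. g i s (z s)\<bar> \<le> (LBINT s:{0..T}. \<bar>g i s (z s)\<bar>)" for i
  proof -
    have "\<bar>LBINT s:{0..t}. g i s (z s)\<bar> \<le> (LBINT s:{0..t}. \<bar>g i s (z s)\<bar>)"
      using set_integral_norm_bound[OF int[OF t, of i]] by simp
    also have "\<dots> \<le> (LBINT s:{0..T}. \<bar>g i s (z s)\<bar>)"
      unfolding set_lebesgue_integral_def
      by (rule integral_mono) (use t set_integrable_abs[OF int[OF T]] set_integrable_abs[OF int[OF t]]
        in \<open>auto simp: set_integrable_def indicator_def\<close>)
    finally show ?thesis .
  qed
  then have "(\<Sum>i\<in>UNIV. \<bar>LBINT s:{0..t}. g i s (z s)\<bar> * norm (l i)) \<le> (\<Sum>i\<in>UNIV. (LBINT s:{0..T}. \<bar>g i s (z s)\<bar>) * norm (l i))"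
    by (intro sum_mono mult_right_mono) auto
  moreover have "norm (\<Sum>i\<in>UNIV. (LBINT s:{0..t}. g i s (z s)) *\<^sub>R l i) \<le> (\<Sum>i\<in>UNIV. \<bar>LBINT s:{0..t}. g i s (z s)\<bar> * norm (l i))"
    by (rule norm_sum_scaleR_le)
  moreover have "z t = x0 + (\<Sum>i\<in>UNIV. (LBINT s:{0..t}. g i s (z s)) *\<^sub>R l i)"
    using z t unfolding fluid_solution_def by blast
  ultimately show ?thesis using norm_triangle_ineq[of x0 "\<Sum>i\<in>UNIV. (LBINT s:{0..t}. g i s (z s)) *\<^sub>R l i"] by simp
qed

lemma fluid_solution_unique:
  assumes z: "fluid_solution T x0 l g z" and z': "fluid_solution T x0 l g z'" and t: "t \<in> {0..T}"
  shows "z t = z' t"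
proof -
  define S where "S = (norm x0 + (\<Sum>i\<in>UNIV. (LBINT s:{0..T}. \<bar>g i s (z s)\<bar>) * norm (l i)))
     + (norm x0 + (\<Sum>i\<in>UNIV. (LBINT s:{0..T}. \<bar>g i s (z' s)\<bar>) * norm (l i)))"
  have "norm (z t - z' t) \<le> 2 * 0 * exp (2 * K * t)"
  proof (rule stability[where S = S, OF _ _ _ _ _ t])
    show "norm (z t - z' t) \<le> S" if "t \<in> {0..T}" for t
      unfolding S_def using fluid_solution_bounded[OF z that] fluid_solution_bounded[OF z' that] norm_triangle_ineq4[of "z t" "z' t"]
      by linarith
    show "set_integrable lborel {0..t} (\<lambda>s. g i s (z s))" "set_integrable lborel {0..t} (\<lambda>s. g i s (z' s))" if "t \<in> {0..T}" for t i
      using z z' that unfolding fluid_solution_def by blast+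
    show "norm ((z t - z' t) - ((\<Sum>i\<in>UNIV. (LBINT s:{0..t}. g i s (z s)) *\<^sub>R l i)
        - (\<Sum>i\<in>UNIV. (LBINT s:{0..t}. g i s (z' s)) *\<^sub>R l i))) \<le> 0" if "t \<in> {0..T}" for t
    proof -
      have "z t = x0 + (\<Sum>i\<in>UNIV. (LBINT s:{0..t}. g i s (z s)) *\<^sub>R l i)"
        "z' t = x0 + (\<Sum>i\<in>UNIV. (LBINT s:{0..t}. g i s (z' s)) *\<^sub>R l i)"
        using z z' that unfolding fluid_solution_def by blast+
      then show ?thesis by simp
    qed
  qed simp
  then show ?thesis by simp
qed

end

section \<open>Almost sure limit of the scaled paths\<close>

locale scaled_paths = lipschitz_drift T K l g x0
  for T K :: real and l :: "'k::finite \<Rightarrow> real^'d" and g :: "'k \<Rightarrow> real \<Rightarrow> real^'d \<Rightarrow> real" and x0 :: "real^'d" +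
  fixes y :: "'k \<Rightarrow> real \<Rightarrow> nat" and z :: "nat \<Rightarrow> real \<Rightarrow> real^'d" and G :: real
  assumes growth: "\<And>i t x. t \<in> {0..T} \<Longrightarrow> \<bar>g i t x\<bar> \<le> G * (1 + norm x)"
    and deviation: "\<And>i \<delta>. 0 < \<delta> \<Longrightarrow> \<exists>A. \<forall>v\<ge>0. \<bar>real (y i v) - v\<bar> \<le> A + \<delta> * v"
    and z_int: "\<And>n t i. 1 \<le> n \<Longrightarrow> t \<in> {0..T} \<Longrightarrow> set_integrable lborel {0..t} (\<lambda>s. g i s (z n s))"
    and z_eq: "\<And>n t. 1 \<le> n \<Longrightarrow> t \<in> {0..T} \<Longrightarrow>
       z n t = x0 + (\<Sum>i\<in>UNIV. (real (y i (real n * (LBINT s:{0..t}. g i s (z n s)))) / real n) *\<^sub>R l i)"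
    and z_nonneg: "\<And>n t i. 1 \<le> n \<Longrightarrow> t \<in> {0..T} \<Longrightarrow> 0 \<le> g i t (z n t)"
begin

definition L where "L = (\<Sum>i\<in>UNIV. norm (l i))"
definition clock where "clock n i t = (LBINT s:{0..t}. g i s (z n s))"

lemma L_nonneg: "0 \<le> L" by (simp add: L_def sum_nonneg)

lemma uniform_deviation:
  assumes "0 < \<delta>"
  shows "\<exists>A\<ge>0. \<forall>i. \<forall>v\<ge>0. \<bar>real (y i v) - v\<bar> \<le> A + \<delta> * v"
proof -
  obtain A where A: "\<And>i v. v \<ge> 0 \<Longrightarrow> \<bar>real (y i v) - v\<bar> \<le> A i + \<delta> * v"
    using deviation[OF assms] by metis
  have "A i \<le> (\<Sum>i\<in>UNIV. \<bar>A i\<bar>)" for i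
    using member_le_sum[of i UNIV "\<lambda>i. \<bar>A i\<bar>"] by simp
  then show ?thesis using A by (intro exI[of _ "\<Sum>i\<in>UNIV. \<bar>A i\<bar>"]) (fastforce intro: sum_nonneg order.trans)
qed

lemma clock_nonneg: "1 \<le> n \<Longrightarrow> t \<in> {0..T} \<Longrightarrow> 0 \<le> clock n i t"
  unfolding clock_def set_lebesgue_integral_def using z_nonneg
  by (intro Bochner_Integration.integral_nonneg) (auto simp: indicator_def)

lemma clock_mono:
  assumes n: "1 \<le> n" and t: "t \<in> {0..T}"
  shows "clock n i t \<le> clock n i T"
  unfolding clock_def set_lebesgue_integral_def
proof (rule integral_mono)
  show "integrable lborel (\<lambda>s. indicator {0..t} s *\<^sub>R g i s (z n s))" "integrable lborel (\<lambda>s. indicator {0..T} s *\<^sub>R g i s (z n s))"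
    using z_int[OF n t, of i] z_int[OF n, of T i] t by (auto simp: set_integrable_def)
  show "indicator {0..t} s *\<^sub>R g i s (z n s) \<le> indicator {0..T} s *\<^sub>R g i s (z n s)" for s
    using t z_nonneg[OF n] by (auto simp: indicator_def)
qed

text \<open>Dividing \<open>A + \<delta> * (n * clock)\<close> by \<open>n\<close> makes the
  additive constant vanish in the limit and leaves \<open>\<delta>\<close> unchanged.\<close>

lemma scaled_deviation:
  assumes n: "1 \<le> n" and t: "t \<in> {0..T}" and A: "0 \<le> A" "\<And>i v. 0 \<le> v \<Longrightarrow> \<bar>real (y i v) - v\<bar> \<le> A + \<delta> * v"
  shows "\<bar>real (y i (real n * clock n i t)) / real n - clock n i t\<bar> \<le> A / real n + \<delta> * clock n i t"
proof -
  have "\<bar>real (y i (real n * clock n i t)) - real n * clock n i t\<bar> / real n \<le> (A + \<delta> * (real n * clock n i t)) / real n"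
    using n clock_nonneg[OF n t] by (intro divide_right_mono A(2)) auto
  moreover have "\<bar>real (y i (real n * clock n i t)) - real n * clock n i t\<bar> / real n = \<bar>real (y i (real n * clock n i t)) / real n - clock n i t\<bar>"
  proof -
    have "(real (y i (real n * clock n i t)) - real n * clock n i t) / real n = real (y i (real n * clock n i t)) / real n - clock n i t"
      using n by (simp add: diff_divide_distrib)
    then show ?thesis by (metis abs_divide abs_of_nat)
  qed
  moreover have "(A + \<delta> * (real n * clock n i t)) / real n = A / real n + \<delta> * clock n i t" using n by (simp add: field_simps)
  ultimately show ?thesis by simp
qed

text \<open>The deviation bound with \<open>\<delta> = 1\<close> gives
  \<open>y v \<le> A + 2 * v\<close> for every \<open>v \<ge> 0\<close>, so
  \<open>1 + norm (z n t)\<close> is at most a constant plus twice the weighted clocks, and linear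
  growth closes the Gronwall loop with constants free of \<open>n\<close>.\<close>

lemma z_uniformly_bounded: "\<exists>B\<ge>0. \<forall>n\<ge>1. \<forall>t\<in>{0..T}. norm (z n t) \<le> B"
proof -
  obtain A where A: "0 \<le> A" "\<And>i v. 0 \<le> v \<Longrightarrow> \<bar>real (y i v) - v\<bar> \<le> A + 1 * v"
    using uniform_deviation[of 1] by auto
  \<comment> \<open>The \<open>2\<close> is the slope in \<open>A + 2 * v\<close>, and the
    \<open>+ 1\<close> makes \<open>b\<close> positive even if \<open>L\<close> or \<open>G\<close>
    vanishes.\<close>
  define b where "b = 2 * L * \<bar>G\<bar> + 1"
  define a where "a = 1 + norm x0 + L * A"
  have b: "0 < b" and a: "0 \<le> a" using L_nonneg A(1) by (simp_all add: b_def a_def add_nonneg_pos)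
  have main: "1 + norm (z n t) \<le> 2 * a * exp (2 * b * t)" if n: "1 \<le> n" and t: "t \<in> {0..T}" for n t
  proof -
    have pre: "1 + norm (z n t) \<le> a + (\<Sum>i\<in>UNIV. 2 * clock n i t * norm (l i))" if t: "t \<in> {0..T}" for t
    proof -
      have c: "\<bar>real (y i (real n * clock n i t)) / real n\<bar> \<le> A + 2 * clock n i t" for i
      proof -
        have "A / real n \<le> A" using n A(1) by (simp add: divide_le_eq mult_le_cancel_left1)
        then show ?thesis using scaled_deviation[OF n t A, of i] by (simp add: abs_le_iff)
      qed
      have "norm (z n t) \<le> norm x0 + (\<Sum>i\<in>UNIV. \<bar>real (y i (real n * clock n i t)) / real n\<bar> * norm (l i))"
        unfolding z_eq[OF n t] clock_def[symmetric]
        by (rule order.trans[OF norm_triangle_ineq add_left_mono[OF norm_sum_scaleR_le]])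
      also have "\<dots> \<le> norm x0 + (\<Sum>i\<in>UNIV. (A + 2 * clock n i t) * norm (l i))"
        by (intro add_left_mono sum_mono mult_right_mono c) auto
      finally show ?thesis by (simp add: a_def L_def algebra_simps sum.distrib sum_distrib_left)
    qed
    let ?k = "\<lambda>s. \<Sum>i\<in>UNIV. 2 * norm (l i) * g i s (z n s)"
    show ?thesis
    proof (rule integral_gronwall[OF a b _ _ _ _ t, where k = ?k])
      fix t assume t: "t \<in> {0..T}"
      \<comment> \<open>This bound depends on \<open>n\<close> through the clocks at
        \<open>T\<close>, which is harmless: Gronwall uses it only as a finiteness
        condition.\<close>
      have "(\<Sum>i\<in>UNIV. 2 * clock n i t * norm (l i)) \<le> (\<Sum>i\<in>UNIV. 2 * clock n i T * norm (l i))"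
        using clock_mono[OF n t] by (intro sum_mono mult_right_mono mult_left_mono) auto
      then show "1 + norm (z n t) \<le> a + (\<Sum>i\<in>UNIV. 2 * clock n i T * norm (l i))" using pre[OF t] by simp
      have i: "integrable lborel (\<lambda>s. 2 * norm (l i) * (indicator {0..t} s * g i s (z n s)))" for i
        using z_int[OF n t, of i] by (simp add: set_integrable_def)
      have e: "(\<lambda>s. indicator {0..t} s *\<^sub>R ?k s) = (\<lambda>s. \<Sum>i\<in>UNIV. 2 * norm (l i) * (indicator {0..t} s * g i s (z n s)))"
        by (simp add: sum_distrib_left algebra_simps)
      show "set_integrable lborel {0..t} ?k"
        unfolding set_integrable_def e using i by (intro Bochner_Integration.integrable_sum)
      have "(LBINT s:{0..t}. ?k s) = (\<Sum>i\<in>UNIV. 2 * clock n i t * norm (l i))"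
        unfolding set_lebesgue_integral_def e using i
        by (subst Bochner_Integration.integral_sum) (auto simp: clock_def set_lebesgue_integral_def algebra_simps)
      then show "1 + norm (z n t) \<le> a + (LBINT s:{0..t}. ?k s)" using pre[OF t] by simp
      have "?k t \<le> (\<Sum>i\<in>UNIV. 2 * norm (l i) * (\<bar>G\<bar> * (1 + norm (z n t))))"
      proof (intro sum_mono mult_left_mono)
        fix i
        have "g i t (z n t) \<le> G * (1 + norm (z n t))" using growth[OF t, of i "z n t"] by simp
        also have "\<dots> \<le> \<bar>G\<bar> * (1 + norm (z n t))" by (intro mult_right_mono) auto
        finally show "g i t (z n t) \<le> \<bar>G\<bar> * (1 + norm (z n t))" .
      qed auto
      also have "\<dots> = (2 * L * \<bar>G\<bar>) * (1 + norm (z n t))"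
        unfolding L_def sum_distrib_left sum_distrib_right by (simp add: algebra_simps)
      also have "\<dots> \<le> b * (1 + norm (z n t))" unfolding b_def by (intro mult_right_mono) auto
      finally show "?k t \<le> b * (1 + norm (z n t))" .
    qed
  qed
  show ?thesis
  proof (intro exI[of _ "2 * a * exp (2 * b * \<bar>T\<bar>)"] conjI ballI allI impI)
    fix n t assume n: "1 \<le> (n::nat)" and t: "t \<in> {0..T}"
    have "2 * a * exp (2 * b * t) \<le> 2 * a * exp (2 * b * \<bar>T\<bar>)" using t a b by (intro mult_left_mono) auto
    then show "norm (z n t) \<le> 2 * a * exp (2 * b * \<bar>T\<bar>)" using main[OF n t] by simp
  qed (use a in simp)
qed

lemma clock_uniformly_bounded: "\<exists>U\<ge>0. \<forall>n\<ge>1. \<forall>i. \<forall>t\<in>{0..T}. clock n i t \<le> U"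
proof -
  obtain B where B: "0 \<le> B" "\<And>n t. 1 \<le> n \<Longrightarrow> t \<in> {0..T} \<Longrightarrow> norm (z n t) \<le> B"
    using z_uniformly_bounded by blast
  have "clock n i t \<le> \<bar>G\<bar> * (1 + B) * \<bar>T\<bar>" if n: "1 \<le> n" and t: "t \<in> {0..T}" for n i t
  proof -
    have "clock n i t \<le> (LBINT s:{0..t}. \<bar>G\<bar> * (1 + B))"
      unfolding clock_def
    proof (rule set_integral_mono[OF z_int[OF n t]])
      show "set_integrable lborel {0..t} (\<lambda>s. \<bar>G\<bar> * (1 + B))" by (rule borel_integrable_atLeastAtMost') simp
      fix s assume "s \<in> {0..t}"
      then have s: "s \<in> {0..T}" using t by auto
      have "g i s (z n s) \<le> G * (1 + norm (z n s))" using growth[OF s, of i "z n s"] by simp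
      also have "\<dots> \<le> \<bar>G\<bar> * (1 + B)" using B(2)[OF n s] by (intro mult_mono) auto
      finally show "g i s (z n s) \<le> \<bar>G\<bar> * (1 + B)" .
    qed
    also have "\<dots> = \<bar>G\<bar> * (1 + B) * t" using t by (simp add: set_lebesgue_integral_def)
    also have "\<dots> \<le> \<bar>G\<bar> * (1 + B) * \<bar>T\<bar>" using t B(1) by (intro mult_left_mono) auto
    finally show ?thesis .
  qed
  then show ?thesis using B(1) by (intro exI[of _ "\<bar>G\<bar> * (1 + B) * \<bar>T\<bar>"]) auto
qed

text \<open>The bound \<open>U\<close> on the clocks is obtained before \<open>\<delta>\<close> is
  chosen, so \<open>\<delta>\<close> may depend on it; then \<open>n\<close> absorbs the constant
  \<open>A\<close> that belongs to \<open>\<delta>\<close>.\<close>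

lemma convergence:
  assumes m: "fluid_solution T x0 l g m" and t: "t \<in> {0..T}"
  shows "(\<lambda>n. z n t) \<longlonglongrightarrow> m t"
proof (rule LIMSEQ_I)
  fix r :: real assume r: "0 < r"
  obtain U where U: "0 \<le> U" "\<And>n i t. 1 \<le> n \<Longrightarrow> t \<in> {0..T} \<Longrightarrow> clock n i t \<le> U"
    using clock_uniformly_bounded by blast
  obtain B where B: "0 \<le> B" "\<And>n t. 1 \<le> n \<Longrightarrow> t \<in> {0..T} \<Longrightarrow> norm (z n t) \<le> B"
    using z_uniformly_bounded by blast
  define E where "E = 2 * exp (2 * K * t) * L"
  have E: "0 \<le> E" using L_nonneg by (simp add: E_def)
  \<comment> \<open>Makes \<open>E * \<delta> * U\<close> less than \<open>r / 2\<close>; the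
    \<open>+ 1\<close> covers \<open>E * U = 0\<close>.\<close>
  define \<delta> where "\<delta> = r / (2 * (E * U + 1))"
  have \<delta>: "0 < \<delta>" using r E U(1) by (simp add: \<delta>_def add_nonneg_pos)
  obtain A where A: "0 \<le> A" "\<And>i v. 0 \<le> v \<Longrightarrow> \<bar>real (y i v) - v\<bar> \<le> A + \<delta> * v"
    using uniform_deviation[OF \<delta>] by auto
  define S where "S = B + (norm x0 + (\<Sum>i\<in>UNIV. (LBINT s:{0..T}. \<bar>g i s (m s)\<bar>) * norm (l i)))"
  have bound: "norm (z n t - m t) \<le> E * (A / real n + \<delta> * U)" if n: "1 \<le> n" for n
  proof -
    have dU: "0 \<le> A / real n + \<delta> * U" using A(1) \<delta> U(1) by simp
    have "norm (z n t - m t) \<le> 2 * ((A / real n + \<delta> * U) * L) * exp (2 * K * t)"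
    proof (rule stability[where S = S, OF _ _ _ _ _ t])
      fix t assume t: "t \<in> {0..T}"
      show "set_integrable lborel {0..t} (\<lambda>s. g i s (z n s))" for i by (rule z_int[OF n t])
      show "set_integrable lborel {0..t} (\<lambda>s. g i s (m s))" for i using m t unfolding fluid_solution_def by blast
      show "norm (z n t - m t) \<le> S"
        unfolding S_def using fluid_solution_bounded[OF m t] B(2)[OF n t] norm_triangle_ineq4[of "z n t" "m t"] by linarith
      have mt: "m t = x0 + (\<Sum>i\<in>UNIV. (LBINT s:{0..t}. g i s (m s)) *\<^sub>R l i)"
        using m t unfolding fluid_solution_def by blast
      have "norm ((z n t - m t) - ((\<Sum>i\<in>UNIV. (LBINT s:{0..t}. g i s (z n s)) *\<^sub>R l i) - (\<Sum>i\<in>UNIV. (LBINT s:{0..t}. g i s (m s)) *\<^sub>R l i)))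
        = norm (\<Sum>i\<in>UNIV. (real (y i (real n * clock n i t)) / real n - clock n i t) *\<^sub>R l i)"
        unfolding mt z_eq[OF n t] clock_def[symmetric] by (simp add: sum_subtractf scaleR_diff_left)
      also have "\<dots> \<le> (\<Sum>i\<in>UNIV. \<bar>real (y i (real n * clock n i t)) / real n - clock n i t\<bar> * norm (l i))"
        by (rule norm_sum_scaleR_le)
      also have "\<dots> \<le> (\<Sum>i\<in>UNIV. (A / real n + \<delta> * U) * norm (l i))"
      proof (intro sum_mono mult_right_mono)
        fix i
        have "\<delta> * clock n i t \<le> \<delta> * U" using U(2)[OF n t] \<delta> by (intro mult_left_mono) auto
        then show "\<bar>real (y i (real n * clock n i t)) / real n - clock n i t\<bar> \<le> A / real n + \<delta> * U"
          using scaled_deviation[OF n t A, of i] by linarith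
      qed auto
      also have "\<dots> = (A / real n + \<delta> * U) * L" by (simp add: L_def sum_distrib_left)
      finally show "norm ((z n t - m t) - ((\<Sum>i\<in>UNIV. (LBINT s:{0..t}. g i s (z n s)) *\<^sub>R l i) - (\<Sum>i\<in>UNIV. (LBINT s:{0..t}. g i s (m s)) *\<^sub>R l i)))
         \<le> (A / real n + \<delta> * U) * L" .
    qed (use dU L_nonneg in simp)
    then show ?thesis by (simp add: E_def algebra_simps)
  qed
  have "(\<lambda>n. E * (A / real n + \<delta> * U)) \<longlonglongrightarrow> E * (0 + \<delta> * U)"
    by (intro tendsto_intros lim_const_over_n)
  moreover have "E * (0 + \<delta> * U) < r"
  proof -
    have EU: "0 \<le> E * U" using E U(1) by simp
    then have "E * U * r < r * (2 * (E * U + 1))" using r mult_nonneg_nonneg[OF EU less_imp_le[OF r]]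
      by (simp add: algebra_simps)
    then have "E * U * r / (2 * (E * U + 1)) < r" using EU by (simp add: pos_divide_less_eq)
    then show ?thesis by (simp add: \<delta>_def mult_ac)
  qed
  ultimately have "\<forall>\<^sub>F n in sequentially. E * (A / real n + \<delta> * U) < r" by (rule order_tendstoD(2))
  then obtain n0 where "\<And>n. n \<ge> n0 \<Longrightarrow> E * (A / real n + \<delta> * U) < r" by (auto simp: eventually_sequentially)
  then show "\<exists>no. \<forall>n\<ge>no. norm (z n t - m t) < r"
    using bound by (intro exI[of _ "max 1 n0"]) (fastforce intro: le_less_trans)
qed

end

section \<open>The mean of the jump process\<close>

text \<open>Componentwise \<open>\<bar>a\<bar> \<le> 1 + a * a\<close>, so the diagonal of the
  covariance matrix controls the first absolute moment, which is what linear growth calls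
  for.\<close>

lemma norm_bound_mean_deviation:
  fixes V :: "'a \<Rightarrow> real^'d"
  assumes M: "prob_space M" and V: "finite_mean_covariance M V"
  shows "(LINT \<omega>|M. norm (V \<omega> - integral\<^sup>L M V)) \<le> (\<Sum>p\<in>UNIV. 1 + covariance_matrix M V $ p $ p)"
proof -
  interpret prob_space M by fact
  define m where "m = integral\<^sup>L M V"
  have I: "integrable M V" and Q: "integrable M (\<lambda>\<omega>. (V \<omega> $ p - m $ p) * (V \<omega> $ p - m $ p))" for p
    using V by (auto simp: finite_mean_covariance_def m_def)
  have "norm (V \<omega> - m) \<le> (\<Sum>p\<in>UNIV. 1 + (V \<omega> $ p - m $ p) * (V \<omega> $ p - m $ p))" for \<omega>
  proof -
    have a: "\<bar>a\<bar> \<le> 1 + a * a" for a :: real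
    proof -
      have "0 \<le> (\<bar>a\<bar> - 1) * (\<bar>a\<bar> - 1)" by simp
      then have "0 \<le> a * a - 2 * \<bar>a\<bar> + 1" by (simp only: algebra_simps abs_mult_self_eq)
      then show ?thesis using zero_le_square[of a] by linarith
    qed
    have "norm (V \<omega> - m) \<le> (\<Sum>p\<in>UNIV. \<bar>(V \<omega> - m) $ p\<bar>)" by (rule norm_le_l1_cart)
    also have "\<dots> \<le> (\<Sum>p\<in>UNIV. 1 + (V \<omega> $ p - m $ p) * (V \<omega> $ p - m $ p))"
      using a by (intro sum_mono) simp
    finally show ?thesis .
  qed
  then have "(LINT \<omega>|M. norm (V \<omega> - m)) \<le> (LINT \<omega>|M. (\<Sum>p\<in>UNIV. 1 + (V \<omega> $ p - m $ p) * (V \<omega> $ p - m $ p)))"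
    using I Q by (intro integral_mono) auto
  also have "\<dots> = (\<Sum>p\<in>UNIV. 1 + covariance_matrix M V $ p $ p)"
    using Q by (subst Bochner_Integration.integral_sum) (auto simp: covariance_matrix_def prob_space simp flip: m_def)
  finally show ?thesis by (simp add: m_def)
qed

locale jump_model = prob_space M + rates T x0 l f
  for M :: "'a measure" and T :: real and x0 :: "real^'d" and l :: "'k::finite \<Rightarrow> real^'d"
    and f :: "'k \<Rightarrow> real \<Rightarrow> real^'d \<Rightarrow> real" +
  fixes Y :: "'k \<Rightarrow> real \<Rightarrow> 'a \<Rightarrow> nat" and X :: "real \<Rightarrow> 'a \<Rightarrow> real^'d" and C :: "'k \<Rightarrow> real"
  assumes Y_poisson: "\<And>i. poisson_process M 1 (Y i)"
    and Y_indep: "independent_processes M Y"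
    and X_sol: "time_change_solution M T x0 l f Y X"
    and X_nonneg: "AE \<omega> in M. \<forall>i. \<forall>s\<in>{0..T}. 0 \<le> f i s (X s \<omega>)"
    and X_moments: "\<And>t. t \<in> {0..T} \<Longrightarrow> finite_mean_covariance M (X t)"
    and mean_bounded: "bounded ((\<lambda>t. integral\<^sup>L M (X t)) ` {0..T})"
    and covariance_bounded: "bounded ((\<lambda>t. covariance_matrix M (X t)) ` {0..T})"
    and growth: "\<And>i t x. t \<in> {0..T} \<Longrightarrow> \<bar>f i t x\<bar> \<le> C i * (1 + norm x)"
begin

definition m where "m t = expectation (X t)"

lemma X_measurable[measurable]: "t \<in> {0..T} \<Longrightarrow> X t \<in> borel_measurable M"
  using X_sol by (simp add: time_change_solution_def)

lemma X_integrable: "t \<in> {0..T} \<Longrightarrow> integrable M (X t)"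
  using X_moments by (simp add: finite_mean_covariance_def)

lemma path_AE: "AE \<omega> in M. time_changed_path T x0 l f (\<lambda>j u. Y j u \<omega>) (\<lambda>u. X u \<omega>)"
proof -
  have "AE \<omega> in M. \<forall>j. Y j 0 \<omega> = 0 \<and> mono_on {0..} (\<lambda>t. Y j t \<omega>) \<and> (\<forall>t\<ge>0. continuous (at_right t) (\<lambda>u. Y j u \<omega>))"
    unfolding AE_all_countable using poisson_process_AE[OF Y_poisson] by blast
  moreover have "AE \<omega> in M. \<forall>t\<in>{0..T}. (\<forall>i. set_integrable lborel {0..t} (\<lambda>s. f i s (X s \<omega>))) \<and>
        X t \<omega> = x0 + (\<Sum>i\<in>UNIV. real (Y i (LBINT s:{0..t}. f i s (X s \<omega>)) \<omega>) *\<^sub>R l i)"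
    using X_sol by (simp add: time_change_solution_def)
  ultimately show ?thesis
    using X_nonneg
  proof eventually_elim
    case (elim \<omega>)
    show ?case by unfold_locales (use elim in blast)+
  qed
qed

lemma mean_deviation_bounded: "\<exists>B\<ge>0. \<forall>t\<in>{0..T}. expectation (\<lambda>\<omega>. norm (X t \<omega> - m t)) \<le> B"
proof -
  obtain b where b: "\<And>t. t \<in> {0..T} \<Longrightarrow> norm (covariance_matrix M (X t)) \<le> b"
    using covariance_bounded unfolding bounded_iff by blast
  have "expectation (\<lambda>\<omega>. norm (X t \<omega> - m t)) \<le> (\<Sum>p\<in>(UNIV::'d set). 1 + \<bar>b\<bar>)" if t: "t \<in> {0..T}" for t
  proof -
    have "covariance_matrix M (X t) $ p $ p \<le> \<bar>b\<bar>" for p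
      using component_le_norm_cart[of "covariance_matrix M (X t) $ p" p] Finite_Cartesian_Product.norm_nth_le[of "covariance_matrix M (X t)" p] b[OF t]
      by linarith
    then have "(\<Sum>p\<in>UNIV. 1 + covariance_matrix M (X t) $ p $ p) \<le> (\<Sum>p\<in>(UNIV::'d set). 1 + \<bar>b\<bar>)"
      by (intro sum_mono) simp
    then show ?thesis
      unfolding m_def using norm_bound_mean_deviation[OF prob_space_axioms X_moments[OF t]] by linarith
  qed
  then show ?thesis by (intro exI[of _ "\<Sum>p\<in>(UNIV::'d set). 1 + \<bar>b\<bar>"]) (auto intro: sum_nonneg)
qed

lemma mean_norm_bounded: "\<exists>B\<ge>0. \<forall>t\<in>{0..T}. expectation (\<lambda>\<omega>. norm (X t \<omega>)) \<le> B"
proof -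
  obtain B where B: "0 \<le> B" "\<And>t. t \<in> {0..T} \<Longrightarrow> expectation (\<lambda>\<omega>. norm (X t \<omega> - m t)) \<le> B"
    using mean_deviation_bounded by blast
  obtain b where b: "\<And>t. t \<in> {0..T} \<Longrightarrow> norm (m t) \<le> b"
    using mean_bounded unfolding bounded_iff m_def by blast
  have "expectation (\<lambda>\<omega>. norm (X t \<omega>)) \<le> B + \<bar>b\<bar>" if t: "t \<in> {0..T}" for t
  proof -
    have i: "integrable M (\<lambda>\<omega>. norm (X t \<omega> - m t))"
      using X_integrable[OF t] by simp
    have "expectation (\<lambda>\<omega>. norm (X t \<omega>)) \<le> expectation (\<lambda>\<omega>. norm (X t \<omega> - m t) + norm (m t))"
      using X_integrable[OF t] i by (intro integral_mono) (auto intro: order.trans[OF _ norm_triangle_ineq])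
    also have "\<dots> = expectation (\<lambda>\<omega>. norm (X t \<omega> - m t)) + norm (m t)"
      using i by (simp add: prob_space)
    finally show ?thesis using B(2)[OF t] b[OF t] by linarith
  qed
  then show ?thesis using B(1) by (intro exI[of _ "B + \<bar>b\<bar>"]) auto
qed

section \<open>Averaging the rates over the base distribution\<close>

lemma continuous_on_f_space: "t \<in> {0..T} \<Longrightarrow> continuous_on UNIV (f j t)"
proof -
  assume t: "t \<in> {0..T}"
  have "continuous_on UNIV (\<lambda>x::real^'d. (t, x))" by (intro continuous_intros)
  then have "continuous_on UNIV (\<lambda>x. (\<lambda>(t, x). f j t x) (t, x))"
    by (rule continuous_on_compose2[OF f_cont]) (use t in auto)
  then show ?thesis by simp
qed

lemma f_measurable[measurable]: "t \<in> {0..T} \<Longrightarrow> f j t \<in> borel_measurable borel"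
  by (rule borel_measurable_continuous_onI[OF continuous_on_f_space])

lemma f_norm_le:
  assumes "t \<in> {0..T}"
  shows "norm (f j t x) \<le> \<bar>C j\<bar> * (1 + norm x)"
proof -
  have "C j * (1 + norm x) \<le> \<bar>C j\<bar> * (1 + norm x)" by (intro mult_right_mono) auto
  then show ?thesis using growth[OF assms, of j x] by simp
qed

lemma f_shift_integrable:
  assumes t: "t \<in> {0..T}"
  shows "integrable M (\<lambda>\<omega>. f j t (X t \<omega> + v))"
proof (rule Bochner_Integration.integrable_bound)
  show "integrable M (\<lambda>\<omega>. \<bar>C j\<bar> * (1 + norm (X t \<omega> + v)))" using X_integrable[OF t] by simp
  show "(\<lambda>\<omega>. f j t (X t \<omega> + v)) \<in> borel_measurable M" using t by measurable
  show "AE \<omega> in M. norm (f j t (X t \<omega> + v)) \<le> norm (\<bar>C j\<bar> * (1 + norm (X t \<omega> + v)))"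
    using f_norm_le[OF t] by (intro AE_I2) (auto intro: order.trans)
qed

lemma f_integrable: "t \<in> {0..T} \<Longrightarrow> integrable M (\<lambda>\<omega>. f j t (X t \<omega>))"
  using f_shift_integrable[of t j 0] by simp

lemma averaged_rate_eq:
  assumes t: "t \<in> {0..T}"
  shows "averaged_rate M X f j t x = expectation (\<lambda>\<omega>. f j t (X t \<omega> + (x - m t)))"
proof -
  have [measurable]: "(\<lambda>\<omega>. X t \<omega> - m t) \<in> measurable M borel" using t by measurable
  have [measurable]: "(\<lambda>y. f j t (y + x)) \<in> borel_measurable borel" using t by measurable
  have "averaged_rate M X f j t x = expectation (\<lambda>\<omega>. f j t (X t \<omega> - m t + x))"
    unfolding averaged_rate_def base_distribution_def m_def[symmetric] by (rule integral_distr) measurable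
  then show ?thesis by (simp add: algebra_simps)
qed

lemma averaged_rate_mean: "t \<in> {0..T} \<Longrightarrow> averaged_rate M X f j t (m t) = expectation (\<lambda>\<omega>. f j t (X t \<omega>))"
  by (simp add: averaged_rate_eq)

lemma averaged_rate_growth: "\<exists>G. \<forall>j. \<forall>t\<in>{0..T}. \<forall>x. \<bar>averaged_rate M X f j t x\<bar> \<le> G * (1 + norm x)"
proof -
  obtain B where B: "0 \<le> B" "\<And>t. t \<in> {0..T} \<Longrightarrow> expectation (\<lambda>\<omega>. norm (X t \<omega> - m t)) \<le> B"
    using mean_deviation_bounded by blast
  define c where "c = (\<Sum>j\<in>UNIV. \<bar>C j\<bar>)"
  have c: "\<bar>C j\<bar> \<le> c" "0 \<le> c" for j
    unfolding c_def using member_le_sum[of j UNIV "\<lambda>j. \<bar>C j\<bar>"] by (auto intro: sum_nonneg)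
  have "\<bar>averaged_rate M X f j t x\<bar> \<le> (c * (1 + B)) * (1 + norm x)" if t: "t \<in> {0..T}" for j t x
  proof -
    have i: "integrable M (\<lambda>\<omega>. norm (X t \<omega> - m t))"
      using X_integrable[OF t] by simp
    have "\<bar>averaged_rate M X f j t x\<bar> \<le> expectation (\<lambda>\<omega>. norm (f j t (X t \<omega> + (x - m t))))"
      unfolding averaged_rate_eq[OF t] using integral_norm_bound[of M "\<lambda>\<omega>. f j t (X t \<omega> + (x - m t))"] by simp
    also have "\<dots> \<le> expectation (\<lambda>\<omega>. c * (1 + norm x + norm (X t \<omega> - m t)))"
    proof (rule integral_mono)
      show "integrable M (\<lambda>\<omega>. norm (f j t (X t \<omega> + (x - m t))))" using f_shift_integrable[OF t] by (intro integrable_norm)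
      show "integrable M (\<lambda>\<omega>. c * (1 + norm x + norm (X t \<omega> - m t)))" using i by simp
      fix \<omega>
      have "norm (X t \<omega> + (x - m t)) \<le> norm x + norm (X t \<omega> - m t)"
        using norm_triangle_ineq[of x "X t \<omega> - m t"] by (simp add: algebra_simps)
      then have "\<bar>C j\<bar> * (1 + norm (X t \<omega> + (x - m t))) \<le> c * (1 + norm x + norm (X t \<omega> - m t))"
        using c(1)[of j] c(2) by (intro mult_mono) auto
      then show "norm (f j t (X t \<omega> + (x - m t))) \<le> c * (1 + norm x + norm (X t \<omega> - m t))"
        using f_norm_le[OF t, of j "X t \<omega> + (x - m t)"] by linarith
    qed
    also have "\<dots> = c * (1 + norm x + expectation (\<lambda>\<omega>. norm (X t \<omega> - m t)))"
      using i by (simp add: prob_space)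
    also have "\<dots> \<le> c * ((1 + B) * (1 + norm x))"
    proof (intro mult_left_mono)
      have "0 \<le> B * norm x" using B by simp
      then show "1 + norm x + expectation (\<lambda>\<omega>. norm (X t \<omega> - m t)) \<le> (1 + B) * (1 + norm x)"
        using B(2)[OF t] by (simp add: algebra_simps)
    qed (rule c(2))
    finally show ?thesis by (simp add: mult.assoc)
  qed
  then show ?thesis by blast
qed

lemma averaged_drift:
  assumes t: "t \<in> {0..T}"
  shows "drift l (averaged_rate M X f) t x = expectation (\<lambda>\<omega>. drift l f t (X t \<omega> + (x - m t)))"
    and "integrable M (\<lambda>\<omega>. drift l f t (X t \<omega> + (x - m t)))"
proof -
  have i: "integrable M (\<lambda>\<omega>. f j t (X t \<omega> + (x - m t)) *\<^sub>R l j)" for j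
    using f_shift_integrable[OF t] by (intro integrable_scaleR_left)
  then show "integrable M (\<lambda>\<omega>. drift l f t (X t \<omega> + (x - m t)))"
    unfolding drift_def by (intro Bochner_Integration.integrable_sum)
  have "expectation (\<lambda>\<omega>. drift l f t (X t \<omega> + (x - m t))) = (\<Sum>j\<in>UNIV. expectation (\<lambda>\<omega>. f j t (X t \<omega> + (x - m t)) *\<^sub>R l j))"
    unfolding drift_def by (rule Bochner_Integration.integral_sum) (rule i)
  also have "\<dots> = (\<Sum>j\<in>UNIV. averaged_rate M X f j t x *\<^sub>R l j)"
    unfolding averaged_rate_eq[OF t] using f_shift_integrable[OF t] by (intro sum.cong refl integral_scaleR_left)
  finally show "drift l (averaged_rate M X f) t x = expectation (\<lambda>\<omega>. drift l f t (X t \<omega> + (x - m t)))"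
    by (simp add: drift_def)
qed

text \<open>At each outcome the two arguments of the drift differ by exactly \<open>x - y\<close>,
  so the constant is preserved by averaging.\<close>

lemma averaged_drift_lipschitz:
  assumes t: "t \<in> {0..T}" and lip: "\<And>x y. norm (drift l f t x - drift l f t y) \<le> K * norm (x - y)"
  shows "norm (drift l (averaged_rate M X f) t x - drift l (averaged_rate M X f) t y) \<le> K * norm (x - y)"
proof -
  let ?d = "\<lambda>\<omega>. drift l f t (X t \<omega> + (x - m t)) - drift l f t (X t \<omega> + (y - m t))"
  have i: "integrable M ?d" using averaged_drift(2)[OF t] by (intro Bochner_Integration.integrable_diff)
  have eq: "drift l (averaged_rate M X f) t x - drift l (averaged_rate M X f) t y = expectation ?d"
    unfolding averaged_drift(1)[OF t] by (rule Bochner_Integration.integral_diff[symmetric]) (rule averaged_drift(2)[OF t])+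
  have "norm (expectation ?d) \<le> expectation (\<lambda>\<omega>. norm (?d \<omega>))" by (rule integral_norm_bound)
  also have "\<dots> \<le> expectation (\<lambda>\<omega>. K * norm (x - y))"
  proof (rule integral_mono)
    show "norm (?d \<omega>) \<le> K * norm (x - y)" for \<omega>
      using lip[of "X t \<omega> + (x - m t)" "X t \<omega> + (y - m t)"] by simp
  qed (use i in auto)
  also have "\<dots> = K * norm (x - y)" by (simp add: prob_space)
  finally show ?thesis unfolding eq .
qed

section \<open>Joint measurability and expected clocks\<close>

definition X_joint :: "real \<Rightarrow> 'a \<Rightarrow> real^'d" where
  "X_joint s \<omega> = lim (\<lambda>k. X (min T (real (nat \<lceil>real (Suc k) * s\<rceil>) / real (Suc k))) \<omega>)"

text \<open>Fubini needs joint measurability, while \<open>X t\<close> is measurable for each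
  \<open>t\<close> separately. Rounding time up to a grid leaves countably many time points, where
  this suffices; right-continuity of the paths identifies the limit, and \<open>min T\<close> keeps
  the points inside the horizon.\<close>

lemma X_joint_measurable: "(\<lambda>(s, \<omega>). X_joint s \<omega>) \<in> borel_measurable (lborel \<Otimes>\<^sub>M M)"
proof -
  have step: "(\<lambda>p. X (min T (real (nat \<lceil>real (Suc k) * fst p\<rceil>) / real (Suc k))) (snd p)) \<in> borel_measurable (lborel \<Otimes>\<^sub>M M)" for k
  proof (rule measurable_compose_countable[where f = "\<lambda>n p. X (min T (real n / real (Suc k))) (snd p)" and g = "\<lambda>p. nat \<lceil>real (Suc k) * fst p\<rceil>"])
    fix n
    have "X (min T (real n / real (Suc k))) \<in> borel_measurable M"
      using T_nonneg by (intro X_measurable) auto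
    then show "(\<lambda>p. X (min T (real n / real (Suc k))) (snd p)) \<in> borel_measurable (lborel \<Otimes>\<^sub>M M)"
      by (rule measurable_compose[OF measurable_snd])
  qed measurable
  have "(\<lambda>p. lim (\<lambda>k. X (min T (real (nat \<lceil>real (Suc k) * fst p\<rceil>) / real (Suc k))) (snd p))) \<in> borel_measurable (lborel \<Otimes>\<^sub>M M)"
    by (rule borel_measurable_lim_metric[OF step])
  then show ?thesis unfolding X_joint_def by (simp add: case_prod_beta')
qed

lemma X_joint_eq: "AE \<omega> in M. \<forall>s\<in>{0..T}. X_joint s \<omega> = X s \<omega>"
  using path_AE
proof eventually_elim
  case (elim \<omega>)
  interpret time_changed_path T x0 l f "\<lambda>j u. Y j u \<omega>" "\<lambda>u. X u \<omega>" by fact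
  show ?case
  proof
    fix s assume s: "s \<in> {0..T}"
    define v where "v k = min T (real (nat \<lceil>real (Suc k) * s\<rceil>) / real (Suc k))" for k
    have v: "v k \<in> {s..T}" "v k \<le> s + 1 / real (Suc k)" for k
    proof -
      have p: "0 \<le> real (Suc k) * s" using s by simp
      have "real (Suc k) * s \<le> real (nat \<lceil>real (Suc k) * s\<rceil>)" "real (nat \<lceil>real (Suc k) * s\<rceil>) \<le> real (Suc k) * s + 1"
        using p by linarith+
      then have "s \<le> real (nat \<lceil>real (Suc k) * s\<rceil>) / real (Suc k)" "real (nat \<lceil>real (Suc k) * s\<rceil>) / real (Suc k) \<le> s + 1 / real (Suc k)"
        by (simp_all add: field_simps del: of_nat_Suc)
      then show "v k \<in> {s..T}" "v k \<le> s + 1 / real (Suc k)" using s by (auto simp: v_def)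
    qed
    have "(\<lambda>k. s + 1 / real (Suc k)) \<longlonglongrightarrow> s + 0"
      by (intro tendsto_add tendsto_const LIMSEQ_inverse_real_of_nat[unfolded inverse_eq_divide])
    then have "(\<lambda>k. s + 1 / real (Suc k)) \<longlonglongrightarrow> s" by simp
    then have "v \<longlonglongrightarrow> s"
      by (rule tendsto_sandwich[OF _ _ tendsto_const, rotated 2]) (use v in \<open>auto intro!: always_eventually\<close>)
    from right_constant_x[OF v(1) this] s have "(\<lambda>k. X (v k) \<omega>) \<longlonglongrightarrow> X s \<omega>" by simp
    then show "X_joint s \<omega> = X s \<omega>" unfolding X_joint_def v_def by (rule limI)
  qed
qed

text \<open>The inner indicator extends \<open>f\<close> by \<open>0\<close> outside
  \<open>[0, T]\<close>: continuity is assumed on that strip only, and the extension is measurable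
  on the whole product space.\<close>

definition rate_joint :: "'k \<Rightarrow> real \<Rightarrow> real \<Rightarrow> 'a \<Rightarrow> real" where
  "rate_joint j t s \<omega> = indicator {0..t} s * (indicator ({0..T} \<times> UNIV) (s, X_joint s \<omega>) *\<^sub>R f j s (X_joint s \<omega>))"

lemma rate_joint_measurable: "(\<lambda>(s, \<omega>). rate_joint j t s \<omega>) \<in> borel_measurable (lborel \<Otimes>\<^sub>M M)"
proof -
  have "(\<lambda>p. indicator ({0..T} \<times> UNIV) p *\<^sub>R (case p of (t, x) \<Rightarrow> f j t x)) \<in> borel_measurable (borel :: (real \<times> (real^'d)) measure)"
    by (intro borel_measurable_continuous_on_indicator f_cont borel_closed closed_Times) auto
  then have [measurable]: "(\<lambda>p. indicator ({0..T} \<times> UNIV) p *\<^sub>R (case p of (t, x) \<Rightarrow> f j t x)) \<in> borel_measurable (borel \<Otimes>\<^sub>M (borel :: (real^'d) measure))"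
    by (simp add: borel_prod)
  have Xj[measurable]: "(\<lambda>p. X_joint (fst p) (snd p)) \<in> borel_measurable (lborel \<Otimes>\<^sub>M M)"
    using X_joint_measurable by (simp add: case_prod_beta')
  have "(\<lambda>p. (fst p, X_joint (fst p) (snd p))) \<in> measurable (lborel \<Otimes>\<^sub>M M) (borel \<Otimes>\<^sub>M borel)"
    by measurable
  then have [measurable]: "(\<lambda>q. (\<lambda>p. indicator ({0..T} \<times> UNIV) p *\<^sub>R (case p of (t, x) \<Rightarrow> f j t x)) (fst q, X_joint (fst q) (snd q))) \<in> borel_measurable (lborel \<Otimes>\<^sub>M M)"
    by (rule measurable_compose) measurable
  have "(\<lambda>q. indicator {0..t} (fst q) * (\<lambda>p. indicator ({0..T} \<times> UNIV) p *\<^sub>R (case p of (t, x) \<Rightarrow> f j t x)) (fst q, X_joint (fst q) (snd q))) \<in> borel_measurable (lborel \<Otimes>\<^sub>M M)"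
    by measurable
  then show ?thesis unfolding rate_joint_def by (simp add: case_prod_beta')
qed

lemma rate_joint_eq:
  assumes t: "t \<in> {0..T}"
  shows "AE \<omega> in M. \<forall>s. rate_joint j t s \<omega> = indicator {0..t} s * f j s (X s \<omega>)"
  using X_joint_eq
proof eventually_elim
  case (elim \<omega>)
  show ?case
  proof
    fix s
    show "rate_joint j t s \<omega> = indicator {0..t} s * f j s (X s \<omega>)"
      using elim t by (cases "s \<in> {0..t}") (auto simp: rate_joint_def)
  qed
qed

lemma rate_joint_section:
  assumes t: "t \<in> {0..T}"
  shows "integrable M (rate_joint j t s)"
    and "expectation (rate_joint j t s) = indicator {0..t} s * expectation (\<lambda>\<omega>. f j s (X s \<omega>))"
    and "expectation (\<lambda>\<omega>. norm (rate_joint j t s \<omega>)) = indicator {0..t} s * expectation (\<lambda>\<omega>. norm (f j s (X s \<omega>)))"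
proof -
  have [measurable]: "rate_joint j t s \<in> borel_measurable M"
    using measurable_Pair2[OF rate_joint_measurable, of s] by simp
  have i: "integrable M (\<lambda>\<omega>. indicator {0..t} s * f j s (X s \<omega>))"
    using f_integrable[of s j] t by (cases "s \<in> {0..t}") auto
  have AE: "AE \<omega> in M. rate_joint j t s \<omega> = indicator {0..t} s * f j s (X s \<omega>)"
    using rate_joint_eq[OF t, of j] by eventually_elim simp
  show "integrable M (rate_joint j t s)"
    using i by (subst integrable_cong_AE[OF _ _ AE]) (auto intro: borel_measurable_integrable)
  have "expectation (rate_joint j t s) = expectation (\<lambda>\<omega>. indicator {0..t} s * f j s (X s \<omega>))"
    using i by (intro integral_cong_AE AE) (auto intro: borel_measurable_integrable)
  then show "expectation (rate_joint j t s) = indicator {0..t} s * expectation (\<lambda>\<omega>. f j s (X s \<omega>))" by simp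
  have "expectation (\<lambda>\<omega>. norm (rate_joint j t s \<omega>)) = expectation (\<lambda>\<omega>. norm (indicator {0..t} s * f j s (X s \<omega>)))"
    using i by (intro integral_cong_AE) (auto intro!: borel_measurable_integrable integrable_abs eventually_mono[OF AE])
  also have "\<dots> = expectation (\<lambda>\<omega>. indicator {0..t} s * norm (f j s (X s \<omega>)))"
    by (intro Bochner_Integration.integral_cong refl) (auto simp: indicator_def)
  finally show "expectation (\<lambda>\<omega>. norm (rate_joint j t s \<omega>)) = indicator {0..t} s * expectation (\<lambda>\<omega>. norm (f j s (X s \<omega>)))" by simp
qed

text \<open>Linear growth bounds the expected absolute rate by
  \<open>\<bar>C j\<bar> * (1 + B)\<close>, uniformly over the bounded time interval.\<close>

lemma rate_joint_integrable:
  assumes t: "t \<in> {0..T}"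
  shows "integrable (lborel \<Otimes>\<^sub>M M) (\<lambda>(s, \<omega>). rate_joint j t s \<omega>)"
proof -
  interpret P: pair_sigma_finite lborel M ..
  obtain B where B: "0 \<le> B" "\<And>t. t \<in> {0..T} \<Longrightarrow> expectation (\<lambda>\<omega>. norm (X t \<omega>)) \<le> B"
    using mean_norm_bounded by blast
  show ?thesis
  proof (rule P.Fubini_integrable[OF rate_joint_measurable])
    show "AE s in lborel. integrable M (\<lambda>\<omega>. case (s, \<omega>) of (s, \<omega>) \<Rightarrow> rate_joint j t s \<omega>)"
      using rate_joint_section(1)[OF t] by (intro AE_I2) simp
    have "integrable lborel (\<lambda>s. expectation (\<lambda>\<omega>. norm (rate_joint j t s \<omega>)))"
    proof (rule Bochner_Integration.integrable_bound)
      have "set_integrable lborel {0..t} (\<lambda>s. \<bar>C j\<bar> * (1 + B))" by (rule borel_integrable_atLeastAtMost') simp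
      then show "integrable lborel (\<lambda>s. indicator {0..t} s * (\<bar>C j\<bar> * (1 + B)))" by (simp add: set_integrable_def)
      show "(\<lambda>s. expectation (\<lambda>\<omega>. norm (rate_joint j t s \<omega>))) \<in> borel_measurable lborel"
        using rate_joint_measurable[of j t]
        by (intro borel_measurable_lebesgue_integral) (simp add: case_prod_beta')
      show "AE s in lborel. norm (expectation (\<lambda>\<omega>. norm (rate_joint j t s \<omega>))) \<le> norm (indicator {0..t} s * (\<bar>C j\<bar> * (1 + B)))"
      proof (rule AE_I2)
        fix s
        show "norm (expectation (\<lambda>\<omega>. norm (rate_joint j t s \<omega>))) \<le> norm (indicator {0..t} s * (\<bar>C j\<bar> * (1 + B)))"
        proof (cases "s \<in> {0..t}")
          case True
          then have s: "s \<in> {0..T}" using t by auto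
          have "expectation (\<lambda>\<omega>. norm (f j s (X s \<omega>))) \<le> expectation (\<lambda>\<omega>. \<bar>C j\<bar> * (1 + norm (X s \<omega>)))"
            using f_norm_le[OF s] X_integrable[OF s] f_integrable[OF s] by (intro integral_mono) auto
          also have "\<dots> = \<bar>C j\<bar> * (1 + expectation (\<lambda>\<omega>. norm (X s \<omega>)))"
            using X_integrable[OF s] by (simp add: prob_space)
          also have "\<dots> \<le> \<bar>C j\<bar> * (1 + B)" using B(2)[OF s] by (intro mult_left_mono) auto
          finally show ?thesis using True B(1) by (simp add: rate_joint_section(3)[OF t, simplified])
        next
          case False
          then show ?thesis using rate_joint_section(3)[OF t, of j s] by simp
        qed
      qed
    qed
    then show "integrable lborel (\<lambda>s. \<integral>\<omega>. norm (case (s, \<omega>) of (s, \<omega>) \<Rightarrow> rate_joint j t s \<omega>) \<partial>M)" by simp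
  qed
qed

text \<open>Outside a null set the absolute value is redundant; it makes the clock nonnegative everywhere.\<close>

definition clock_joint :: "'k \<Rightarrow> real \<Rightarrow> 'a \<Rightarrow> real" where
  "clock_joint j t \<omega> = \<bar>LINT s|lborel. rate_joint j t s \<omega>\<bar>"

lemma expected_clock:
  assumes t: "t \<in> {0..T}"
  shows "clock_joint j t \<in> borel_measurable M" "integrable M (clock_joint j t)"
    and "AE \<omega> in M. clock_joint j t \<omega> = (LBINT s:{0..t}. f j s (X s \<omega>))"
    and "expectation (clock_joint j t) = (LBINT s:{0..t}. expectation (\<lambda>\<omega>. f j s (X s \<omega>)))"
    and "set_integrable lborel {0..t} (\<lambda>s. expectation (\<lambda>\<omega>. f j s (X s \<omega>)))"
proof -
  interpret P: pair_sigma_finite lborel M ..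
  note I = rate_joint_integrable[OF t, of j]
  have J: "integrable M (\<lambda>\<omega>. LINT s|lborel. rate_joint j t s \<omega>)"
    using P.integrable_snd[OF I] .
  then show CI: "integrable M (clock_joint j t)" unfolding clock_joint_def[abs_def] by (rule integrable_abs)
  then show "clock_joint j t \<in> borel_measurable M" by (rule borel_measurable_integrable)
  have AE: "AE \<omega> in M. (LINT s|lborel. rate_joint j t s \<omega>) = (LBINT s:{0..t}. f j s (X s \<omega>))
     \<and> 0 \<le> (LBINT s:{0..t}. f j s (X s \<omega>))"
    using rate_joint_eq[OF t, of j] X_nonneg
  proof eventually_elim
    case (elim \<omega>)
    have "(LINT s|lborel. rate_joint j t s \<omega>) = (LBINT s:{0..t}. f j s (X s \<omega>))"
      using elim(1) by (simp add: set_lebesgue_integral_def)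
    moreover have "0 \<le> (LBINT s:{0..t}. f j s (X s \<omega>))"
      unfolding set_lebesgue_integral_def using elim(2) t
      by (intro Bochner_Integration.integral_nonneg) (auto simp: indicator_def)
    ultimately show ?case by simp
  qed
  show "AE \<omega> in M. clock_joint j t \<omega> = (LBINT s:{0..t}. f j s (X s \<omega>))"
    using AE by eventually_elim (simp add: clock_joint_def)
  have "expectation (clock_joint j t) = expectation (\<lambda>\<omega>. LINT s|lborel. rate_joint j t s \<omega>)"
  proof (rule integral_cong_AE)
    show "AE \<omega> in M. clock_joint j t \<omega> = (LINT s|lborel. rate_joint j t s \<omega>)"
      using AE by eventually_elim (simp add: clock_joint_def)
  qed (use J CI in \<open>auto intro: borel_measurable_integrable\<close>)
  also have "\<dots> = (LINT s|lborel. expectation (rate_joint j t s))"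
    by (rule P.Fubini_integral[OF I])
  also have "\<dots> = (LBINT s:{0..t}. expectation (\<lambda>\<omega>. f j s (X s \<omega>)))"
    by (simp add: rate_joint_section(2)[OF t] set_lebesgue_integral_def)
  finally show "expectation (clock_joint j t) = (LBINT s:{0..t}. expectation (\<lambda>\<omega>. f j s (X s \<omega>)))" .
  have "integrable lborel (\<lambda>s. expectation (rate_joint j t s))"
    using P.integrable_fst[OF I] .
  then show "set_integrable lborel {0..t} (\<lambda>s. expectation (\<lambda>\<omega>. f j s (X s \<omega>)))"
    by (simp add: rate_joint_section(2)[OF t] set_integrable_def)
qed

text \<open>Taking expectations in the time change equation is legitimate because the stopped counts
  are integrable; their means are expected clocks, and Fubini moves the expectation inside the time
  integral.\<close>

lemma mean_equation:
  assumes t: "t \<in> {0..T}"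
  shows "m t = x0 + (\<Sum>j\<in>UNIV. (LBINT s:{0..t}. expectation (\<lambda>\<omega>. f j s (X s \<omega>))) *\<^sub>R l j)"
proof -
  note \<rho> = expected_clock[OF t]
  define c where "c j \<omega> = real (rc_version (\<lambda>u. Y j u \<omega>) (clock_joint j t \<omega>))" for j \<omega>
  have c: "integrable M (c j)" "expectation (c j) = expectation (clock_joint j t)" for j
  proof -
    have "0 \<le> clock_joint j t \<omega>" for \<omega> by (simp add: clock_joint_def)
    from time_changed_count_mean[OF path_AE Y_poisson Y_indep rates_axioms t \<rho>(1) this \<rho>(2,3)]
    show "integrable M (c j)" "expectation (c j) = expectation (clock_joint j t)"
      unfolding c_def[abs_def] by auto
  qed
  have i: "integrable M (\<lambda>\<omega>. c j \<omega> *\<^sub>R l j)" for j using c(1) by (intro integrable_scaleR_left)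
  have "AE \<omega> in M. \<forall>j. clock_joint j t \<omega> = (LBINT s:{0..t}. f j s (X s \<omega>))"
    unfolding AE_all_countable using \<rho>(3) by blast
  then have "AE \<omega> in M. X t \<omega> = x0 + (\<Sum>j\<in>UNIV. c j \<omega> *\<^sub>R l j)"
    using path_AE
  proof eventually_elim
    case (elim \<omega>)
    interpret time_changed_path T x0 l f "\<lambda>j u. Y j u \<omega>" "\<lambda>u. X u \<omega>" by fact
    have "c j \<omega> = real (y j (\<tau> j t))" for j using elim by (simp add: c_def y_def \<tau>_def)
    then show ?case using x_eq_y[OF t] by simp
  qed
  then have "m t = expectation (\<lambda>\<omega>. x0 + (\<Sum>j\<in>UNIV. c j \<omega> *\<^sub>R l j))"
    unfolding m_def using X_measurable[OF t] i by (intro integral_cong_AE) (auto intro!: borel_measurable_integrable)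
  also have "\<dots> = x0 + (\<Sum>j\<in>UNIV. expectation (c j) *\<^sub>R l j)"
    using i c(1) by (subst Bochner_Integration.integral_add) (auto simp: prob_space)
  finally show ?thesis by (simp add: c(2) \<rho>(4))
qed

lemma mean_fluid_solution: "fluid_solution T x0 l (averaged_rate M X f) m"
  unfolding fluid_solution_def
proof (intro ballI conjI allI)
  fix t i assume t: "t \<in> {0..T}"
  have e: "indicator {0..t} s * averaged_rate M X f i s (m s) = indicator {0..t} s * expectation (\<lambda>\<omega>. f i s (X s \<omega>))" for s i
    using t averaged_rate_mean[of s i] by (cases "s \<in> {0..t}") auto
  show "set_integrable lborel {0..t} (\<lambda>s. averaged_rate M X f i s (m s))"
    using expected_clock(5)[OF t, of i] by (simp add: set_integrable_def e)
  show "m t = x0 + (\<Sum>i\<in>UNIV. (LBINT s:{0..t}. averaged_rate M X f i s (m s)) *\<^sub>R l i)"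
    using mean_equation[OF t] by (simp add: set_lebesgue_integral_def e)
qed

end

theorem theorem5:
  fixes M :: "'a measure"
    and T :: real
    and x0 :: "real^'d"
    and l :: "'k::finite \<Rightarrow> real^'d"
    and f :: "'k \<Rightarrow> real \<Rightarrow> real^'d \<Rightarrow> real"
    and Y :: "'k \<Rightarrow> real \<Rightarrow> 'a \<Rightarrow> nat"
    and X :: "real \<Rightarrow> 'a \<Rightarrow> real^'d"
    and Z :: "nat \<Rightarrow> real \<Rightarrow> 'a \<Rightarrow> real^'d"
    and g :: "'k \<Rightarrow> real \<Rightarrow> real^'d \<Rightarrow> real"
    and C :: "'k \<Rightarrow> real"
    and K :: real
  assumes "prob_space M"
    and "0 \<le> T"
    and "\<And>i j. l i $ j \<in> \<int>"
    and "\<And>i. continuous_on ({0..T} \<times> UNIV) (\<lambda>(t, x). f i t x)"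
    and "\<And>i. poisson_process M 1 (Y i)"
    and "independent_processes M Y"
    and "time_change_solution M T x0 l f Y X"
    and "AE \<omega> in M. \<forall>i. \<forall>s\<in>{0..T}. 0 \<le> f i s (X s \<omega>)"
    and "\<And>t. t \<in> {0..T} \<Longrightarrow> finite_mean_covariance M (X t)"
    and "bounded ((\<lambda>t. integral\<^sup>L M (X t)) ` {0..T})"
    and "bounded ((\<lambda>t. covariance_matrix M (X t)) ` {0..T})"
    and "g = averaged_rate M X f"
    and "\<And>n. n \<ge> 1 \<Longrightarrow>
           time_change_solution M T x0 (\<lambda>i. (1 / real n) *\<^sub>R l i) (\<lambda>i s x. real n * g i s x) Y (Z n)"
    and "\<And>n. n \<ge> 1 \<Longrightarrow> AE \<omega> in M. \<forall>i. \<forall>s\<in>{0..T}. 0 \<le> g i s (Z n s \<omega>)"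
    and "\<And>i t x. t \<in> {0..T} \<Longrightarrow> \<bar>f i t x\<bar> \<le> C i * (1 + norm x)"
    and "\<And>t x y. t \<in> {0..T} \<Longrightarrow> norm (drift l f t x - drift l f t y) \<le> K * norm (x - y)"
  shows "\<exists>Zbar. fluid_solution T x0 l g Zbar
           \<and> (\<forall>z. fluid_solution T x0 l g z \<longrightarrow> (\<forall>t\<in>{0..T}. z t = Zbar t))
           \<and> (\<forall>t\<in>{0..T}. AE \<omega> in M. (\<lambda>n. Z n t \<omega>) \<longlonglongrightarrow> Zbar t)
           \<and> (\<forall>t\<in>{0..T}. Zbar t = integral\<^sup>L M (X t)
                \<and> integral\<^sup>L M (X t)
                  = x0 + (\<Sum>i\<in>UNIV. (LBINT s:{0..t}. (LINT \<omega>|M. f i s (X s \<omega>))) *\<^sub>R l i))"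
proof -
  interpret prob_space M by fact
  interpret jump_model M T x0 l f Y X C
    by unfold_locales (use assms in auto)
  have g: "g = averaged_rate M X f" by fact
  have fluid: "fluid_solution T x0 l g m" unfolding g by (rule mean_fluid_solution)
  \<comment> \<open>\<open>K\<close> may be zero or negative, whereas the Gronwall estimate needs a
    positive rate.\<close>
  interpret lipschitz_drift T "\<bar>K\<bar> + 1" l g x0
  proof
    fix t x y assume t: "t \<in> {0..T}"
    have "norm (drift l g t x - drift l g t y) \<le> K * norm (x - y)"
      unfolding g by (rule averaged_drift_lipschitz[OF t assms(16)[OF t]])
    also have "\<dots> \<le> (\<bar>K\<bar> + 1) * norm (x - y)" by (intro mult_right_mono) auto
    finally show "norm (drift l g t x - drift l g t y) \<le> (\<bar>K\<bar> + 1) * norm (x - y)" .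
  qed simp
  obtain G where G: "\<And>j t x. t \<in> {0..T} \<Longrightarrow> \<bar>g j t x\<bar> \<le> G * (1 + norm x)"
    using averaged_rate_growth unfolding g by blast
  \<comment> \<open>One null set serves all \<open>n\<close>, since countably many are
    united.\<close>
  have "AE \<omega> in M. \<forall>n\<ge>1. \<forall>t\<in>{0..T}.
        (\<forall>i. set_integrable lborel {0..t} (\<lambda>s. real n * g i s (Z n s \<omega>))) \<and>
        Z n t \<omega> = x0 + (\<Sum>i\<in>UNIV. real (Y i (LBINT s:{0..t}. real n * g i s (Z n s \<omega>)) \<omega>) *\<^sub>R (1 / real n) *\<^sub>R l i)"
    using assms(13) unfolding time_change_solution_def by (auto simp: AE_all_countable)
  moreover have "AE \<omega> in M. \<forall>n\<ge>1. \<forall>i. \<forall>s\<in>{0..T}. 0 \<le> g i s (Z n s \<omega>)"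
    using assms(14) by (simp add: AE_all_countable)
  moreover have "AE \<omega> in M. \<forall>i. \<forall>\<delta>>0. \<exists>A. \<forall>v\<ge>0. \<bar>real (Y i v \<omega>) - v\<bar> \<le> A + \<delta> * v"
    unfolding AE_all_countable using poisson_process_deviation[OF Y_poisson] by blast
  \<comment> \<open>The argument is pathwise from here on, so the exceptional null set does not
    depend on \<open>t\<close> either.\<close>
  ultimately have conv: "AE \<omega> in M. \<forall>t\<in>{0..T}. (\<lambda>n. Z n t \<omega>) \<longlonglongrightarrow> m t"
  proof eventually_elim
    case (elim \<omega>)
    interpret scaled_paths T "\<bar>K\<bar> + 1" l g x0 "\<lambda>i u. Y i u \<omega>" "\<lambda>n t. Z n t \<omega>" G
    proof
      show "\<bar>g i t x\<bar> \<le> G * (1 + norm x)" if "t \<in> {0..T}" for i t x by (rule G[OF that])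
      show "\<exists>A. \<forall>v\<ge>0. \<bar>real (Y i v \<omega>) - v\<bar> \<le> A + \<delta> * v" if "0 < \<delta>" for i \<delta>
        using elim(3) that by blast
      show "0 \<le> g i t (Z n t \<omega>)" if "1 \<le> n" "t \<in> {0..T}" for n t i
        using elim(2) that by blast
      fix n :: nat and t :: real assume n: "1 \<le> n" and t: "t \<in> {0..T}"
      have si: "set_integrable lborel {0..t} (\<lambda>s. real n * g i s (Z n s \<omega>))" for i
        using elim(1) n t by blast
      show "set_integrable lborel {0..t} (\<lambda>s. g i s (Z n s \<omega>))" for i
        using si[of i] n by (simp add: set_integrable_mult_right_iff)
      show "Z n t \<omega> = x0 + (\<Sum>i\<in>UNIV. (real (Y i (real n * (LBINT s:{0..t}. g i s (Z n s \<omega>))) \<omega>) / real n) *\<^sub>R l i)"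
        using elim(1) n t by (simp add: set_integral_mult_right)
    qed
    show ?case using convergence[OF fluid] by blast
  qed
  show ?thesis
  proof (intro exI[of _ m] conjI ballI allI impI)
    fix t assume t: "t \<in> {0..T}"
    show "AE \<omega> in M. (\<lambda>n. Z n t \<omega>) \<longlonglongrightarrow> m t" using conv by eventually_elim (use t in blast)
    show "m t = integral\<^sup>L M (X t)" by (simp add: m_def)
    show "integral\<^sup>L M (X t) = x0 + (\<Sum>i\<in>UNIV. (LBINT s:{0..t}. (LINT \<omega>|M. f i s (X s \<omega>))) *\<^sub>R l i)"
      using mean_equation[OF t] by (simp add: m_def)
    show "z t = m t" if "fluid_solution T x0 l g z" for z
      by (rule fluid_solution_unique[OF that fluid t])
  qed (rule fluid)
qed

end
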